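(* Let $d\ge 4$ and let $\{\mathbf S_n\}_{n\ge 0}$ be the simple symmetric random walk on $\mathbb{Z}^d$ started at $\mathbf 0$. For each $\varepsilon>0$, with probability 1 there exists a (random) $n_0=n_0(\varepsilon)$ such that if $n\ge n_0$ then: (i) $(\xi(\mathbf z,n),\Xi(\mathbf z,n))\in ((1+\varepsilon)\log n)\,\mathcal D$ for all $\mathbf z\in\mathbb{Z}^d$; (ii) for any pair of nonnegative integers $(k,\ell)\in ((1-\varepsilon)\log n)\,\mathcal D$ there exists a random $\mathbf z\in\mathbb{Z}^d$ for which $$(\xi(\mathbf z,n),\Xi(\mathbf z,n))=(k,\ell+1).$$
   Context: Simple symmetric random walk on $\mathbb{Z}^d$: $\mathbf S_0=\mathbf 0$, $\mathbf S_n=\sum_{k=1}^n\mathbf X_k$, with $\mathbf X_k$ i.i.d., $\mathbf P(\mathbf X_1=\mathbf e_i)=\frac1{2d}$ for $i=1,\dots,2d$, where $\mathbf e_1,\dots,\mathbf e_d$ are the standard orthogonal unit vectors and $\mathbf e_{d+j}=-\mathbf e_j$, $j=1,\dots,d$. Local time: $\xi(\mathbf z,n)=\#\{k: 0<k\le n,\ \mathbf S_k=\mathbf z\}$ (time $0$ is not counted). $\mathcal S(1)=\{\mathbf z\in\mathbb{Z}^d:\|\mathbf z\|=1\}=\{\mathbf e_1,\dots,\mathbf e_{2d}\}$ (Euclidean norm), and $\Xi(\mathbf z,n)=\sum_{\mathbf u\in\mathcal S(1)+\mathbf z}\xi(\mathbf u,n)=\sum_{i=1}^{2d}\xi(\mathbf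 z+\mathbf e_i,n)$ is the occupation time of the surface of the unit ball centered at $\mathbf z$. Let $T=\min\{i\ge1:\mathbf S_i=\mathbf 0\}$ and $T_{\mathcal S(1)}=\min\{i\ge 1:\mathbf S_i\in\mathcal S(1)\}$ (with value $\infty$ if no such $i$), and let $\mathbf P_{\mathbf z}$ be the law of the walk started from $\mathbf z$. Put $p=\mathbf P_{\mathbf e_1}(T_{\mathcal S(1)}<T)$ (including the case $T_{\mathcal S(1)}<T=\infty$). $\mathcal D=\{(x,y)\in\mathbb{R}^2: y\ge x\ge0,\ -y\log y+x\log(2dx)+(y-x)\log((y-x)/p)\le1\}$, with the convention that a term of the form $0\log 0$ equals $0$. For real $c$, $c\,\mathcal D=\{(cx,cy):(x,y)\in\mathcal D\}$. *)

theory Defs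
  imports "HOL-Probability.Probability"
begin

text \<open>The lattice \<open>\<int>\<^sup>d\<close> is the type \<^typ>\<open>int ^ 'd\<close> with \<open>d = CARD('d)\<close>.\<close>

definition lattice_norm :: "int ^ 'd \<Rightarrow> real" where
  "lattice_norm z = norm (\<chi> i. real_of_int (z $ i))"

definition unit_sphere :: "(int ^ 'd) set" where
  "unit_sphere = {z. lattice_norm z = 1}"

definition unit_steps :: "(int ^ 'd) set" where
  "unit_steps = range (\<lambda>j. axis j 1) \<union> range (\<lambda>j. - axis j 1)"

lemma unit_sphere_eq_unit_steps: "unit_sphere = unit_steps"
proof -
  have sq: "(norm (\<chi> i. real_of_int (z $ i)))\<^sup>2 = real_of_int (\<Sum>i\<in>UNIV. (z $ i)\<^sup>2)"
    for z :: "int ^ 'd"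
    by (simp add: norm_vec_def L2_set_def sum_nonneg)
  have sphere_iff: "z \<in> unit_sphere \<longleftrightarrow> (\<Sum>i\<in>UNIV. (z $ i)\<^sup>2) = 1" for z :: "int ^ 'd"
  proof -
    have "z \<in> unit_sphere \<longleftrightarrow> (norm (\<chi> i. real_of_int (z $ i)))\<^sup>2 = 1"
      by (auto simp: unit_sphere_def lattice_norm_def power2_eq_1_iff)
        (metis norm_ge_zero not_one_le_zero le_minus_one_simps(3))
    then show ?thesis
      unfolding sq by (metis of_int_1 of_int_eq_iff)
  qed
  have "z \<in> unit_steps" if "z \<in> unit_sphere" for z :: "int ^ 'd"
  proof -
    have s: "(\<Sum>i\<in>UNIV. (z $ i)\<^sup>2) = 1"
      using that sphere_iff by blast
    then obtain j where j: "z $ j \<noteq> 0"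
      by (metis (mono_tags, lifting) sum.neutral zero_neq_one zero_power2)
    have split: "(z $ j)\<^sup>2 + (\<Sum>i\<in>UNIV - {j}. (z $ i)\<^sup>2) = 1"
      using s by (simp add: sum.remove)
    have nn: "(\<Sum>i\<in>UNIV - {j}. (z $ i)\<^sup>2) \<ge> 0"
      by (simp add: sum_nonneg)
    have "(z $ j)\<^sup>2 \<ge> 1"
      using j by (smt (verit) zero_less_power2)
    then have zj: "(z $ j)\<^sup>2 = 1" and "(\<Sum>i\<in>UNIV - {j}. (z $ i)\<^sup>2) = 0"
      using split nn by linarith+
    then have other: "z $ i = 0" if "i \<noteq> j" for i
      using that by (simp add: sum_nonneg_eq_0_iff)
    from zj have "z $ j = 1 \<or> z $ j = - 1"
      by (simp add: power2_eq_1_iff)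
    then have "z = axis j 1 \<or> z = - axis j 1"
      using other by (auto simp: vec_eq_iff axis_def)
    then show ?thesis
      by (auto simp: unit_steps_def)
  qed
  moreover have "z \<in> unit_sphere" if step: "z \<in> unit_steps" for z :: "int ^ 'd"
  proof -
    obtain j where "z = axis j 1 \<or> z = - axis j 1"
      using step unfolding unit_steps_def by blast
    then have "(z $ i)\<^sup>2 = (if i = j then 1 else 0)" for i
      by (auto simp: axis_def)
    then show ?thesis
      by (simp add: sphere_iff)
  qed
  ultimately show ?thesis
    by blast
qed

text \<open>\<open>\<^bold>X\<^sub>1, \<^bold>X\<^sub>2, \<dots>\<close> are the steps of a simple symmetric random walk; \<open>X 0\<close> is not used.\<close>

locale simple_random_walk = prob_space M
  for M :: "'a measure" +
  fixes X :: "nat \<Rightarrow> 'a \<Rightarrow> int ^ 'd"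
  assumes indep_steps: "indep_vars (\<lambda>_. count_space UNIV) X {1..}"
    and prob_step: "\<And>k e. k \<ge> 1 \<Longrightarrow> e \<in> unit_steps \<Longrightarrow>
          prob {\<omega> \<in> space M. X k \<omega> = e} = 1 / (2 * real CARD('d))"

definition walk :: "int ^ 'd \<Rightarrow> (nat \<Rightarrow> int ^ 'd) \<Rightarrow> nat \<Rightarrow> int ^ 'd" where
  "walk z x n = z + (\<Sum>k=1..n. x k)"

text \<open>The law \<open>\<^bold>P\<^sub>z\<close>, on path space, of the simple symmetric random walk started from \<open>z\<close>.\<close>

definition walk_law :: "int ^ 'd \<Rightarrow> (nat \<Rightarrow> int ^ 'd) measure" where
  "walk_law z =
     distr (\<Pi>\<^sub>M k\<in>{1..}. measure_pmf (pmf_of_set unit_steps)) (\<Pi>\<^sub>M n\<in>UNIV. count_space UNIV) (walk z)"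

text \<open>The infimum over the empty set is \<open>\<infinity>\<close>, so never hitting \<open>A\<close> gives the value \<open>\<infinity>\<close>.\<close>

definition hitting_time :: "(int ^ 'd) set \<Rightarrow> (nat \<Rightarrow> int ^ 'd) \<Rightarrow> enat" where
  "hitting_time A s = (INF i\<in>{i. i \<ge> 1 \<and> s i \<in> A}. enat i)"

text \<open>For a unit vector \<open>u\<close> this is \<open>p = \<^bold>P\<^sub>u(T\<^sub>S\<^sub>(\<^sub>1\<^sub>) < T)\<close>.\<close>

definition sphere_before_origin_prob :: "int ^ 'd \<Rightarrow> real" where
  "sphere_before_origin_prob u =
     measure (walk_law u)
       {s \<in> space (walk_law u). hitting_time unit_sphere s < hitting_time {0} s}"

definition local_time :: "(nat \<Rightarrow> int ^ 'd) \<Rightarrow> int ^ 'd \<Rightarrow> nat \<Rightarrow> nat" where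
  "local_time s z n = card {k. 0 < k \<and> k \<le> n \<and> s k = z}"

definition sphere_occupation_time :: "(nat \<Rightarrow> int ^ 'd) \<Rightarrow> int ^ 'd \<Rightarrow> nat \<Rightarrow> nat" where
  "sphere_occupation_time s z n = (\<Sum>u\<in>(\<lambda>v. v + z) ` unit_sphere. local_time s u n)"

text \<open>The convention \<open>0 log 0 = 0\<close> holds automatically, since \<^prop>\<open>0 * ln t = (0::real)\<close> for all \<open>t\<close>.\<close>

definition limit_region :: "nat \<Rightarrow> real \<Rightarrow> (real \<times> real) set" where
  "limit_region d p =
     {(x, y). y \<ge> x \<and> x \<ge> 0 \<and>
        - y * ln y + x * ln (2 * real d * x) + (y - x) * ln ((y - x) / p) \<le> 1}"

end

theory Submission
  imports Defs "HOL-Real_Asymp.Real_Asymp"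
begin

text \<open>Once the walk has entered the sphere around \<open>z\<close>, each visit to the sphere is followed by a visit
  to \<open>z\<close> with probability \<open>1 / (2d)\<close>, by a direct return to the sphere with probability \<open>p\<close>, and
  otherwise by an escape. So the pair of occupation times ends in \<open>(k, l + 1)\<close> with probability of order
  \<open>binomial l k * (1 / (2d)) ^ k * p ^ (l - k)\<close>, which up to a factor \<open>l + 1\<close> is \<open>exp (- f (k, l))\<close> for the
  homogeneous function \<open>f\<close> that defines the limit region. Up to time \<open>n\<close> the walk enters at most \<open>2 d n\<close>
  spheres, so values of \<open>f\<close> above \<open>(1 + \<epsilon>) log n\<close> are excluded by a union bound and Borel-Cantelli along
  \<open>n = 2 ^ i\<close>. Conversely, for \<open>f (k, l) \<le> (1 - \<epsilon>) log n\<close> one looks for a centre with the prescribed counts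
  in about \<open>n ^ (2 \<eta>) exp (f (k, l))\<close> disjoint, hence independent, time blocks of length \<open>n ^ (4 \<eta>)\<close>;
  this fails with polynomially small probability. The number of blocks is so small that
  with high probability none of the centres found is visited outside its block: a visit more than \<open>L\<close>
  steps away has probability \<open>O(1 / L)\<close>, as \<open>P (S n = x) = O(n ^ (- 2))\<close> for \<open>d \<ge> 4\<close>.\<close>

section \<open>Averages over words of steps\<close>

text \<open>Estimates are made for averages over finite words of steps, where conditioning on a step
  or a prefix is an identity between finite sums; only the last two sections involve probability
  spaces. The obstacle in the lower bound is that an event of weight \<open>w\<close> needs more
  than \<open>1 / w\<close> blocks to occur, so a revisit probability \<open>O(1 / L)\<close> per
  block is useless unless it comes multiplied by \<open>w\<close>. Hence \<open>settled\<close> and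
  \<open>started\<close>, which separate the prescribed counts from the revisit in time; visits
  before the block are treated by reading the past backwards. A second loss is that only direct
  returns within a fixed time \<open>T\<close> fit into a block, and their probability is below
  \<open>p\<close>. Since l = O(log n) on the region, a large \<open>T\<close> limits this loss to a
  factor n^\<eta>. With x = n^\<eta>, about x^2 / w blocks of length about x^4 are used: misses have
  probability exp(- c x), revisits about x^2 / x^4, and everything fits into time n because \<delta>
  = 8 \<eta>. Centres within distance 1 of the start are not entered from outside; there transience
  keeps the counts bounded.\<close>

lemma finite_unit_steps [simp]: "finite (unit_steps :: (int ^ 'd) set)"
  by (simp add: unit_steps_def)

lemma axis_one_eq_iff: "axis i (1::int) = axis j 1 \<longleftrightarrow> i = j"
  by (simp add: axis_eq_axis)

lemma axis_neq_uminus_axis: "axis i (1::int) \<noteq> - axis j 1"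
proof
  assume "axis i (1::int) = - axis j 1"
  then have "axis i (1::int) $ i = (- axis j 1) $ i" by simp
  then show False by (auto simp: axis_def split: if_splits)
qed

lemma sum_unit_steps:
  fixes F :: "int ^ 'd \<Rightarrow> 'a :: comm_monoid_add"
  shows "(\<Sum>e\<in>unit_steps. F e) = (\<Sum>i\<in>UNIV. F (axis i 1) + F (- axis i 1))"
proof -
  have "range (\<lambda>j. axis j (1::int)) \<inter> range (\<lambda>j. - axis j 1) = {}"
    using axis_neq_uminus_axis by auto
  then have "(\<Sum>e\<in>unit_steps. F e) =
      (\<Sum>e\<in>range (\<lambda>j. axis j 1). F e) + (\<Sum>e\<in>range (\<lambda>j. - axis j 1). F e)"
    unfolding unit_steps_def by (intro sum.union_disjoint) auto
  also have "\<dots> = (\<Sum>i\<in>UNIV. F (axis i 1)) + (\<Sum>i\<in>UNIV. F (- axis i 1))"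
    by (intro arg_cong2[of _ _ _ _ "(+)"]; subst sum.reindex)
       (auto simp: inj_on_def axis_one_eq_iff)
  finally show ?thesis by (simp add: sum.distrib)
qed

lemma card_unit_steps: "card (unit_steps :: (int ^ 'd) set) = 2 * CARD('d)"
  using sum_unit_steps[of "\<lambda>_ :: int ^ 'd. 1::nat"] by simp

lemma uminus_unit_steps [simp]: "- e \<in> unit_steps \<longleftrightarrow> e \<in> unit_steps"
  by (auto simp: unit_steps_def image_iff) (metis minus_minus)

lemma zero_notin_unit_steps [simp]: "0 \<notin> unit_steps"
  by (auto simp: unit_steps_def image_iff axis_def vec_eq_iff)

lemma axis_in_unit_steps [simp]: "axis j 1 \<in> unit_steps"
  by (simp add: unit_steps_def)

lemma odd_sum_unit_steps:
  assumes "e \<in> unit_steps"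
  shows "odd (\<Sum>i\<in>UNIV. e $ i)"
proof -
  have "(\<Sum>i\<in>UNIV. axis j (1::int) $ i) = 1" for j :: 'a
    by (simp add: axis_def)
  then show ?thesis
    using assms by (auto simp: unit_steps_def sum_negf)
qed

lemma add_unit_steps_notin:
  assumes "x \<in> unit_steps" "e \<in> unit_steps"
  shows "x + e \<notin> unit_steps"
proof
  assume "x + e \<in> unit_steps"
  from odd_sum_unit_steps[OF this] odd_sum_unit_steps[OF assms(1)] odd_sum_unit_steps[OF assms(2)]
  show False by (simp add: sum.distrib)
qed

lemma add_eq_zero_unit_steps:
  fixes x e :: "int ^ 'd"
  assumes "x + e = 0" "e \<in> unit_steps"
  shows "x \<in> unit_steps"
  using assms by (metis add_eq_0_iff uminus_unit_steps)

text \<open>The expectation of \<open>g\<close> over \<open>n\<close> independent uniform unit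
  steps. Recursion on the first step makes the Markov property definitional;
  \<open>word_mean_append\<close> is its form for a whole prefix.\<close>

primrec word_mean :: "nat \<Rightarrow> ((int ^ 'd) list \<Rightarrow> real) \<Rightarrow> real" where
  "word_mean 0 g = g []"
| "word_mean (Suc n) g = (\<Sum>e\<in>unit_steps. word_mean n (\<lambda>l. g (e # l))) / (2 * real CARD('d))"

abbreviation word_prob :: "nat \<Rightarrow> ((int ^ 'd) list \<Rightarrow> bool) \<Rightarrow> real" where
  "word_prob n Q \<equiv> word_mean n (\<lambda>l. of_bool (Q l))"

lemma word_mean_add: "word_mean n (\<lambda>l. g l + h l) = word_mean n g + word_mean n h"
  by (induction n arbitrary: g h) (simp_all add: sum.distrib add_divide_distrib)

lemma word_mean_cmult: "word_mean n (\<lambda>l. c * g l) = c * word_mean n g"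
  by (induction n arbitrary: g) (simp_all add: sum_distrib_left)

lemma word_mean_zero: "word_mean n (\<lambda>l. 0) = 0"
  using word_mean_cmult[of n 0] by simp

lemma word_mean_const [simp]: "word_mean n (\<lambda>l. c) = c"
  by (induction n) (simp_all add: card_unit_steps)

lemma word_mean_sum: "word_mean n (\<lambda>l. \<Sum>a\<in>A. g a l) = (\<Sum>a\<in>A. word_mean n (g a))"
proof (induction n arbitrary: g)
  case (Suc n)
  show ?case
    by (simp add: Suc sum.swap[of _ unit_steps] sum_divide_distrib)
qed simp

lemma word_mean_mono:
  assumes "\<And>l. length l = n \<Longrightarrow> set l \<subseteq> unit_steps \<Longrightarrow> g l \<le> h l"
  shows "word_mean n g \<le> word_mean n h"
  using assms
proof (induction n arbitrary: g h)
  case (Suc n)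
  show ?case
    unfolding word_mean.simps
    by (intro divide_right_mono sum_mono Suc.IH Suc.prems) auto
qed simp

lemma word_mean_cong:
  assumes "\<And>l. length l = n \<Longrightarrow> set l \<subseteq> unit_steps \<Longrightarrow> g l = h l"
  shows "word_mean n g = word_mean n h"
  by (intro antisym word_mean_mono) (auto simp: assms)

lemma word_mean_nonneg:
  assumes "\<And>l. length l = n \<Longrightarrow> set l \<subseteq> unit_steps \<Longrightarrow> 0 \<le> g l"
  shows "0 \<le> word_mean n g"
  using word_mean_mono[of n "\<lambda>_. 0" g] assms by simp

lemma word_mean_append: "word_mean (m + n) g = word_mean m (\<lambda>a. word_mean n (\<lambda>b. g (a @ b)))"
  by (induction m arbitrary: g) simp_all

lemma word_mean_append_mult:
  "word_mean (m + n) (\<lambda>l. g (take m l) * h (drop m l)) = word_mean m g * word_mean n h"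
proof -
  have "word_mean (m + n) (\<lambda>l. g (take m l) * h (drop m l)) =
      word_mean m (\<lambda>a. word_mean n (\<lambda>b. g a * h b))"
    unfolding word_mean_append by (intro word_mean_cong) simp
  also have "\<dots> = word_mean m (\<lambda>a. word_mean n h * g a)"
    by (simp add: word_mean_cmult mult.commute)
  finally show ?thesis by (simp only: word_mean_cmult mult.commute[of "word_mean m g"])
qed

lemma word_mean_take: "word_mean (m + n) (\<lambda>l. g (take m l)) = word_mean m g"
  using word_mean_append_mult[of m n g "\<lambda>_. 1"] by simp

lemma word_mean_drop: "word_mean (m + n) (\<lambda>l. h (drop m l)) = word_mean n h"
  using word_mean_append_mult[of m n "\<lambda>_. 1" h] by simp

lemma word_mean_snoc:
  "word_mean (Suc n) (g :: (int ^ 'd) list \<Rightarrow> real) =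
     (\<Sum>e\<in>unit_steps. word_mean n (\<lambda>l. g (l @ [e]))) / (2 * real CARD('d))"
proof -
  have "word_mean (Suc n) g = word_mean n (\<lambda>a. word_mean 1 (\<lambda>b. g (a @ b)))"
    using word_mean_append[of n 1 g] by simp
  also have "\<dots> = word_mean n (\<lambda>a. (1 / (2 * real CARD('d))) * (\<Sum>e\<in>unit_steps. g (a @ [e])))"
    by simp
  also have "\<dots> = (1 / (2 * real CARD('d))) * (\<Sum>e\<in>unit_steps. word_mean n (\<lambda>a. g (a @ [e])))"
    by (simp only: word_mean_cmult word_mean_sum)
  finally show ?thesis by simp
qed

lemma word_mean_rev: "word_mean n (\<lambda>l. g (rev l)) = word_mean n g"
proof (induction n arbitrary: g)
  case (Suc n)
  show ?case
    unfolding word_mean_snoc[of n g] by (simp add: Suc[of "\<lambda>l. g (l @ [_])"])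
qed simp

lemma word_mean_map:
  fixes \<sigma> :: "int ^ 'd \<Rightarrow> int ^ 'd"
  assumes "bij_betw \<sigma> unit_steps unit_steps"
  shows "word_mean n (\<lambda>l. g (map \<sigma> l)) = word_mean n g"
proof (induction n arbitrary: g)
  case (Suc n)
  have "(\<Sum>e\<in>unit_steps. word_mean n (\<lambda>l. g (\<sigma> e # map \<sigma> l))) =
      (\<Sum>e\<in>unit_steps. word_mean n (\<lambda>l. g (\<sigma> e # l)))"
    by (simp add: Suc[of "\<lambda>l. g (_ # l)"])
  also have "\<dots> = (\<Sum>e\<in>unit_steps. word_mean n (\<lambda>l. g (e # l)))"
    by (rule sum.reindex_bij_betw[OF assms])
  finally show ?case by simp
qed simp

lemma bij_betw_uminus_unit_steps: "bij_betw uminus (unit_steps :: (int ^ 'd) set) unit_steps"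
  by (rule bij_betw_byWitness[where f' = uminus]) auto

lemma word_prob_mono:
  assumes "\<And>l. length l = n \<Longrightarrow> set l \<subseteq> unit_steps \<Longrightarrow> P l \<Longrightarrow> Q l"
  shows "word_prob n P \<le> word_prob n Q"
  using assms by (intro word_mean_mono) auto

lemma word_prob_nonneg: "0 \<le> word_prob n P"
  by (intro word_mean_nonneg) simp

lemma word_prob_le_1: "word_prob n P \<le> 1"
  using word_mean_mono[of n "\<lambda>l. of_bool (P l)" "\<lambda>_. 1"] by simp

lemma word_prob_compl: "word_prob n (\<lambda>l. \<not> P l) = 1 - word_prob n P"
  using word_mean_add[of n "\<lambda>l. of_bool (P l)" "\<lambda>l. of_bool (\<not> P l)"]
  by (simp flip: of_bool_or_iff add: of_bool_not_iff)

lemma word_prob_union: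
  fixes P :: "(int ^ 'd) list \<Rightarrow> bool"
  assumes "finite A" "\<And>l. length l = n \<Longrightarrow> set l \<subseteq> unit_steps \<Longrightarrow> P l \<Longrightarrow> \<exists>a\<in>A. Q a l"
  shows "word_prob n P \<le> (\<Sum>a\<in>A. word_prob n (Q a))"
proof -
  have "word_prob n P \<le> word_mean n (\<lambda>l. \<Sum>a\<in>A. of_bool (Q a l))"
  proof (rule word_mean_mono)
    fix l :: "(int ^ 'd) list" assume l: "length l = n" "set l \<subseteq> unit_steps"
    show "of_bool (P l) \<le> (\<Sum>a\<in>A. of_bool (Q a l) :: real)"
    proof (cases "P l")
      case True
      then obtain a where a: "a \<in> A" "Q a l" using assms(2) l by blast
      then have "of_bool (Q a l) \<le> (\<Sum>a\<in>A. of_bool (Q a l) :: real)"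
        using assms(1) by (intro member_le_sum) auto
      then show ?thesis using a True by simp
    qed (simp add: sum_nonneg)
  qed
  then show ?thesis by (simp only: word_mean_sum)
qed

lemma word_prob_disj: "word_prob n (\<lambda>l. P l \<or> Q l) \<le> word_prob n P + word_prob n Q"
  by (subst word_mean_add[symmetric], rule word_mean_mono) auto

text \<open>The word lists the steps of a path from \<open>x\<close>. The starting point is not
  counted, just as local times leave out time 0.\<close>

primrec visits :: "(int ^ 'd) set \<Rightarrow> int ^ 'd \<Rightarrow> (int ^ 'd) list \<Rightarrow> nat" where
  "visits A x [] = 0"
| "visits A x (e # l) = of_bool (x + e \<in> A) + visits A (x + e) l"

lemma visits_append: "visits A x (a @ b) = visits A x a + visits A (x + sum_list a) b"
  by (induction a arbitrary: x) (simp_all add: add.assoc)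

lemma visits_eq_card: "visits A x l = card {i. 0 < i \<and> i \<le> length l \<and> x + sum_list (take i l) \<in> A}"
proof (induction l rule: rev_induct)
  case (snoc e l)
  let ?S = "\<lambda>l. {i. 0 < i \<and> i \<le> length l \<and> x + sum_list (take i l) \<in> A}"
  have "?S (l @ [e]) = ?S l \<union> (if x + sum_list (l @ [e]) \<in> A then {Suc (length l)} else {})"
    by (auto simp: le_Suc_eq)
  moreover have "finite (?S l)" by simp
  moreover have "Suc (length l) \<notin> ?S l" by simp
  ultimately have "card (?S (l @ [e])) = card (?S l) + of_bool (x + sum_list (l @ [e]) \<in> A)"
    by (simp del: sum_list_append)
  then show ?case by (simp add: visits_append snoc add.assoc)
qed auto

lemma visits_eq_0_iff:
  "visits A x l = 0 \<longleftrightarrow> (\<forall>i. 0 < i \<longrightarrow> i \<le> length l \<longrightarrow> x + sum_list (take i l) \<notin> A)"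
  unfolding visits_eq_card by auto

lemma visits_take_le: "visits A x (take i l) \<le> visits A x l"
  using visits_append[of A x "take i l" "drop i l"] by simp

lemma visits_mono: "A \<subseteq> B \<Longrightarrow> visits A x l \<le> visits B x l"
  by (induction l arbitrary: x) (auto simp: of_bool_def intro: le_SucI)

lemma visits_le_length: "visits A x l \<le> length l"
  by (induction l arbitrary: x) (auto intro!: le_SucI simp: of_bool_def)

section \<open>Heat kernel\<close>

text \<open>The transition operator of the walk; \<open>word_mean_endpoint\<close> identifies its
  powers with expectations at the end point.\<close>

definition step_avg :: "(int ^ 'd \<Rightarrow> real) \<Rightarrow> int ^ 'd \<Rightarrow> real" where
  "step_avg h x = (\<Sum>e\<in>unit_steps. h (x + e)) / (2 * real CARD('d))"

lemma word_mean_endpoint: "word_mean n (\<lambda>l. h (x + sum_list l)) = (step_avg ^^ n) h x"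
proof (induction n arbitrary: x)
  case (Suc n)
  have "word_mean (Suc n) (\<lambda>l. h (x + sum_list l)) = step_avg ((step_avg ^^ n) h) x"
    by (simp add: step_avg_def Suc[symmetric] add.assoc)
  then show ?case by simp
qed simp

section \<open>The one-dimensional kernel\<close>

definition step_avg1 :: "(int \<Rightarrow> real) \<Rightarrow> int \<Rightarrow> real" where
  "step_avg1 h y = (h (y + 1) + h (y - 1)) / 2"

text \<open>With \<open>a k\<close> the quotient,
  \<open>a (k + 1) = a k * (2 k + 1) / (2 k + 2)\<close>. As (2k + 1)(2k + 3) \<le> (2k + 2)^2, the
  left-hand side decreases from its value 1 at k = 0.\<close>

lemma central_binomial_sq_bound: "(real (2 * k choose k) / 4 ^ k)\<^sup>2 * (2 * real k + 1) \<le> 1"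
proof (induction k)
  case (Suc k)
  let ?a = "\<lambda>k. real (2 * k choose k) / 4 ^ k"
  have rec: "?a (Suc k) = ?a k * ((2 * real k + 1) / (2 * real k + 2))"
  proof -
    have "2 * Suc k choose Suc k = 2 * (Suc (2 * k) choose Suc k)"
      using binomial_symmetric[of k "Suc (2 * k)"] by simp
    moreover have "Suc k * (Suc (2 * k) choose Suc k) = Suc (2 * k) * (2 * k choose k)"
      by (rule Suc_times_binomial)
    ultimately have "Suc k * (2 * Suc k choose Suc k) = 2 * Suc (2 * k) * (2 * k choose k)"
      by (simp only: mult.left_commute mult.assoc)
    then have "real (Suc k) * real (2 * Suc k choose Suc k) = 2 * real (Suc (2 * k)) * real (2 * k choose k)"
      by (metis of_nat_mult of_nat_numeral)
    then have "real (2 * Suc k choose Suc k) = 2 * real (Suc (2 * k)) * real (2 * k choose k) / real (Suc k)"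
      by (metis nonzero_mult_div_cancel_left of_nat_eq_0_iff nat.distinct(1))
    then show ?thesis
      by (simp only: power_Suc) (simp add: divide_simps, simp add: algebra_simps)
  qed
  have "(?a (Suc k))\<^sup>2 * (2 * real (Suc k) + 1) =
      ((?a k)\<^sup>2 * (2 * real k + 1)) * ((2 * real k + 1) * (2 * real k + 3) / (2 * real k + 2)\<^sup>2)"
    unfolding rec power_mult_distrib power_divide by (simp add: power2_eq_square field_simps)
  also have "\<dots> \<le> 1 * 1"
  proof (intro mult_mono)
    show "(2 * real k + 1) * (2 * real k + 3) / (2 * real k + 2)\<^sup>2 \<le> 1"
      by (simp add: power2_eq_square divide_simps) (simp add: algebra_simps)
  qed (use Suc in auto)
  finally show ?case by simp
qed simp

lemma binomial_over_power_bound: "real (m choose k) / 2 ^ m \<le> 1 / sqrt (real m + 1)"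
proof -
  have mid: "real (m choose (m div 2)) / 2 ^ m \<le> 1 / sqrt (real m + 1)"
  proof (cases "even m")
    case True
    then obtain j where j: "m = 2 * j" by blast
    have "(real (2 * j choose j) / 4 ^ j)\<^sup>2 \<le> 1 / (2 * real j + 1)"
      using central_binomial_sq_bound[of j] by (simp add: field_simps)
    then have "real (2 * j choose j) / 4 ^ j \<le> sqrt (1 / (2 * real j + 1))"
      by (rule real_le_rsqrt)
    then show ?thesis by (simp add: j power_mult real_sqrt_divide)
  next
    case False
    then obtain j where j: "m = 2 * j + 1" using oddE by blast
    \<comment> \<open>An odd row has two equal middle entries, which add up to the middle entry of
      the next row; this reduces it to the even case.\<close>
    have "2 * (2 * j + 1 choose j) = 2 * Suc j choose Suc j"
      using binomial_symmetric[of j "2 * j + 1"] by simp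
    then have "real (2 * j + 1 choose j) = real (2 * Suc j choose Suc j) / 2"
      by linarith
    then have eq: "real (m choose (m div 2)) / 2 ^ m = real (2 * Suc j choose Suc j) / 4 ^ Suc j"
    proof -
      have "m div 2 = j" "(2 :: real) ^ m = 2 * 4 ^ j" using j by (simp_all add: power_mult)
      then show ?thesis
        unfolding \<open>m div 2 = j\<close> using j
        \<open>real (2 * j + 1 choose j) = real (2 * Suc j choose Suc j) / 2\<close> by (simp only:) simp
    qed
    have "(real (2 * Suc j choose Suc j) / 4 ^ Suc j)\<^sup>2 \<le> 1 / (2 * real (Suc j) + 1)"
      using central_binomial_sq_bound[of "Suc j"] by (simp add: field_simps)
    also have "\<dots> \<le> 1 / (real m + 1)"
      by (simp add: j divide_left_mono)
    finally have "real (2 * Suc j choose Suc j) / 4 ^ Suc j \<le> sqrt (1 / (real m + 1))"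
      by (rule real_le_rsqrt)
    then show ?thesis unfolding eq by (simp add: real_sqrt_divide)
  qed
  have "real (m choose k) / 2 ^ m \<le> real (m choose (m div 2)) / 2 ^ m"
    by (intro divide_right_mono) (auto intro: binomial_maximum)
  then show ?thesis using mid by linarith
qed

text \<open>The value at \<open>y\<close> is the probability that the one-dimensional walk from
  \<open>y\<close> is at 0 at time \<open>m\<close>. From \<open>2 * k - m\<close> this takes
  exactly \<open>k\<close> steps down; from the other parity class it is impossible.\<close>

lemma step_avg1_indicator:
  "(step_avg1 ^^ m) (\<lambda>y. of_bool (y = 0)) (2 * k - int m) =
     (if k \<ge> 0 then real (m choose nat k) else 0) / 2 ^ m \<and>
   (step_avg1 ^^ m) (\<lambda>y. of_bool (y = 0)) (2 * k - int m + 1) = 0"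
proof (induction m arbitrary: k)
  case 0
  have "2 * k + 1 \<noteq> (0 :: int)" by presburger
  moreover have "(0 choose nat k) = (if k \<le> 0 then 1 else 0)"
    by (cases "nat k") auto
  ultimately show ?case by auto
next
  case (Suc m)
  let ?h = "(step_avg1 ^^ m) (\<lambda>y. of_bool (y = 0))"
  have e1: "2 * k - int (Suc m) + 1 = 2 * k - int m"
    and e2: "2 * k - int (Suc m) - 1 = 2 * (k - 1) - int m"
    and e3: "2 * k - int (Suc m) + 1 + 1 = 2 * k - int m + 1"
    and e4: "2 * k - int (Suc m) + 1 - 1 = 2 * (k - 1) - int m + 1"
    by (simp_all add: algebra_simps)
  have pascal: "real (Suc m choose nat k) = real (m choose nat k) + real (m choose nat (k - 1))"
    if "k \<ge> 1"
  proof -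
    have "nat k = Suc (nat (k - 1))" using that by simp
    then show ?thesis by simp
  qed
  consider "k < 0" | "k = 0" | "k \<ge> 1" by linarith
  then have "(?h (2 * k - int m) + ?h (2 * (k - 1) - int m)) / 2 =
      (if k \<ge> 0 then real (Suc m choose nat k) else 0) / 2 ^ Suc m"
    by cases (use Suc[of k] Suc[of "k - 1"] pascal in \<open>auto simp: add_divide_distrib\<close>)
  moreover have "(?h (2 * k - int m + 1) + ?h (2 * (k - 1) - int m + 1)) / 2 = 0"
    using Suc[of k] Suc[of "k - 1"] by simp
  ultimately show ?case
    unfolding funpow.simps comp_apply step_avg1_def e1 e2 e3 e4
    using e1 e2 e3 e4 by (simp add: step_avg1_def)
qed

lemma step_avg1_bounds:
  "0 \<le> (step_avg1 ^^ m) (\<lambda>y. of_bool (y = 0)) y"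
  "(step_avg1 ^^ m) (\<lambda>y. of_bool (y = 0)) y \<le> 1 / sqrt (real m + 1)"
proof -
  have "\<exists>k. y = 2 * k - int m \<or> y = 2 * k - int m + 1" by presburger
  then obtain k where "y = 2 * k - int m \<or> y = 2 * k - int m + 1" by blast
  then show "0 \<le> (step_avg1 ^^ m) (\<lambda>y. of_bool (y = 0)) y"
    "(step_avg1 ^^ m) (\<lambda>y. of_bool (y = 0)) y \<le> 1 / sqrt (real m + 1)"
    using step_avg1_indicator[of m k] binomial_over_power_bound[of m "nat k"] by auto
qed

text \<open>The average over the numbers \<open>c\<close> of steps that the walk takes in each coordinate direction.
  Conditionally on these numbers the coordinates of the walk are independent.\<close>

primrec multinomial_mean :: "nat \<Rightarrow> (('d :: finite \<Rightarrow> nat) \<Rightarrow> real) \<Rightarrow> ('d \<Rightarrow> nat) \<Rightarrow> real" where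
  "multinomial_mean 0 g c = g c"
| "multinomial_mean (Suc n) g c =
     (\<Sum>i\<in>UNIV. multinomial_mean n g (c(i := Suc (c i)))) / real CARD('d)"

lemma multinomial_mean_mono:
  assumes "\<And>c. g c \<le> h c"
  shows "multinomial_mean n g c \<le> multinomial_mean n h c"
  by (induction n arbitrary: c) (auto simp: assms intro!: divide_right_mono sum_mono)

lemma multinomial_mean_sum:
  "multinomial_mean n (\<lambda>c. \<Sum>a\<in>A. g a c) c = (\<Sum>a\<in>A. multinomial_mean n (g a) c)"
proof (induction n arbitrary: c)
  case (Suc n)
  show ?case
    unfolding multinomial_mean.simps Suc sum_divide_distrib[symmetric]
    by (subst sum.swap) (rule refl)
qed simp

lemma step_avg_power_sum:
  "(step_avg ^^ n) (\<lambda>x. (\<Sum>a\<in>A. g a x) / r) x = (\<Sum>a\<in>A. (step_avg ^^ n) (g a) x) / r"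
proof -
  have "(step_avg ^^ n) (\<lambda>x. (\<Sum>a\<in>A. g a x) / r) x =
      word_mean n (\<lambda>l. (1 / r) * (\<Sum>a\<in>A. g a (x + sum_list l)))"
    by (simp flip: word_mean_endpoint)
  also have "\<dots> = (1 / r) * (\<Sum>a\<in>A. word_mean n (\<lambda>l. g a (x + sum_list l)))"
    by (simp only: word_mean_cmult word_mean_sum)
  finally show ?thesis by (simp add: word_mean_endpoint)
qed

text \<open>A step picks a coordinate \<open>j\<close> uniformly and moves it up or down with equal
  probability, so only the factor of \<open>j\<close> is averaged.\<close>

lemma step_avg_prod:
  fixes h :: "'d :: finite \<Rightarrow> int \<Rightarrow> real"
  shows "step_avg (\<lambda>x :: int ^ 'd. \<Prod>i\<in>UNIV. h i (x $ i)) x =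
    (\<Sum>j\<in>UNIV. \<Prod>i\<in>UNIV. (if i = j then step_avg1 (h i) else h i) (x $ i)) / real CARD('d)"
proof -
  have prod_upd: "(\<Prod>i\<in>UNIV. if i = j then F i else G i) = F j * (\<Prod>i\<in>UNIV - {j}. G i)"
    for F G :: "'d \<Rightarrow> real" and j
    by (subst prod.remove[of UNIV j]) (auto intro!: prod.cong)
  have pm: "(\<Prod>i\<in>UNIV. h i ((x + s *s axis j 1) $ i)) = h j (x $ j + s) * (\<Prod>i\<in>UNIV - {j}. h i (x $ i))"
    for s j
  proof -
    have "(\<Prod>i\<in>UNIV. h i ((x + s *s axis j 1) $ i)) =
        (\<Prod>i\<in>UNIV. if i = j then h i (x $ i + s) else h i (x $ i))"
      by (intro prod.cong) (auto simp: axis_def)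
    then show ?thesis by (simp add: prod_upd)
  qed
  have "step_avg (\<lambda>x. \<Prod>i\<in>UNIV. h i (x $ i)) x =
    (\<Sum>j\<in>UNIV. (\<Prod>i\<in>UNIV. h i ((x + axis j 1) $ i)) + (\<Prod>i\<in>UNIV. h i ((x + - axis j 1) $ i)))
      / (2 * real CARD('d))"
    unfolding step_avg_def sum_unit_steps ..
  also have "\<dots> = (\<Sum>j\<in>UNIV. 2 * (step_avg1 (h j) (x $ j) * (\<Prod>i\<in>UNIV - {j}. h i (x $ i))))
      / (2 * real CARD('d))"
  proof (intro arg_cong2[of _ _ _ _ "(/)"] sum.cong refl)
    fix j
    have "x + axis j 1 = x + 1 *s axis j 1" "x + - axis j 1 = x + (-1) *s axis j 1"
      by (simp_all add: vec_eq_iff)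
    then show "(\<Prod>i\<in>UNIV. h i ((x + axis j 1) $ i)) + (\<Prod>i\<in>UNIV. h i ((x + - axis j 1) $ i)) =
        2 * (step_avg1 (h j) (x $ j) * (\<Prod>i\<in>UNIV - {j}. h i (x $ i)))"
      by (simp only: pm) (simp add: step_avg1_def field_simps)
  qed
  also have "\<dots> = (\<Sum>j\<in>UNIV. step_avg1 (h j) (x $ j) * (\<Prod>i\<in>UNIV - {j}. h i (x $ i)))
      / real CARD('d)"
    by (simp add: sum_distrib_left[symmetric])
  also have "\<dots> = (\<Sum>j\<in>UNIV. \<Prod>i\<in>UNIV. if i = j then step_avg1 (h i) (x $ i) else h i (x $ i))
      / real CARD('d)"
    by (simp add: prod_upd)
  also have "\<dots> = (\<Sum>j\<in>UNIV. \<Prod>i\<in>UNIV. (if i = j then step_avg1 (h i) else h i) (x $ i))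
      / real CARD('d)"
    by (intro arg_cong2[of _ _ _ _ "(/)"] sum.cong prod.cong) auto
  finally show ?thesis .
qed

text \<open>The exponents \<open>c\<close> are arbitrary so that the induction can peel off the
  innermost step: by \<open>step_avg_prod\<close> it raises one exponent and keeps the product
  form.\<close>

lemma step_avg_power_prod:
  fixes h :: "'d :: finite \<Rightarrow> int \<Rightarrow> real"
  shows "(step_avg ^^ n) (\<lambda>x :: int ^ 'd. \<Prod>i\<in>UNIV. (step_avg1 ^^ c i) (h i) (x $ i)) x =
    multinomial_mean n (\<lambda>c. \<Prod>i\<in>UNIV. (step_avg1 ^^ c i) (h i) (x $ i)) c"
proof (induction n arbitrary: c)
  case (Suc n)
  have "step_avg (\<lambda>x :: int ^ 'd. \<Prod>i\<in>UNIV. (step_avg1 ^^ c i) (h i) (x $ i)) =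
    (\<lambda>x. (\<Sum>j\<in>UNIV. \<Prod>i\<in>UNIV. (step_avg1 ^^ (c(j := Suc (c j))) i) (h i) (x $ i)) / real CARD('d))"
  proof
    fix x :: "int ^ 'd"
    show "step_avg (\<lambda>x. \<Prod>i\<in>UNIV. (step_avg1 ^^ c i) (h i) (x $ i)) x =
      (\<Sum>j\<in>UNIV. \<Prod>i\<in>UNIV. (step_avg1 ^^ (c(j := Suc (c j))) i) (h i) (x $ i)) / real CARD('d)"
      unfolding step_avg_prod[of "\<lambda>i. (step_avg1 ^^ c i) (h i)"]
      by (intro arg_cong2[of _ _ _ _ "(/)"] sum.cong prod.cong) auto
  qed
  then show ?case
    by (simp only: funpow_Suc_right comp_apply step_avg_power_sum Suc multinomial_mean.simps)
qed simp

text \<open>The count of coordinate \<open>i\<close> grows by 1 with probability 1/d per step.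
  Instead of a large deviation estimate, 1/s^2 is replaced by the majorant \<phi>(s) = 2/(s (s +
  1)), whose differences are explicit, and averaging over one step is shown to lower it at least as
  much as the shift by 1/(3d). By convexity of \<phi> the mean shift 1/d itself would be too much to
  ask.\<close>

lemma multinomial_mean_inverse_square:
  fixes c :: "'d :: finite \<Rightarrow> nat"
  shows "multinomial_mean n (\<lambda>c. 1 / (real (c i) + 1)\<^sup>2) c \<le>
    2 / ((real (c i) + 1 + n / (3 * real CARD('d))) * (real (c i) + 2 + n / (3 * real CARD('d))))"
proof (induction n arbitrary: c)
  case 0
  define s where "s = real (c i) + 1"
  have "1 / s\<^sup>2 \<le> 2 / (s * (s + 1))" if "s \<ge> 1"
    using that by (simp add: power2_eq_square divide_simps)
  then show ?case by (simp add: s_def add_ac)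
next
  case (Suc n)
  define D where "D = real CARD('d)"
  have D: "D \<ge> 1" unfolding D_def by (simp add: Suc_leI)
  define \<phi> where "\<phi> s = 2 / (s * (s + 1))" for s :: real
  define t where "t = real (c i) + 1 + n / (3 * D)"
  have t: "t \<ge> 1" using D by (simp add: t_def)
  have IH: "multinomial_mean n (\<lambda>c. 1 / (real (c i) + 1)\<^sup>2) c \<le> \<phi> (real (c i) + 1 + n / (3 * D))" for c
    using Suc[of c] by (simp add: \<phi>_def D_def add.commute add.left_commute add.assoc)
  have "multinomial_mean (Suc n) (\<lambda>c. 1 / (real (c i) + 1)\<^sup>2) c =
      (\<Sum>j\<in>UNIV. multinomial_mean n (\<lambda>c. 1 / (real (c i) + 1)\<^sup>2) (c(j := Suc (c j)))) / D"
    by (simp add: D_def)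
  also have "\<dots> \<le> (\<Sum>j\<in>UNIV. if j = i then \<phi> (t + 1) else \<phi> t) / D"
  proof (intro divide_right_mono sum_mono)
    fix j
    show "multinomial_mean n (\<lambda>c. 1 / (real (c i) + 1)\<^sup>2) (c(j := Suc (c j)))
        \<le> (if j = i then \<phi> (t + 1) else \<phi> t)"
      using IH[of "c(j := Suc (c j))"] by (auto simp: t_def add_ac)
  qed (use D in auto)
  also have "\<dots> = (\<phi> (t + 1) + (D - 1) * \<phi> t) / D"
    by (subst sum.remove[of UNIV i]) (auto simp: D_def of_nat_diff card_Diff_singleton Suc_leI)
  also have "\<dots> \<le> \<phi> (t + 1 / (3 * D))"
  proof -
    define a where "a = 1 / (3 * D)"
    have a: "0 < a" "a \<le> 1" "1 / D = 3 * a" using D by (auto simp: a_def field_simps)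
    have "\<phi> t - \<phi> (t + a) = 2 * a * (2 * t + 1 + a) / (t * (t + 1) * ((t + a) * (t + a + 1)))"
      using t a by (simp add: \<phi>_def divide_simps)  (simp add: algebra_simps)
    also have "\<dots> \<le> 2 * a * (2 * t + 1 + 1) / (t * (t + 1) * (t * (t + 1)))"
      using t a by (intro frac_le mult_mono) auto
    also have "\<dots> \<le> 3 * a * (4 / (t * (t + 1) * (t + 2)))"
    proof -
      \<comment> \<open>This amounts to t + 2 \<le> 3 t, which is where the factor 3 in the shift
        comes from.\<close>
      have "4 * a / (t * (t * (t + 1))) \<le> 12 * a / (t * (t + 1) * (t + 2))"
        using t a by (simp add: divide_simps)
      moreover have "2 * a * (2 * t + 1 + 1) / (t * (t + 1) * (t * (t + 1))) = 4 * a / (t * (t * (t + 1)))"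
        using t by (simp add: divide_simps)
      ultimately show ?thesis by simp
    qed
    also have "4 / (t * (t + 1) * (t + 2)) = \<phi> t - \<phi> (t + 1)"
      using t by (simp add: \<phi>_def divide_simps)
    finally have "\<phi> t - \<phi> (t + a) \<le> (1 / D) * (\<phi> t - \<phi> (t + 1))" by (simp add: a)
    moreover have "(\<phi> (t + 1) + (D - 1) * \<phi> t) / D = \<phi> t - (1 / D) * (\<phi> t - \<phi> (t + 1))"
      using D by (simp add: field_simps)
    ultimately show ?thesis by (simp add: a_def)
  qed
  also have "\<dots> = 2 / ((real (c i) + 1 + Suc n / (3 * real CARD('d))) * (real (c i) + 2 + Suc n / (3 * real CARD('d))))"
    by (simp add: \<phi>_def t_def D_def add_divide_distrib add_ac)
  finally show ?case .
qed

text \<open>This is where \<open>d \<ge> 4\<close> enters: the product of \<open>d\<close> one-dimensional bounds \<open>1 / sqrt (c i + 1)\<close>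
  is at most the fourth power of the largest of them.\<close>

lemma heat_kernel_bound:
  fixes x y :: "int ^ 'd"
  assumes "CARD('d) \<ge> 4"
  shows "word_prob n (\<lambda>l. x + sum_list l = y) \<le> 18 * real CARD('d) ^ 3 / (real n + 1)\<^sup>2"
proof -
  define D where "D = real CARD('d)"
  have D: "D \<ge> 4" using assms by (simp add: D_def)
  let ?h0 = "\<lambda>y :: int. of_bool (y = 0) :: real"
  have "word_prob n (\<lambda>l. x + sum_list l = y) =
      word_mean n (\<lambda>l. \<Prod>i\<in>UNIV. ?h0 (((x - y) + sum_list l) $ i))"
  proof (rule word_mean_cong)
    fix l :: "(int ^ 'd) list"
    have "x + sum_list l = y \<longleftrightarrow> (\<forall>i. ((x - y) + sum_list l) $ i = 0)"
      by (auto simp: vec_eq_iff algebra_simps)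
    then show "of_bool (x + sum_list l = y) = (\<Prod>i\<in>UNIV. ?h0 (((x - y) + sum_list l) $ i))"
      by (cases "x + sum_list l = y") auto
  qed
  also have "\<dots> = (step_avg ^^ n) (\<lambda>x. \<Prod>i\<in>UNIV. ?h0 (x $ i)) (x - y)"
    by (rule word_mean_endpoint)
  also have "\<dots> = multinomial_mean n (\<lambda>c. \<Prod>i\<in>UNIV. (step_avg1 ^^ c i) ?h0 ((x - y) $ i)) (\<lambda>_. 0)"
    using step_avg_power_prod[of n "\<lambda>_. 0" "\<lambda>_. ?h0" "x - y"] by simp
  also have "\<dots> \<le> multinomial_mean n (\<lambda>c. \<Sum>i\<in>UNIV. 1 / (real (c i) + 1)\<^sup>2) (\<lambda>_ :: 'd. 0)"
  proof (rule multinomial_mean_mono)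
    fix c :: "'d \<Rightarrow> nat"
    obtain j where j: "\<And>i. c j \<le> c i"
      using arg_min_if_finite(2)[of "UNIV :: 'd set" c] by (metis UNIV_I finite UNIV_not_empty not_le)
    have "(\<Prod>i\<in>UNIV. (step_avg1 ^^ c i) ?h0 ((x - y) $ i)) \<le> (\<Prod>i\<in>(UNIV :: 'd set). 1 / sqrt (real (c j) + 1))"
    proof (intro prod_mono conjI)
      fix i
      have "(step_avg1 ^^ c i) ?h0 ((x - y) $ i) \<le> 1 / sqrt (real (c i) + 1)"
        by (rule step_avg1_bounds)
      also have "\<dots> \<le> 1 / sqrt (real (c j) + 1)"
        using j[of i] by (intro divide_left_mono) auto
      finally show "(step_avg1 ^^ c i) ?h0 ((x - y) $ i) \<le> 1 / sqrt (real (c j) + 1)" .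
    qed (rule step_avg1_bounds)
    also have "\<dots> = (1 / sqrt (real (c j) + 1)) ^ CARD('d)" by simp
    also have "\<dots> \<le> (1 / sqrt (real (c j) + 1)) ^ 4"
      by (intro power_decreasing assms) auto
    also have "\<dots> = ((1 / sqrt (real (c j) + 1))\<^sup>2)\<^sup>2" by (simp flip: power_mult)
    also have "\<dots> = 1 / (real (c j) + 1)\<^sup>2"
      by (simp add: power_divide)
    \<comment> \<open>Which count is smallest depends on \<open>c\<close>; the sum over all
      coordinates does not single one out and can be averaged term by term, at the price of a factor
      d.\<close>
    also have "\<dots> \<le> (\<Sum>i\<in>UNIV. 1 / (real (c i) + 1)\<^sup>2)"
      by (rule member_le_sum) auto
    finally show "(\<Prod>i\<in>UNIV. (step_avg1 ^^ c i) ?h0 ((x - y) $ i)) \<le> (\<Sum>i\<in>UNIV. 1 / (real (c i) + 1)\<^sup>2)" .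
  qed
  also have "\<dots> = (\<Sum>i\<in>UNIV. multinomial_mean n (\<lambda>c. 1 / (real (c i) + 1)\<^sup>2) (\<lambda>_ :: 'd. 0))"
    by (rule multinomial_mean_sum)
  also have "\<dots> \<le> (\<Sum>i\<in>(UNIV :: 'd set). 18 * D\<^sup>2 / (real n + 1)\<^sup>2)"
  proof (rule sum_mono)
    fix i :: 'd
    have "multinomial_mean n (\<lambda>c. 1 / (real (c i) + 1)\<^sup>2) (\<lambda>_ :: 'd. 0) \<le>
        2 / ((1 + n / (3 * D)) * (2 + n / (3 * D)))"
      using multinomial_mean_inverse_square[of n i "\<lambda>_. 0"] by (simp add: D_def)
    also have "\<dots> \<le> 2 / (((real n + 1) / (3 * D)) * ((real n + 1) / (3 * D)))"
      using D by (intro divide_left_mono mult_mono mult_pos_pos) (auto simp: field_simps add_pos_nonneg)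
    also have "\<dots> = 18 * D\<^sup>2 / (real n + 1)\<^sup>2"
      using D by (simp add: power2_eq_square field_simps)
    finally show "multinomial_mean n (\<lambda>c. 1 / (real (c i) + 1)\<^sup>2) (\<lambda>_ :: 'd. 0) \<le> 18 * D\<^sup>2 / (real n + 1)\<^sup>2" .
  qed
  also have "\<dots> = 18 * D ^ 3 / (real n + 1)\<^sup>2"
    by (simp add: D_def power2_eq_square power3_eq_cube)
  finally show ?thesis by (simp add: D_def)
qed

section \<open>Transience of the unit ball\<close>

abbreviation unit_ball :: "(int ^ 'd) set" where
  "unit_ball \<equiv> insert 0 unit_steps"

lemma card_unit_ball: "card (unit_ball :: (int ^ 'd) set) = 2 * CARD('d) + 1"
  by (simp add: card_unit_steps)

text \<open>The number of points of the ball times the constant of \<open>heat_kernel_bound\<close>.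
  Divided by \<open>m + 1\<close> it bounds the expected number of visits to the ball after time
  \<open>m\<close>.\<close>

definition green_const :: "nat \<Rightarrow> real" where
  "green_const d = (2 * real d + 1) * (18 * real d ^ 3)"

lemma green_const_nonneg: "0 \<le> green_const d"
  by (simp add: green_const_def)

text \<open>A union bound over times and points of the ball; 1/(i + 1)^2 is at most 1/i - 1/(i + 1),
  so the sum telescopes and neither the horizon \<open>n\<close> nor the starting point enters the
  bound.\<close>

lemma late_visit_bound:
  fixes x :: "int ^ 'd"
  assumes "CARD('d) \<ge> 4"
  shows "word_prob n (\<lambda>l. \<exists>i. m < i \<and> i \<le> n \<and> x + sum_list (take i l) \<in> unit_ball)
    \<le> green_const CARD('d) / (real m + 1)"
proof -
  define c where "c = 18 * real CARD('d) ^ 3"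
  have "word_prob n (\<lambda>l. \<exists>i. m < i \<and> i \<le> n \<and> x + sum_list (take i l) \<in> unit_ball)
      \<le> (\<Sum>p\<in>{m<..n} \<times> unit_ball. word_prob n (\<lambda>l. x + sum_list (take (fst p) l) = snd p))"
    by (rule word_prob_union) auto
  also have "\<dots> \<le> (\<Sum>p\<in>{m<..n} \<times> (unit_ball :: (int ^ 'd) set). c * (1 / real (fst p) - 1 / real (Suc (fst p))))"
  proof (rule sum_mono)
    fix p :: "nat \<times> (int ^ 'd)" assume p: "p \<in> {m<..n} \<times> unit_ball"
    obtain i y where [simp]: "p = (i, y)" by (cases p)
    have i: "m < i" "i \<le> n" using p by auto
    have "word_prob n (\<lambda>l. x + sum_list (take i l) = y) = word_prob i (\<lambda>l. x + sum_list l = y)"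
      using word_mean_take[of i "n - i" "\<lambda>l. of_bool (x + sum_list l = y)"] i by simp
    also have "\<dots> \<le> c / (real i + 1)\<^sup>2"
      unfolding c_def by (rule heat_kernel_bound[OF assms])
    also have "\<dots> \<le> c * (1 / real i - 1 / real (Suc i))"
    proof -
      have "1 / (real i + 1)\<^sup>2 \<le> 1 / real i - 1 / real (Suc i)"
        using i by (simp add: divide_simps power2_eq_square) (simp add: algebra_simps)
      then have "c * (1 / (real i + 1)\<^sup>2) \<le> c * (1 / real i - 1 / real (Suc i))"
        by (intro mult_left_mono) (auto simp: c_def)
      then show ?thesis by simp
    qed
    finally show "word_prob n (\<lambda>l. x + sum_list (take (fst p) l) = snd p)
        \<le> c * (1 / real (fst p) - 1 / real (Suc (fst p)))"
      by simp
  qed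
  also have "\<dots> = (\<Sum>i\<in>{m<..n}. \<Sum>y\<in>(unit_ball :: (int ^ 'd) set). c * (1 / real i - 1 / real (Suc i)))"
    by (subst sum.cartesian_product) (simp add: case_prod_unfold)
  also have "\<dots> = (2 * real CARD('d) + 1) * c * (\<Sum>i\<in>{m<..n}. 1 / real i - 1 / real (Suc i))"
    by (simp only: sum_constant card_unit_ball) (simp add: sum_distrib_left mult.assoc add.commute)
  also have "\<dots> \<le> (2 * real CARD('d) + 1) * c * (1 / (real m + 1))"
  proof (intro mult_left_mono)
    have "(\<Sum>i\<in>{m<..n}. 1 / real i - 1 / real (Suc i)) \<le> 1 / (real m + 1) - 1 / (real n + 1)"
      if "m \<le> n"
      using that
    proof (induction n rule: dec_induct)
      case (step n)
      then have "{m<..Suc n} = insert (Suc n) {m<..n}" by auto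
      then show ?case using step by (simp add: add_ac)
    qed simp
    moreover have "{m<..n} = {}" if "\<not> m \<le> n" using that by simp
    ultimately show "(\<Sum>i\<in>{m<..n}. 1 / real i - 1 / real (Suc i)) \<le> 1 / (real m + 1)"
      by (cases "m \<le> n") (auto intro: order_trans)
  qed (auto simp: c_def)
  finally show ?thesis by (simp add: green_const_def c_def)
qed

lemma word_prob_singleton:
  fixes w :: "(int ^ 'd) list"
  assumes "set w \<subseteq> unit_steps" "length w = n"
  shows "word_prob n (\<lambda>l. l = w) = (1 / (2 * real CARD('d))) ^ n"
  using assms
proof (induction n arbitrary: w)
  case (Suc n)
  then obtain f v where w: "w = f # v" and f: "f \<in> unit_steps" and v: "set v \<subseteq> unit_steps" "length v = n"
    by (cases w) auto
  have "word_prob (Suc n) (\<lambda>l. l = w) =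
      (\<Sum>e\<in>unit_steps. if e = f then word_prob n (\<lambda>l. l = v) else 0) / (2 * real CARD('d))"
    unfolding word_mean.simps w by (intro arg_cong2[of _ _ _ _ "(/)"] sum.cong) (auto simp: word_mean_zero)
  then show ?case using f Suc.IH[OF v] by simp
qed simp

text \<open>A signed coordinate that measures height in the direction \<open>u\<close>, for the
  straight escape below.\<close>

lemma unit_steps_functional:
  fixes u :: "int ^ 'd"
  assumes "u \<in> unit_steps"
  obtains a s where "s * u $ a = 1" "\<And>e. e \<in> unit_steps \<Longrightarrow> s * e $ a \<le> 1" "\<And>e. e \<in> unit_steps \<Longrightarrow> s * e $ a \<ge> -1"
proof -
  obtain a where a: "u = axis a 1 \<or> u = - axis a 1"
    using assms by (auto simp: unit_steps_def)
  have bound: "\<bar>e $ a\<bar> \<le> 1" if "e \<in> unit_steps" for e :: "int ^ 'd"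
    using that by (auto simp: unit_steps_def axis_def)
  have "u $ a * u $ a = 1" using a by auto
  moreover have "u $ a * e $ a \<le> 1" "u $ a * e $ a \<ge> -1" if "e \<in> unit_steps" for e :: "int ^ 'd"
    using a bound[OF that] by (auto simp: abs_le_iff)
  ultimately show thesis using that by blast
qed

lemma visits_take_eq_0: "visits A x l = 0 \<Longrightarrow> visits A x (take n l) = 0"
  using visits_take_le[of A x n l] by simp

text \<open>The walk escapes by walking straight away from the ball for so long that the expected
  number of later visits is at most \<open>1/2\<close>.\<close>

lemma escape_probability:
  assumes d: "CARD('d) \<ge> 4"
  obtains \<gamma> where "0 < \<gamma>" "\<gamma> \<le> 1"
    "\<And>n u. u \<in> unit_steps \<Longrightarrow> \<gamma> \<le> word_prob n (\<lambda>l :: (int ^ 'd) list. visits unit_ball u l = 0)"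
proof -
  define m where "m = Suc (nat \<lceil>2 * green_const CARD('d)\<rceil>)"
  have m: "green_const CARD('d) / real m \<le> 1 / 2"
  proof -
    have "2 * green_const CARD('d) \<le> real m" unfolding m_def by linarith
    then show ?thesis by (simp add: m_def field_simps)
  qed
  define \<gamma> where "\<gamma> = (1 / (2 * real CARD('d))) ^ m * (1 / 2)"
  have "0 < \<gamma>" by (simp add: \<gamma>_def)
  have "\<gamma> \<le> word_prob n (\<lambda>l. visits unit_ball u l = 0)" if u: "u \<in> unit_steps" for n and u :: "int ^ 'd"
  proof -
    obtain a s where su: "s * u $ a = 1" and le1: "\<And>e. e \<in> unit_steps \<Longrightarrow> s * e $ a \<le> 1"
      and ge1: "\<And>e. e \<in> unit_steps \<Longrightarrow> s * e $ a \<ge> -1"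
      using unit_steps_functional[OF u] by metis
    \<comment> \<open>Height in the direction \<open>u\<close> is at most 1 on the ball and falls by
      at most 1 per step. From height m + 1 the ball is therefore out of reach before time
      m.\<close>
    define \<phi> where "\<phi> x = s * x $ a" for x :: "int ^ 'd"
    have \<phi>_add: "\<phi> (x + y) = \<phi> x + \<phi> y" for x y by (simp add: \<phi>_def algebra_simps)
    have \<phi>_ball: "\<phi> x \<le> 1" if "x \<in> unit_ball" for x using that le1 by (auto simp: \<phi>_def)
    have \<phi>_low: "\<phi> (sum_list l) \<ge> - int (length l)" if "set l \<subseteq> unit_steps" for l
      using that
    proof (induction l)
      case (Cons e l)
      have "\<phi> e \<ge> -1" using ge1 Cons.prems by (auto simp: \<phi>_def)
      then show ?case using Cons by (simp add: \<phi>_add)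
    qed (simp add: \<phi>_def)
    have straight: "visits unit_ball x (replicate i u) = 0 \<and> \<phi> (x + sum_list (replicate i u)) = \<phi> x + int i"
      if "\<phi> x \<ge> 1" for i x
      using that
    proof (induction i arbitrary: x)
      case (Suc i)
      have "\<phi> (x + u) = \<phi> x + 1" using su by (simp add: \<phi>_def algebra_simps)
      moreover from this have "x + u \<notin> unit_ball" using \<phi>_ball[of "x + u"] Suc.prems by linarith
      ultimately show ?case using Suc.IH[of "x + u"] Suc.prems by (simp add: add.assoc)
    qed simp
    define y where "y = u + sum_list (replicate m u)"
    have "\<phi> u = 1" using su by (simp add: \<phi>_def)
    then have y: "\<phi> y = 1 + int m" and str: "visits unit_ball u (replicate m u) = 0"
      using straight[of u m] by (auto simp: y_def)
    have "word_prob n (\<lambda>l. visits unit_ball y l \<noteq> 0) \<le>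
        word_prob n (\<lambda>l. \<exists>i. m - 1 < i \<and> i \<le> n \<and> y + sum_list (take i l) \<in> unit_ball)"
    proof (rule word_prob_mono)
      fix l :: "(int ^ 'd) list" assume l: "length l = n" "set l \<subseteq> unit_steps" "visits unit_ball y l \<noteq> 0"
      then obtain i where i: "0 < i" "i \<le> n" "y + sum_list (take i l) \<in> unit_ball"
        unfolding visits_eq_0_iff by blast
      have "set (take i l) \<subseteq> unit_steps" using l(2) set_take_subset[of i l] by blast
      then have "\<phi> (y + sum_list (take i l)) \<ge> 1 + int m - int i"
        using \<phi>_low[of "take i l"] i l(1) by (simp add: \<phi>_add y)
      then have "m \<le> i" using \<phi>_ball[OF i(3)] by linarith
      then have "m - 1 < i" using i by linarith
      then show "\<exists>i. m - 1 < i \<and> i \<le> n \<and> y + sum_list (take i l) \<in> unit_ball" using i by blast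
    qed
    also have "\<dots> \<le> green_const CARD('d) / (real (m - 1) + 1)"
      by (rule late_visit_bound[OF d])
    also have "\<dots> \<le> 1 / 2" using m by (simp add: m_def add.commute)
    finally have half: "1 / 2 \<le> word_prob n (\<lambda>l. visits unit_ball y l = 0)"
      using word_prob_compl[of n "\<lambda>l. visits unit_ball y l = 0"] by simp
    have "\<gamma> \<le> word_prob m (\<lambda>l. l = replicate m u) * word_prob n (\<lambda>l. visits unit_ball y l = 0)"
      unfolding \<gamma>_def using u half by (subst word_prob_singleton) (auto intro!: mult_left_mono)
    also have "\<dots> = word_mean (m + n) (\<lambda>l. of_bool (take m l = replicate m u) * of_bool (visits unit_ball y (drop m l) = 0))"
      by (rule word_mean_append_mult[symmetric])
    also have "\<dots> \<le> word_prob (m + n) (\<lambda>l. visits unit_ball u l = 0)"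
    proof (rule word_mean_mono)
      fix l :: "(int ^ 'd) list"
      have "visits unit_ball u l = 0" if "take m l = replicate m u" "visits unit_ball y (drop m l) = 0"
        using that str visits_append[of unit_ball u "take m l" "drop m l"]
        by (metis add_0 append_take_drop_id y_def)
      then show "of_bool (take m l = replicate m u) * of_bool (visits unit_ball y (drop m l) = 0)
          \<le> (of_bool (visits unit_ball u l = 0) :: real)"
        by auto
    qed
    \<comment> \<open>The straight start took \<open>m\<close> steps beyond the horizon
      \<open>n\<close>; the absence of visits passes to prefixes.\<close>
    also have "\<dots> \<le> word_prob (n + m) (\<lambda>l. visits unit_ball u (take n l) = 0)"
      unfolding add.commute[of n m] by (rule word_prob_mono) (rule visits_take_eq_0)
    also have "\<dots> = word_prob n (\<lambda>l. visits unit_ball u l = 0)"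
      by (rule word_mean_take)
    finally show ?thesis .
  qed
  note escape = this
  have "\<gamma> \<le> 1"
    by (rule order_trans[OF escape[OF axis_in_unit_steps, of 0] word_prob_le_1])
  then show thesis using that[OF \<open>0 < \<gamma>\<close> _ escape] by simp
qed

text \<open>For \<open>x\<close> on the sphere this is the event \<open>T\<^sub>S\<^sub>(\<^sub>1\<^sub>) < T\<close>, decided within the given steps.\<close>

primrec direct :: "int ^ 'd \<Rightarrow> (int ^ 'd) list \<Rightarrow> bool" where
  "direct x [] \<longleftrightarrow> False"
| "direct x (e # l) \<longleftrightarrow> x + e \<noteq> 0 \<and> (x + e \<in> unit_steps \<or> direct (x + e) l)"

text \<open>Turns the recursion over steps into a statement about times, the form in which
  \<open>hitting_time_less_iff\<close> describes the event that defines \<open>p\<close>.\<close>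

lemma direct_iff:
  "direct x l \<longleftrightarrow> (\<exists>i. 0 < i \<and> i \<le> length l \<and> x + sum_list (take i l) \<in> unit_steps \<and>
     (\<forall>i'. 0 < i' \<and> i' \<le> i \<longrightarrow> x + sum_list (take i' l) \<noteq> 0))"
proof (induction l arbitrary: x)
  case (Cons e l)
  have "direct x (e # l) \<longleftrightarrow> x + e \<noteq> 0 \<and> (x + e \<in> unit_steps \<or>
     (\<exists>i. 0 < i \<and> i \<le> length l \<and> x + e + sum_list (take i l) \<in> unit_steps \<and>
     (\<forall>i'. 0 < i' \<and> i' \<le> i \<longrightarrow> x + e + sum_list (take i' l) \<noteq> 0)))"
    by (simp add: Cons)
  also have "\<dots> \<longleftrightarrow> (\<exists>i. i \<le> length l \<and> x + sum_list (take (Suc i) (e # l)) \<in> unit_steps \<and>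
     (\<forall>i'. i' \<le> i \<longrightarrow> x + sum_list (take (Suc i') (e # l)) \<noteq> 0))" (is "?A = ?B")
  proof
    assume ?A
    then consider "x + e \<noteq> 0" "x + e \<in> unit_steps" | i where "x + e \<noteq> 0" "0 < i" "i \<le> length l" "x + e + sum_list (take i l) \<in> unit_steps"
      "\<forall>i'. 0 < i' \<and> i' \<le> i \<longrightarrow> x + e + sum_list (take i' l) \<noteq> 0" by blast
    then show ?B
    proof cases
      case 1
      then show ?thesis by (intro exI[of _ 0]) simp
    next
      case (2 i)
      have "x + sum_list (take (Suc i') (e # l)) \<noteq> 0" if "i' \<le> i" for i'
        using 2 that by (cases "i' = 0") (simp_all add: add.assoc)
      then show ?thesis using 2 by (intro exI[of _ i]) (simp add: add.assoc)
    qed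
  next
    assume ?B
    then obtain i where i: "i \<le> length l" "x + sum_list (take (Suc i) (e # l)) \<in> unit_steps"
      "\<And>i'. i' \<le> i \<Longrightarrow> x + sum_list (take (Suc i') (e # l)) \<noteq> 0" by blast
    have "x + e \<noteq> 0" using i(3)[of 0] by simp
    then show ?A using i by (cases "i = 0") (auto simp: add.assoc intro!: exI[of _ i])
  qed
  also have "\<dots> \<longleftrightarrow> (\<exists>i. 0 < i \<and> i \<le> length (e # l) \<and> x + sum_list (take i (e # l)) \<in> unit_steps \<and>
     (\<forall>i'. 0 < i' \<and> i' \<le> i \<longrightarrow> x + sum_list (take i' (e # l)) \<noteq> 0))" (is "?B = ?C")
  proof
    assume ?B
    then obtain i where i: "i \<le> length l" "x + sum_list (take (Suc i) (e # l)) \<in> unit_steps"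
      "\<And>i'. i' \<le> i \<Longrightarrow> x + sum_list (take (Suc i') (e # l)) \<noteq> 0" by blast
    have "x + sum_list (take i' (e # l)) \<noteq> 0" if "0 < i'" "i' \<le> Suc i" for i'
      using i(3)[of "i' - 1"] that by simp
    then show ?C using i by (intro exI[of _ "Suc i"]) simp
  next
    assume ?C
    then obtain i where i: "0 < i" "i \<le> length (e # l)" "x + sum_list (take i (e # l)) \<in> unit_steps"
      "\<And>i'. 0 < i' \<and> i' \<le> i \<Longrightarrow> x + sum_list (take i' (e # l)) \<noteq> 0" by blast
    have "x + sum_list (take (Suc i') (e # l)) \<noteq> 0" if "i' \<le> i - 1" for i'
      using i(4)[of "Suc i'"] i(1) that by simp
    then show ?B using i by (intro exI[of _ "i - 1"]) simp
  qed
  finally show ?case .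
qed simp

section \<open>Excursions from the sphere\<close>

abbreviation direct_prob :: "nat \<Rightarrow> int ^ 'd \<Rightarrow> real" where
  "direct_prob R x \<equiv> word_prob R (direct x)"

text \<open>On the sphere this is \<open>p\<close>, by \<open>sphere_before_origin_prob_eq\<close>.
  It is defined for every start because first-step arguments follow an excursion through points off
  the sphere.\<close>

definition direct_lim :: "int ^ 'd \<Rightarrow> real" where
  "direct_lim x = (SUP R. direct_prob R x)"

lemma direct_prob_Suc:
  fixes x :: "int ^ 'd"
  shows "direct_prob (Suc R) x =
    (\<Sum>e\<in>unit_steps. if x + e = 0 then 0 else if x + e \<in> unit_steps then 1 else direct_prob R (x + e))
      / (2 * real CARD('d))"
  unfolding word_mean.simps
  by (intro arg_cong2[of _ _ _ _ "(/)"] sum.cong) (auto simp: word_mean_zero)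

lemma direct_take: "direct x (take n l) \<Longrightarrow> direct x l"
proof (induction l arbitrary: x n)
  case (Cons e l)
  then show ?case by (cases n) auto
qed simp

lemma direct_prob_mono: "incseq (\<lambda>R. direct_prob R x)"
proof (rule incseq_SucI)
  fix R
  have "direct_prob R x = word_prob (R + 1) (\<lambda>l. direct x (take R l))"
    using word_mean_take[of R 1 "\<lambda>l. of_bool (direct x l)"] by simp
  also have "\<dots> \<le> direct_prob (R + 1) x"
    by (rule word_prob_mono) (rule direct_take)
  finally show "direct_prob R x \<le> direct_prob (Suc R) x" by simp
qed

lemma direct_prob_LIMSEQ: "(\<lambda>R. direct_prob R x) \<longlonglongrightarrow> direct_lim x"
  unfolding direct_lim_def
  by (rule LIMSEQ_incseq_SUP[OF _ direct_prob_mono]) (auto intro!: bdd_aboveI[of _ 1] word_prob_le_1)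

lemma direct_prob_le_lim: "direct_prob R x \<le> direct_lim x"
  by (rule incseq_le[OF direct_prob_mono direct_prob_LIMSEQ])

lemma direct_lim_nonneg: "0 \<le> direct_lim x"
  using direct_prob_le_lim[of 0 x] by simp

lemma direct_lim_le_1: "direct_lim x \<le> 1"
  by (rule LIMSEQ_le_const2[OF direct_prob_LIMSEQ]) (auto intro: word_prob_le_1)

text \<open>The limit of the first-step recursion: the average of a function that is 1 on the
  sphere, 0 at the origin and \<open>direct_lim\<close> elsewhere.\<close>

lemma direct_lim_harmonic:
  fixes x :: "int ^ 'd"
  shows "direct_lim x =
    (\<Sum>e\<in>unit_steps. if x + e = 0 then 0 else if x + e \<in> unit_steps then 1 else direct_lim (x + e))
      / (2 * real CARD('d))"
proof (rule LIMSEQ_unique)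
  show "(\<lambda>R. direct_prob (Suc R) x) \<longlonglongrightarrow> direct_lim x"
    by (rule LIMSEQ_Suc[OF direct_prob_LIMSEQ])
  show "(\<lambda>R. direct_prob (Suc R) x) \<longlonglongrightarrow>
    (\<Sum>e\<in>unit_steps. if x + e = 0 then 0 else if x + e \<in> unit_steps then 1 else direct_lim (x + e))
      / (2 * real CARD('d))"
    unfolding direct_prob_Suc
    by (intro tendsto_divide tendsto_sum tendsto_const) (auto intro: direct_prob_LIMSEQ)
qed

section \<open>Symmetry of the direct return probability\<close>

lemma direct_map:
  fixes \<sigma> :: "int ^ 'd \<Rightarrow> int ^ 'd"
  assumes "\<And>x y. \<sigma> (x + y) = \<sigma> x + \<sigma> y" "\<And>x. \<sigma> x = 0 \<longleftrightarrow> x = 0"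
    "\<And>x. \<sigma> x \<in> unit_steps \<longleftrightarrow> x \<in> unit_steps"
  shows "direct (\<sigma> x) (map \<sigma> l) \<longleftrightarrow> direct x l"
  by (induction l arbitrary: x) (simp_all flip: assms(1) add: assms(2,3))

lemma direct_prob_symmetric:
  fixes \<sigma> :: "int ^ 'd \<Rightarrow> int ^ 'd"
  assumes "\<And>x y. \<sigma> (x + y) = \<sigma> x + \<sigma> y" "\<And>x. \<sigma> (\<sigma> x) = x"
    "\<And>x. x \<in> unit_steps \<Longrightarrow> \<sigma> x \<in> unit_steps"
  shows "direct_prob R (\<sigma> x) = direct_prob R x"
proof -
  have 0: "\<sigma> 0 = 0" using assms(1)[of 0 0] by simp
  have "bij_betw \<sigma> unit_steps unit_steps"
    by (rule bij_betw_byWitness[where f' = \<sigma>]) (auto simp: assms)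
  then have "direct_prob R (\<sigma> x) = word_mean R (\<lambda>l. of_bool (direct (\<sigma> x) (map \<sigma> l)))"
    by (rule word_mean_map[symmetric])
  also have "\<dots> = direct_prob R x"
    by (subst direct_map) (use assms 0 in metis)+
  finally show ?thesis .
qed

text \<open>The reflection at the origin and the transpositions of two coordinates preserve the law
  of the walk and act transitively on the unit vectors.\<close>

lemma direct_prob_unit_steps:
  fixes u v :: "int ^ 'd"
  assumes u: "u \<in> unit_steps" and v: "v \<in> unit_steps"
  shows "direct_prob R u = direct_prob R v"
proof -
  have neg: "direct_prob R (- x) = direct_prob R x" for x :: "int ^ 'd"
    by (rule direct_prob_symmetric) auto
  have perm: "direct_prob R (axis a 1) = direct_prob R (axis b 1)" for a b :: 'd
  proof -
    define \<sigma> where "\<sigma> x = (\<chi> i. x $ Transposition.transpose a b i)" for x :: "int ^ 'd"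
    have comp: "\<sigma> x $ i = x $ Transposition.transpose a b i" for x i by (simp add: \<sigma>_def)
    have axis: "\<sigma> (axis c 1) = axis (Transposition.transpose a b c) 1" for c
      by (auto simp: \<sigma>_def vec_eq_iff axis_def Transposition.transpose_def)
    have neg: "\<sigma> (- x) = - \<sigma> x" for x by (simp add: \<sigma>_def vec_eq_iff)
    have "direct_prob R (\<sigma> (axis b 1)) = direct_prob R (axis b 1)"
      by (rule direct_prob_symmetric)
        (auto simp: comp vec_eq_iff, auto simp: unit_steps_def axis neg)
    then show ?thesis by (simp add: axis)
  qed
  show ?thesis
    using u v neg perm by (auto simp: unit_steps_def)
qed

lemma direct_lim_unit_steps:
  fixes u v :: "int ^ 'd"
  shows "u \<in> unit_steps \<Longrightarrow> v \<in> unit_steps \<Longrightarrow> direct_lim u = direct_lim v"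
  unfolding direct_lim_def by (simp add: direct_prob_unit_steps[of u v])

lemma word_prob_first_step:
  fixes f :: "int ^ 'd"
  assumes "f \<in> unit_steps"
  shows "word_prob (Suc n) (\<lambda>l. hd l = f) = 1 / (2 * real CARD('d))"
proof -
  have "word_prob (Suc n) (\<lambda>l. hd l = f) =
      (\<Sum>e\<in>unit_steps. if e = f then 1 else 0) / (2 * real CARD('d))"
    unfolding word_mean.simps by (intro arg_cong2[of _ _ _ _ "(/)"] sum.cong) auto
  then show ?thesis using assms by simp
qed

lemma direct_imp_visits: "direct x l \<Longrightarrow> visits unit_ball x l \<noteq> 0"
proof (induction l arbitrary: x)
  case (Cons e l)
  then show ?case by (cases "x + e \<in> unit_ball") auto
qed simp

text \<open>A direct return, a first step to the origin and an escape are mutually exclusive. The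
  resulting strict inequality 1/(2d) + p < 1 makes excursion weights decay geometrically.\<close>

lemma direct_lim_le_escape:
  fixes u :: "int ^ 'd"
  assumes u: "u \<in> unit_steps"
    and \<gamma>: "\<And>n. \<gamma> \<le> word_prob n (\<lambda>l. visits unit_ball u l = 0)"
  shows "direct_lim u + 1 / (2 * real CARD('d)) \<le> 1 - \<gamma>"
proof -
  have "direct_prob (Suc R) u \<le> 1 - \<gamma> - 1 / (2 * real CARD('d))" for R
  proof -
    have "direct_prob (Suc R) u + word_prob (Suc R) (\<lambda>l. hd l = - u)
        + word_prob (Suc R) (\<lambda>l. visits unit_ball u l = 0) =
      word_mean (Suc R) (\<lambda>l. of_bool (direct u l) + of_bool (hd l = - u) + of_bool (visits unit_ball u l = 0))"
      by (simp only: word_mean_add)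
    also have "\<dots> \<le> word_mean (Suc R) (\<lambda>_ :: (int ^ 'd) list. 1)"
    proof (rule word_mean_mono)
      fix l :: "(int ^ 'd) list" assume "length l = Suc R"
      then obtain e l' where "l = e # l'" by (cases l) auto
      then show "of_bool (direct u l) + of_bool (hd l = - u) + of_bool (visits unit_ball u l = 0) \<le> (1 :: real)"
        using direct_imp_visits[of u l] by auto
    qed
    finally show ?thesis using \<gamma>[of "Suc R"] u by (simp add: word_prob_first_step)
  qed
  then have "direct_lim u \<le> 1 - \<gamma> - 1 / (2 * real CARD('d))"
    by (intro LIMSEQ_le_const2[OF LIMSEQ_Suc[OF direct_prob_LIMSEQ]]) auto
  then show ?thesis by simp
qed

text \<open>One step outwards and back is a direct return.\<close>

lemma direct_lim_pos:
  fixes u :: "int ^ 'd"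
  assumes u: "u \<in> unit_steps"
  shows "0 < direct_lim u"
proof -
  have "u + u \<notin> unit_steps" using add_unit_steps_notin[OF u u] .
  moreover have "u \<noteq> 0" using u by auto
  moreover from this have "u + u \<noteq> 0" by (auto simp: vec_eq_iff)
  ultimately have "direct u [u, - u]" using u by simp
  have "0 < (1 / (2 * real CARD('d))) ^ 2" by simp
  also have "\<dots> = word_prob 2 (\<lambda>l. l = [u, - u])"
    using u by (intro word_prob_singleton[symmetric]) auto
  also have "\<dots> \<le> direct_prob 2 u"
    using \<open>direct u [u, - u]\<close> by (intro word_prob_mono) auto
  also have "\<dots> \<le> direct_lim u" by (rule direct_prob_le_lim)
  finally show ?thesis .
qed

text \<open>The total weight of sequences of \<open>l\<close> returns to the sphere of which
  \<open>k\<close> lead through the origin: such a return has weight \<open>a\<close>, since from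
  the origin every step leads to the sphere, and a direct one has weight \<open>p\<close>. For k > l
  the binomial coefficient vanishes, so the truncated exponent does no harm.\<close>

definition excursion_weight :: "real \<Rightarrow> real \<Rightarrow> nat \<Rightarrow> nat \<Rightarrow> real" where
  "excursion_weight a p k l = real (l choose k) * a ^ k * p ^ (l - k)"

text \<open>Pascal's rule, read as a distinction by the type of the first return; this is the
  recursion that the walk follows.\<close>

lemma excursion_weight_simps [simp]:
  "excursion_weight a p 0 0 = 1"
  "excursion_weight a p (Suc k) 0 = 0"
  "excursion_weight a p 0 (Suc l) = p * excursion_weight a p 0 l"
  "excursion_weight a p (Suc k) (Suc l) = a * excursion_weight a p k l + p * excursion_weight a p (Suc k) l"
proof -
  show "excursion_weight a p (Suc k) (Suc l) = a * excursion_weight a p k l + p * excursion_weight a p (Suc k) l"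
  proof (cases "Suc k \<le> l")
    case True
    then have "l - k = Suc (l - Suc k)" by simp
    then show ?thesis by (simp add: excursion_weight_def algebra_simps)
  qed (simp add: excursion_weight_def binomial_eq_0)
qed (simp_all add: excursion_weight_def)

lemma excursion_weight_nonneg: "0 \<le> a \<Longrightarrow> 0 \<le> p \<Longrightarrow> 0 \<le> excursion_weight a p k l"
  by (simp add: excursion_weight_def)

text \<open>The event that, when the walk from \<open>x\<close> is on the sphere at some positive time, it has visited
  the origin exactly \<open>k\<close> times and the sphere exactly \<open>l\<close> times.\<close>

primrec arrives :: "nat \<Rightarrow> nat \<Rightarrow> int ^ 'd \<Rightarrow> (int ^ 'd) list \<Rightarrow> bool" where
  "arrives k l x [] \<longleftrightarrow> False"
| "arrives k l x (e # w) \<longleftrightarrow>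
    (if x + e = 0 then 0 < k \<and> arrives (k - 1) l 0 w
     else if x + e \<in> unit_steps then 0 < l \<and> (k = 0 \<and> l = 1 \<or> arrives k (l - 1) (x + e) w)
     else arrives k l (x + e) w)"

lemma not_arrives_0: "\<not> arrives k 0 x w"
  by (induction w arbitrary: k x) auto

text \<open>The walk first reaches the sphere directly, which leaves \<open>k\<close> and
  \<open>l\<close> to be collected, or starts on the sphere and goes through the origin first, which
  leaves \<open>k - 1\<close> and \<open>l\<close>. On the sphere the two terms add up by Pascal's
  rule; arbitrary \<open>x\<close> are needed for an induction by single steps.\<close>

lemma arrives_prob_bound:
  fixes x u :: "int ^ 'd"
  assumes u: "u \<in> unit_steps"
  defines "a \<equiv> 1 / (2 * real CARD('d))" and "p \<equiv> direct_lim u"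
  shows "word_prob R (arrives k (Suc l) x) \<le> direct_lim x * excursion_weight a p k l
    + (if x \<in> unit_steps \<and> 0 < k then a * excursion_weight a p (k - 1) l else 0)"
proof (induction R arbitrary: k l x)
  case 0
  show ?case by (simp add: direct_lim_nonneg excursion_weight_nonneg a_def p_def)
next
  case (Suc R)
  let ?w = "excursion_weight a p"
  have w0: "0 \<le> ?w k l" for k l
    by (simp add: a_def p_def direct_lim_nonneg excursion_weight_nonneg)
  have a0: "0 \<le> a" by (simp add: a_def)
  have sphere: "word_prob R (arrives k (Suc l) y) \<le> ?w k (Suc l)" if y: "y \<in> unit_steps" for k l and y :: "int ^ 'd"
  proof -
    have "direct_lim y = p" using direct_lim_unit_steps[OF y u] by (simp add: p_def)
    then show ?thesis using Suc.IH[of k l y] y by (cases k) auto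
  qed
  have origin: "word_prob R (arrives k (Suc l) (0 :: int ^ 'd)) \<le> ?w k l" for k l
    using Suc.IH[of k l 0] mult_right_mono[OF direct_lim_le_1 w0[of k l], of "0 :: int ^ 'd"] by simp
  \<comment> \<open>The function in \<open>direct_lim_harmonic\<close>: the chance of still reaching
    the sphere directly once the first step is made.\<close>
  define F where "F y = (if y = 0 then 0 else if y \<in> unit_steps then 1 else direct_lim y)" for y :: "int ^ 'd"
  have "word_prob R (\<lambda>w. arrives k (Suc l) x (e # w)) \<le> F (x + e) * ?w k l
      + (if e = - x \<and> 0 < k then ?w (k - 1) l else 0)" if e: "e \<in> unit_steps" for e
  proof -
    have ex: "x + e = 0 \<longleftrightarrow> e = - x" by (metis add.commute add_eq_0_iff2 minus_minus add_eq_0_iff)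
    consider "x + e = 0" | "x + e \<in> unit_steps" | "x + e \<notin> unit_ball" by blast
    then show ?thesis
    proof cases
      case 1
      then show ?thesis
        using origin[of "k - 1" l] ex by (cases k) (simp_all add: F_def word_mean_zero)
    next
      case 2
      then have "x + e \<noteq> 0" by auto
      then have F: "F (x + e) = 1" using 2 by (simp add: F_def)
      have "word_prob R (\<lambda>w. arrives k (Suc l) x (e # w)) \<le> ?w k l"
      proof (cases l)
        case 0
        then show ?thesis using 2 \<open>x + e \<noteq> 0\<close> by (cases k) (simp_all add: not_arrives_0 word_mean_zero)
      next
        case (Suc l')
        then show ?thesis using 2 \<open>x + e \<noteq> 0\<close> sphere[OF 2, of k l'] by simp
      qed
      then show ?thesis using \<open>x + e \<noteq> 0\<close> ex F by simp
    next
      case 3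
      then have "x + e \<noteq> 0" "x + e \<notin> unit_steps" by auto
      then show ?thesis using Suc.IH[of k l "x + e"] ex by (simp add: F_def)
    qed
  qed
  then have "word_prob (Suc R) (arrives k (Suc l) x) \<le>
      (\<Sum>e\<in>unit_steps. F (x + e) * ?w k l + (if e = - x \<and> 0 < k then ?w (k - 1) l else 0)) / (2 * real CARD('d))"
    unfolding word_mean.simps by (intro divide_right_mono sum_mono) auto
  also have "\<dots> = direct_lim x * ?w k l
    + (\<Sum>e\<in>unit_steps. if e = - x \<and> 0 < k then ?w (k - 1) l else 0) / (2 * real CARD('d))"
    by (subst direct_lim_harmonic[of x])
      (simp add: sum.distrib add_divide_distrib F_def sum_distrib_right)
  also have "(\<Sum>e\<in>unit_steps. if e = - x \<and> 0 < k then ?w (k - 1) l else 0) =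
      (\<Sum>e\<in>unit_steps. if e = - x then if 0 < k then ?w (k - 1) l else 0 else 0)"
    by (intro sum.cong) auto
  also have "\<dots> = (if x \<in> unit_steps \<and> 0 < k then ?w (k - 1) l else 0)"
    by simp
  also have "direct_lim x * ?w k l + (if x \<in> unit_steps \<and> 0 < k then ?w (k - 1) l else 0) / (2 * real CARD('d)) =
      direct_lim x * ?w k l + (if x \<in> unit_steps \<and> 0 < k then a * ?w (k - 1) l else 0)"
    by (simp add: a_def)
  finally show ?case .
qed

lemma arrives_prob_bound_sphere:
  fixes u :: "int ^ 'd"
  assumes u: "u \<in> unit_steps" and l: "0 < l"
  shows "word_prob R (arrives k l u) \<le> excursion_weight (1 / (2 * real CARD('d))) (direct_lim u) k l"
proof -
  obtain l' where "l = Suc l'" using l by (cases l) auto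
  then show ?thesis using arrives_prob_bound[OF u, of R k l' u] u by (cases k) auto
qed

text \<open>The origin is left only through the sphere, so a path from elsewhere that does not visit
  the sphere can touch the origin only at its end.\<close>

lemma visits_origin_eq_0:
  assumes "visits unit_steps x w = 0" "x \<noteq> 0" "x + sum_list w \<noteq> 0" "set w \<subseteq> unit_steps"
  shows "visits {0} x w = 0"
  using assms
proof (induction w arbitrary: x)
  case (Cons e w)
  have "x + e \<noteq> 0"
  proof
    assume "x + e = 0"
    then show False using Cons.prems by (cases w) (auto simp flip: add.assoc split: if_splits)
  qed
  then show ?case using Cons by (auto simp: add.assoc split: if_splits)
qed simp

text \<open>At its last visit to the sphere the path has collected all its visits to the origin: a
  later one would have to be left through the sphere or be the end point.\<close>

lemma arrivesI:
  assumes "x + sum_list w \<noteq> 0" "set w \<subseteq> unit_steps" "visits unit_steps x w > 0"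
  shows "arrives (visits {0} x w) (visits unit_steps x w) x w"
  using assms
proof (induction w arbitrary: x)
  case (Cons e w)
  let ?y = "x + e"
  show ?case
  proof (cases "visits unit_steps ?y w = 0")
    case True
    then have y: "?y \<in> unit_steps" using Cons.prems(3) by (auto split: if_splits)
    then have "?y \<noteq> 0" by auto
    then have "visits {0} ?y w = 0"
      using visits_origin_eq_0[OF True] Cons.prems by (simp add: add.assoc)
    then show ?thesis using True y \<open>?y \<noteq> 0\<close> by simp
  next
    case False
    then have "arrives (visits {0} ?y w) (visits unit_steps ?y w) ?y w"
      using Cons by (simp add: add.assoc)
    then show ?thesis using False by (cases "?y = 0") auto
  qed
qed simp

text \<open>The counts are prescribed both at time \<open>L\<close> and at the end. Used with words of length \<open>2 * L\<close>, this
  leaves a gap of \<open>L\<close> steps before any later visit to the ball, so that such a visit costs a factor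
  \<open>O(1 / L)\<close> conditionally on the first \<open>L\<close> steps.\<close>

definition settled :: "nat \<Rightarrow> nat \<Rightarrow> nat \<Rightarrow> int ^ 'd \<Rightarrow> (int ^ 'd) list \<Rightarrow> bool" where
  "settled k l L x w \<longleftrightarrow> visits {0} x w = k \<and> visits unit_steps x w = l \<and>
     visits {0} x (take L w) = k \<and> visits unit_steps x (take L w) = l \<and> x + sum_list (take L w) \<noteq> 0"

lemma settled_Cons:
  "settled k l (Suc L) x (e # w) \<longleftrightarrow>
    (if x + e = 0 then 0 < k \<and> settled (k - 1) l L 0 w
     else if x + e \<in> unit_steps then 0 < l \<and> settled k (l - 1) L (x + e) w
     else settled k l L (x + e) w)"
proof (cases "x + e = 0")
  case True
  then have eq: "x + (e + s) = s" for s by (simp flip: add.assoc)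
  show ?thesis using True by (auto simp: settled_def eq)
next
  case False
  then show ?thesis by (auto simp: settled_def add.assoc)
qed

lemma settled_0_0I:
  assumes "visits unit_ball x w = 0" "x \<noteq> 0"
  shows "settled 0 0 L x w"
proof -
  have "visits {0} x v = 0 \<and> visits unit_steps x v = 0" if "visits unit_ball x v = 0" for v
    using visits_mono[of "{0}" unit_ball x v] visits_mono[of unit_steps unit_ball x v] that by auto
  moreover have "visits unit_ball x (take L w) = 0" using assms(1) by (rule visits_take_eq_0)
  moreover have "x + sum_list (take L w) \<noteq> 0"
  proof (cases "take L w = []")
    case False
    then show ?thesis
      using \<open>visits unit_ball x (take L w) = 0\<close> unfolding visits_eq_0_iff
      by (metis insertI1 length_greater_0_conv order_refl take_all)
  qed (metis add.right_neutral assms(2) sum_list.Nil)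
  ultimately show ?thesis using assms by (simp add: settled_def)
qed

text \<open>The converse of \<open>arrives_prob_bound_sphere\<close>, with a time budget. Every
  return to the sphere is either direct within \<open>T\<close> steps or takes two steps through the
  origin, so \<open>T + 2\<close> steps per return suffice; an escape of probability \<gamma>
  freezes the counts.\<close>

lemma settled_prob_bound:
  fixes u v :: "int ^ 'd" and T :: nat
  assumes \<gamma>: "0 \<le> \<gamma>" "\<And>n u. u \<in> unit_steps \<Longrightarrow> \<gamma> \<le> word_prob n (\<lambda>l :: (int ^ 'd) list. visits unit_ball u l = 0)"
    and v: "v \<in> unit_steps"
  defines "a \<equiv> 1 / (2 * real CARD('d))" and "p \<equiv> direct_prob T v"
  assumes u: "u \<in> unit_steps" and L: "(T + 2) * l \<le> L" "L \<le> R"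
  shows "\<gamma> * excursion_weight a p k l \<le> word_prob R (settled k l L u)"
  using u L
proof (induction l arbitrary: k L R u)
  case 0
  show ?case
  proof (cases k)
    case 0
    have "\<gamma> \<le> word_prob R (\<lambda>l. visits unit_ball u l = 0)" using \<gamma>(2) 0 \<open>u \<in> unit_steps\<close> by blast
    also have "\<dots> \<le> word_prob R (settled k 0 L u)"
      unfolding 0 by (rule word_prob_mono, rule settled_0_0I) (use \<open>u \<in> unit_steps\<close> in auto)
    finally show ?thesis using 0 by simp
  qed (simp add: word_prob_nonneg)
next
  case (Suc l)
  let ?w = "excursion_weight a p"
  have a0: "0 \<le> a" and p0: "0 \<le> p" by (simp_all add: a_def p_def word_prob_nonneg)
  have w0: "0 \<le> \<gamma> * ?w k l" for k l
    using \<gamma>(1) excursion_weight_nonneg[OF a0 p0] by simp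
  note main_IH = Suc.IH
  \<comment> \<open>An inner induction on the number \<open>t\<close> of steps left for the current
    direct return; \<open>x\<close> runs through the points of this excursion.\<close>
  have direct_part: "\<gamma> * direct_prob t x * ?w k l \<le> word_prob R (\<lambda>w. settled k (Suc l) L x w \<and> direct x w)"
    if "t + (T + 2) * l \<le> L" "L \<le> R" for t L R and x :: "int ^ 'd"
    using that
  proof (induction t arbitrary: x L R)
    case 0
    then show ?case by (simp add: word_prob_nonneg)
  next
    case (Suc t)
    obtain L' where L': "L = Suc L'" using Suc.prems by (cases L) auto
    obtain R' where R': "R = Suc R'" using Suc.prems L' by (cases R) auto
    have "\<gamma> * ?w k l * (if x + e = 0 then 0 else if x + e \<in> unit_steps then 1 else direct_prob t (x + e))
        \<le> word_prob R' (\<lambda>w. settled k (Suc l) L x (e # w) \<and> direct x (e # w))"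
      if e: "e \<in> unit_steps" for e
    proof -
      consider "x + e = 0" | "x + e \<in> unit_steps" | "x + e \<notin> unit_ball" by blast
      then show ?thesis
      proof cases
        case 1
        then show ?thesis by (simp add: word_prob_nonneg)
      next
        case 2
        then have "x + e \<noteq> 0" by auto
        moreover have "\<gamma> * ?w k l \<le> word_prob R' (settled k l L' (x + e))"
          using 2 Suc.prems L' R' by (intro main_IH) auto
        ultimately show ?thesis using 2 by (simp add: L' settled_Cons)
      next
        case 3
        then have "x + e \<noteq> 0" "x + e \<notin> unit_steps" by auto
        then show ?thesis using Suc.IH[of L' R' "x + e"] Suc.prems
          by (simp add: L' R' settled_Cons mult_ac)
      qed
    qed
    then have "(\<Sum>e\<in>unit_steps. \<gamma> * ?w k l *
          (if x + e = 0 then 0 else if x + e \<in> unit_steps then 1 else direct_prob t (x + e))) / (2 * real CARD('d))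
        \<le> word_prob R (\<lambda>w. settled k (Suc l) L x w \<and> direct x w)"
      unfolding R' word_mean.simps by (intro divide_right_mono sum_mono) auto
    then show ?case
      unfolding direct_prob_Suc by (simp add: sum_distrib_left[symmetric] mult_ac)
  qed
  obtain L'' where L'': "L = Suc (Suc L'')" using Suc.prems by (cases L; cases "L - 1") auto
  obtain R'' where R'': "R = Suc (Suc R'')" using Suc.prems L'' by (cases R; cases "R - 1") auto
  have u0: "u \<noteq> 0" using Suc.prems by auto
  \<comment> \<open>The step \<open>- u\<close> to the origin has probability \<open>a\<close>, and
    whatever step follows leads back to the sphere.\<close>
  have origin_part: "a * (\<gamma> * ?w (k - 1) l) \<le> word_prob R (\<lambda>w. settled k (Suc l) L u w \<and> \<not> direct u w)"
    if "0 < k"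
  proof -
    have "\<gamma> * ?w (k - 1) l \<le> word_prob (Suc R'') (settled (k - 1) (Suc l) (Suc L'') (0 :: int ^ 'd))"
    proof -
      have "\<gamma> * ?w (k - 1) l \<le> word_prob R'' (\<lambda>w. settled (k - 1) (Suc l) (Suc L'') 0 (e # w))"
        if "e \<in> unit_steps" for e :: "int ^ 'd"
      proof -
        have "0 + e \<noteq> 0" "0 + e \<in> unit_steps" using that by auto
        then show ?thesis using Suc.IH[of e L'' R'' "k - 1"] that Suc.prems L'' R'' by (simp add: settled_Cons)
      qed
      then have "(\<Sum>e\<in>(unit_steps :: (int ^ 'd) set). \<gamma> * ?w (k - 1) l) / (2 * real CARD('d))
          \<le> word_prob (Suc R'') (settled (k - 1) (Suc l) (Suc L'') (0 :: int ^ 'd))"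
        unfolding word_mean.simps by (intro divide_right_mono sum_mono) auto
      then show ?thesis by (simp add: card_unit_steps)
    qed
    also have "\<dots> = word_prob (Suc R'') (\<lambda>w. settled k (Suc l) L u (- u # w) \<and> \<not> direct u (- u # w))"
      using that by (simp add: L'' settled_Cons)
    also have "\<dots> \<le> (\<Sum>e\<in>unit_steps. word_prob (Suc R'') (\<lambda>w. settled k (Suc l) L u (e # w) \<and> \<not> direct u (e # w)))"
      using Suc.prems by (intro member_le_sum word_prob_nonneg) auto
    finally have "a * (\<gamma> * ?w (k - 1) l) \<le>
      a * (\<Sum>e\<in>unit_steps. word_prob (Suc R'') (\<lambda>w. settled k (Suc l) L u (e # w) \<and> \<not> direct u (e # w)))"
      by (rule mult_left_mono[OF _ a0])
    then show ?thesis by (simp only: a_def R'' word_mean.simps(2)[of "Suc R''"]) simp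
  qed
  have "word_prob R (settled k (Suc l) L u) =
      word_prob R (\<lambda>w. settled k (Suc l) L u w \<and> direct u w) + word_prob R (\<lambda>w. settled k (Suc l) L u w \<and> \<not> direct u w)"
    unfolding word_mean_add[symmetric] by (rule word_mean_cong) auto
  moreover have "\<gamma> * p * ?w k l \<le> word_prob R (\<lambda>w. settled k (Suc l) L u w \<and> direct u w)"
    using direct_part[of T L R u] Suc.prems direct_prob_unit_steps[OF Suc.prems(1) v] by (simp add: p_def)
  moreover have "0 \<le> word_prob R (\<lambda>w. settled k (Suc l) L u w \<and> \<not> direct u w)"
    by (rule word_prob_nonneg)
  ultimately show ?case
    using origin_part by (cases k) (simp_all add: algebra_simps)
qed

section \<open>The rate function\<close>

text \<open>For y > 0 this is y times the relative entropy of (x/y, 1 - x/y) with respect to the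
  weights (1/(2d), p), whose sum is below 1 when the walk can escape.\<close>

definition rate :: "nat \<Rightarrow> real \<Rightarrow> real \<Rightarrow> real \<Rightarrow> real" where
  "rate d p x y = - y * ln y + x * ln (2 * real d * x) + (y - x) * ln ((y - x) / p)"

lemma mem_limit_region: "(x, y) \<in> limit_region d p \<longleftrightarrow> x \<le> y \<and> 0 \<le> x \<and> rate d p x y \<le> 1"
  by (simp add: limit_region_def rate_def)

lemma rate_0_0 [simp]: "rate d p 0 0 = 0"
  by (simp add: rate_def)

lemma rate_eq:
  assumes "0 < d" "0 < p" "0 \<le> x" "x \<le> y"
  shows "rate d p x y = x * ln x + (y - x) * ln (y - x) - y * ln y + x * ln (2 * real d) - (y - x) * ln p"
proof -
  have "x * ln (2 * real d * x) = x * ln x + x * ln (2 * real d)"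
    using assms by (cases "x = 0") (simp_all add: ln_mult algebra_simps)
  moreover have "(y - x) * ln ((y - x) / p) = (y - x) * ln (y - x) - (y - x) * ln p"
    using assms by (cases "y = x") (simp_all add: ln_div algebra_simps)
  ultimately show ?thesis by (simp add: rate_def)
qed

text \<open>The terms with ln c cancel because x + (y - x) = y.\<close>

lemma rate_scale:
  assumes "0 < d" "0 < p" "0 \<le> x" "x \<le> y" "0 < c"
  shows "rate d p (c * x) (c * y) = c * rate d p x y"
proof -
  have h: "(c * t) * ln (c * t) = c * (t * ln t) + c * t * ln c" if "0 \<le> t" for t
    using that assms(5) by (cases "t = 0") (simp_all add: ln_mult algebra_simps)
  have "c * y - c * x = c * (y - x)" by (simp add: algebra_simps)
  then have "rate d p (c * x) (c * y) = (c * x) * ln (c * x) + (c * (y - x)) * ln (c * (y - x)) - (c * y) * ln (c * y)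
      + (c * x) * ln (2 * real d) - (c * (y - x)) * ln p"
    using assms by (subst rate_eq) (simp_all add: mult_left_mono)
  also have "\<dots> = c * rate d p x y"
    unfolding rate_eq[OF assms(1-4)] h[OF assms(3)] h[of y, OF order_trans[OF assms(3,4)]]
      h[of "y - x", simplified, OF assms(4)]
    by (simp add: algebra_simps)
  finally show ?thesis .
qed

lemma scaled_limit_region:
  assumes "0 < d" "0 < p" "0 < c"
  shows "(x, y) \<in> (*\<^sub>R) c ` limit_region d p \<longleftrightarrow> x \<le> y \<and> 0 \<le> x \<and> rate d p x y \<le> c"
proof
  assume "(x, y) \<in> (*\<^sub>R) c ` limit_region d p"
  then obtain x' y' where xy: "x = c * x'" "y = c * y'" "x' \<le> y'" "0 \<le> x'" "rate d p x' y' \<le> 1"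
    using assms by (auto simp: mem_limit_region)
  then show "x \<le> y \<and> 0 \<le> x \<and> rate d p x y \<le> c"
    using assms rate_scale[OF assms(1,2) xy(4,3) assms(3)] by (simp add: mult_left_mono)
next
  assume *: "x \<le> y \<and> 0 \<le> x \<and> rate d p x y \<le> c"
  then have "rate d p (1 / c * x) (1 / c * y) = 1 / c * rate d p x y"
    using assms by (intro rate_scale) auto
  then have "(x / c, y / c) \<in> limit_region d p"
    using * assms by (simp add: mem_limit_region divide_right_mono)
  moreover have "(x, y) = c *\<^sub>R (x / c, y / c)" using assms by simp
  ultimately show "(x, y) \<in> (*\<^sub>R) c ` limit_region d p" by blast
qed

text \<open>Denominators are cleared, so that k = 0 and k = l are included: 0^0 = 1 matches 0 ln 0 =
  0.\<close>

lemma exp_rate: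
  assumes "0 < d" "0 < p" "k \<le> l"
  shows "exp (- rate d p (real k) (real l)) * (real k ^ k * real (l - k) ^ (l - k)) =
    real l ^ l * (1 / (2 * real d)) ^ k * p ^ (l - k)"
proof -
  have pow: "exp (real n * ln (real n)) = real n ^ n" for n
    by (cases "n = 0") (simp_all add: exp_of_nat_mult)
  have ep: "exp (real n * ln p) = p ^ n" for n
    using assms by (simp add: exp_of_nat_mult)
  have ed: "exp (real n * ln (2 * real d)) = (2 * real d) ^ n" for n
    using assms by (simp add: exp_of_nat_mult)
  have "real l - real k = real (l - k)" using assms by (simp add: of_nat_diff)
  then have "rate d p (real k) (real l) = real k * ln (real k) + real (l - k) * ln (real (l - k))
      - real l * ln (real l) + real k * ln (2 * real d) - real (l - k) * ln p"
    using rate_eq[of d p "real k" "real l"] assms by simp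
  then have "- rate d p (real k) (real l) + (real k * ln (real k) + real (l - k) * ln (real (l - k)))
      + real k * ln (2 * real d) = real l * ln (real l) + real (l - k) * ln p"
    by simp
  then have "exp (- rate d p (real k) (real l)) * (real k ^ k * real (l - k) ^ (l - k)) * (2 * real d) ^ k =
      real l ^ l * p ^ (l - k)"
    by (simp only: pow[symmetric] ep[symmetric] ed[symmetric] exp_add[symmetric])
  then show ?thesis
    using assms by (simp add: field_simps)
qed

lemma binomial_term_le:
  fixes x y :: real
  assumes "0 \<le> x" "0 \<le> y" "k \<le> l"
  shows "real (l choose k) * x ^ k * y ^ (l - k) \<le> (x + y) ^ l"
  unfolding binomial_ring using assms
  by (intro member_le_sum[of k "{..l}" "\<lambda>k. real (l choose k) * x ^ k * y ^ (l - k)"]) auto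

lemma self_power_pos: "0 < real k ^ k"
  by (cases k) auto

text \<open>A single term of the binomial expansion of (k + (l - k))^l is at most l^l.\<close>

lemma excursion_weight_le_exp_rate:
  assumes "0 < d" "0 < p"
  shows "k \<le> l \<Longrightarrow> excursion_weight (1 / (2 * real d)) p k l \<le> exp (- rate d p (real k) (real l))"
proof -
  assume kl: "k \<le> l"
  define P where "P = real k ^ k * real (l - k) ^ (l - k)"
  have P: "0 < P" unfolding P_def by (intro mult_pos_pos self_power_pos)
  have "real (l choose k) * P \<le> real l ^ l"
    using binomial_term_le[of "real k" "real (l - k)" k l] kl by (simp add: P_def of_nat_diff mult.assoc)
  then have "real (l choose k) * P * ((1 / (2 * real d)) ^ k * p ^ (l - k)) \<le> real l ^ l * ((1 / (2 * real d)) ^ k * p ^ (l - k))"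
    using assms by (intro mult_right_mono) auto
  then have "excursion_weight (1 / (2 * real d)) p k l * P \<le> exp (- rate d p (real k) (real l)) * P"
    unfolding excursion_weight_def P_def exp_rate[OF assms kl] by (simp add: mult_ac)
  then show ?thesis using P by simp
qed

text \<open>The mode of the binomial distribution with parameters \<open>l\<close> and \<open>k / l\<close> is \<open>k\<close>.\<close>

lemma binomial_mode:
  assumes "k \<le> l"
  shows "real l ^ l \<le> (real l + 1) * (real (l choose k) * (real k ^ k * real (l - k) ^ (l - k)))"
proof (cases "k = l")
  case True
  then show ?thesis by (simp add: mult_right_mono distrib_right)
next
  case False
  define m where "m = l - k"
  define b where "b i = real (l choose i) * real k ^ i * real m ^ (l - i)" for i
  have m: "0 < m" using False assms by (simp add: m_def)
  \<comment> \<open>The ratio of consecutive terms, without division. It is at least 1 for i < k and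
    at most 1 from i = k on.\<close>
  have rec: "b (Suc i) * (real (Suc i) * real m) = b i * (real (l - i) * real k)" if "i < l" for i
  proof -
    have "real (Suc i) * real (l choose Suc i) = real (l - i) * real (l choose i)"
      using binomial_absorb_comp[of l i] Suc_times_binomial[of i "l - 1"] that
      by (metis Suc_pred' binomial_absorb_comp of_nat_mult gr_implies_not0 neq0_conv diff_Suc_1)
    moreover have "real m ^ (l - i) = real m * real m ^ (l - Suc i)"
      using that by (metis Suc_diff_Suc power_Suc)
    ultimately show ?thesis by (simp add: b_def) (simp add: mult_ac)
  qed
  have b0: "0 \<le> b i" for i by (simp add: b_def)
  have up: "b i \<le> b k" if "i \<le> k" for i
    using that
  proof (induction i rule: inc_induct)
    case (step i)
    have "Suc i * m \<le> k * (l - i)" using step assms by (intro mult_mono) (auto simp: m_def)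
    then have "real (Suc i) * real m \<le> real (l - i) * real k"
      by (metis mult.commute of_nat_le_iff of_nat_mult)
    then have "b i * (real (Suc i) * real m) \<le> b i * (real (l - i) * real k)"
      by (intro mult_left_mono b0)
    also have "\<dots> = b (Suc i) * (real (Suc i) * real m)" using rec[of i] step assms by simp
    finally have "b i \<le> b (Suc i)" using m by simp
    then show ?case using step by simp
  qed simp
  have down: "b i \<le> b k" if "k \<le> i" "i \<le> l" for i
    using that
  proof (induction i rule: dec_induct)
    case (step i)
    have "k * (l - i) \<le> Suc i * m" using step assms by (intro mult_mono) (auto simp: m_def)
    then have "real (l - i) * real k \<le> real (Suc i) * real m"
      by (metis mult.commute of_nat_le_iff of_nat_mult)
    then have "b i * (real (l - i) * real k) \<le> b i * (real (Suc i) * real m)"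
      by (intro mult_left_mono b0)
    then have "b (Suc i) * (real (Suc i) * real m) \<le> b i * (real (Suc i) * real m)"
      using rec[of i] step by simp
    then have "b (Suc i) \<le> b i" using m by simp
    then show ?case using step by simp
  qed simp
  have "real l ^ l = (real k + real m) ^ l" using assms by (simp add: m_def of_nat_diff)
  also have "\<dots> = (\<Sum>i\<le>l. b i)" by (simp add: binomial_ring b_def)
  also have "\<dots> \<le> (\<Sum>i\<le>l. b k)" using up down by (intro sum_mono) (meson atMost_iff linear)
  also have "\<dots> = (real l + 1) * b k" by simp
  finally show ?thesis by (simp add: b_def m_def mult.assoc)
qed

lemma excursion_weight_ge_exp_rate:
  assumes "0 < d" "0 < p" "k \<le> l"
  shows "exp (- rate d p (real k) (real l)) \<le> (real l + 1) * excursion_weight (1 / (2 * real d)) p k l"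
proof -
  define P where "P = real k ^ k * real (l - k) ^ (l - k)"
  have P: "0 < P" unfolding P_def by (intro mult_pos_pos self_power_pos)
  have "real l ^ l * ((1 / (2 * real d)) ^ k * p ^ (l - k))
      \<le> (real l + 1) * (real (l choose k) * P) * ((1 / (2 * real d)) ^ k * p ^ (l - k))"
    unfolding P_def using assms binomial_mode by (intro mult_right_mono) auto
  then have "exp (- rate d p (real k) (real l)) * P \<le> (real l + 1) * excursion_weight (1 / (2 * real d)) p k l * P"
    unfolding excursion_weight_def P_def exp_rate[OF assms] by (simp add: mult_ac)
  then show ?thesis using P by simp
qed

section \<open>Linear growth of the rate and summation over pairs\<close>

lemma excursion_weight_le_power:
  assumes "0 \<le> a" "0 \<le> p"
  shows "excursion_weight a p k l \<le> (a + p) ^ l"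
proof (cases "k \<le> l")
  case False
  then show ?thesis using assms by (simp add: excursion_weight_def binomial_eq_0)
qed (use binomial_term_le assms in \<open>simp add: excursion_weight_def\<close>)

text \<open>With q = 1/(2d) + p, the weights (1/(2d), p) divided by q form a probability vector;
  relative entropy with respect to it is nonnegative, and l ln(1/q) is what normalising contributes.
  As a consequence, a bound on the rate bounds \<open>l\<close> linearly.\<close>

lemma rate_ge_linear:
  assumes d: "0 < d" and p: "0 < p" and kl: "k \<le> l"
  shows "real l * ln (1 / (1 / (2 * real d) + p)) \<le> rate d p (real k) (real l)"
proof (cases "l = 0")
  case False
  define q where "q = 1 / (2 * real d) + p"
  have q: "0 < q" using d p by (simp add: q_def add_pos_pos)
  have l: "0 < real l" using False by simp
  define m where "m = real l - real k"
  have m: "0 \<le> m" using kl by (simp add: m_def)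
  have gibbs: "t * ln s - t * ln t \<le> s - t" if "0 \<le> t" "0 < s" for s t :: real
  proof (cases "t = 0")
    case False
    then have t: "0 < t" using that by simp
    have "t * ln (s / t) \<le> t * (s / t - 1)"
      using t that by (intro mult_left_mono ln_le_minus_one) auto
    then show ?thesis using t that by (simp add: ln_div algebra_simps)
  qed (use that in simp)
  \<comment> \<open>The comparison values are the shares of \<open>l\<close> under the normalised
    weights. They add up to \<open>l\<close>, so the two right-hand sides cancel.\<close>
  have "real k * ln (real l / (2 * real d * q)) - real k * ln (real k) \<le> real l / (2 * real d * q) - real k"
    using l d q by (intro gibbs) auto
  moreover have "m * ln (p * real l / q) - m * ln m \<le> p * real l / q - m"
    using l p q m by (intro gibbs) auto
  moreover have "real l / (2 * real d * q) + p * real l / q = real l"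
  proof -
    have "real l / (2 * real d * q) + p * real l / q = real l * q / q"
      unfolding q_def using d p by (simp add: add_divide_distrib distrib_left mult.commute)
    then show ?thesis using q by simp
  qed
  moreover have "ln (real l / (2 * real d * q)) = ln (real l) - ln (2 * real d) - ln q"
    using l d q by (simp add: ln_div ln_mult)
  moreover have "ln (p * real l / q) = ln p + ln (real l) - ln q"
    using l p q by (simp add: ln_div ln_mult)
  ultimately have "real k * (ln (real l) - ln (2 * real d) - ln q) - real k * ln (real k)
      + (m * (ln p + ln (real l) - ln q) - m * ln m) \<le> 0"
    by (simp add: m_def)
  moreover have "rate d p (real k) (real l) = real k * ln (real k) + m * ln m - real l * ln (real l)
      + real k * ln (2 * real d) - m * ln p"
    using rate_eq[OF d p, of "real k" "real l"] kl by (simp add: m_def)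
  moreover have "real l * ln (real l) = real k * ln (real l) + m * ln (real l)"
    "real l * ln (1 / q) = - (real k * ln q) - m * ln q"
    using q by (simp_all add: ln_div m_def algebra_simps)
  ultimately show ?thesis
    unfolding q_def[symmetric] right_diff_distrib distrib_left by linarith
qed (use kl in simp)

lemma weighted_geometric_sum:
  fixes r :: real
  assumes "0 \<le> r" "r < 1"
  shows "(\<Sum>l<n. (real l + 1) * r ^ l) \<le> 1 / (1 - r)\<^sup>2"
proof -
  have "(\<Sum>l<n. (real l + 1) * r ^ l) * (1 - r)\<^sup>2 = 1 - (real n + 1) * r ^ n + real n * r ^ Suc n"
    by (induction n) (simp_all add: algebra_simps power2_eq_square)
  also have "\<dots> \<le> 1"
  proof -
    have "real n * r ^ Suc n \<le> (real n + 1) * r ^ n"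
      using assms by (intro mult_mono power_decreasing) auto
    then show ?thesis by simp
  qed
  finally show ?thesis using assms by (simp add: field_simps)
qed

text \<open>Each weight is at most exp(- c), but this alone is not summable uniformly in
  \<open>n\<close>. Writing w = w^(1 - s) w^s, the first factor is bounded by exp(- (1 - s) c) and
  the second by a geometric sequence in \<open>l\<close>.\<close>

lemma excursion_weight_tail_sum:
  assumes d: "0 < d" and p: "0 < p" and q: "1 / (2 * real d) + p < 1" and s: "0 < s" "s < 1" and c: "0 \<le> c"
  shows "(\<Sum>(k, l)\<in>{(k, l). k \<le> l \<and> l < n \<and> rate d p (real k) (real l) > c}.
      excursion_weight (1 / (2 * real d)) p k l)
    \<le> exp (- (1 - s) * c) / (1 - (1 / (2 * real d) + p) powr s)\<^sup>2"
proof -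
  define a where "a = 1 / (2 * real d)"
  define r where "r = (a + p) powr s"
  have a: "0 < a" using d by (simp add: a_def)
  have "r < 1 powr s" unfolding r_def using q s a p by (intro powr_less_mono2) (auto simp: a_def)
  then have r: "0 \<le> r" "r < 1" by (auto simp: r_def)
  define A where "A = {(k, l). k \<le> l \<and> l < n \<and> rate d p (real k) (real l) > c}"
  have A: "A \<subseteq> (SIGMA l:{..<n}. {..l})\<inverse>" by (auto simp: A_def)
  have fin: "finite ((SIGMA l:{..<n}. {..l})\<inverse>)" by simp
  have "(\<Sum>(k, l)\<in>A. excursion_weight a p k l) \<le> (\<Sum>(k, l)\<in>A. exp (- (1 - s) * c) * r ^ l)"
  proof (rule sum_mono, clarify)
    fix k l assume "(k, l) \<in> A"
    then have kl: "k \<le> l" "rate d p (real k) (real l) > c" by (auto simp: A_def)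
    let ?w = "excursion_weight a p k l"
    have w: "0 < ?w" using kl a p by (simp add: excursion_weight_def)
    have "?w \<le> exp (- rate d p (real k) (real l))"
      unfolding a_def by (rule excursion_weight_le_exp_rate[OF d p kl(1)])
    then have "?w \<le> exp (- c)" using kl(2) by (meson exp_le_cancel_iff le_less_trans neg_le_iff_le not_le order.strict_implies_order order_trans)
    then have "?w powr (1 - s) \<le> exp (- c) powr (1 - s)"
      using s w by (intro powr_mono2) auto
    also have "\<dots> = exp (- (1 - s) * c)" by (simp add: powr_def algebra_simps)
    finally have 1: "?w powr (1 - s) \<le> exp (- (1 - s) * c)" .
    have "?w powr s \<le> ((a + p) ^ l) powr s"
      using excursion_weight_le_power[of a p k l] a p s w by (intro powr_mono2) auto
    also have "\<dots> = r ^ l"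
      using a p unfolding r_def by (simp add: powr_realpow[symmetric] powr_powr mult.commute)
    finally have 2: "?w powr s \<le> r ^ l" .
    have "?w = ?w powr (1 - s) * ?w powr s"
      using w by (simp add: powr_add[symmetric])
    also have "\<dots> \<le> exp (- (1 - s) * c) * r ^ l"
      using 1 2 by (intro mult_mono) auto
    finally show "?w \<le> exp (- (1 - s) * c) * r ^ l" .
  qed
  also have "\<dots> \<le> (\<Sum>(k, l)\<in>(SIGMA l:{..<n}. {..l})\<inverse>. exp (- (1 - s) * c) * r ^ l)"
    using A fin r by (intro sum_mono2) auto
  also have "\<dots> = (\<Sum>(l, k)\<in>(SIGMA l:{..<n}. {..l}). exp (- (1 - s) * c) * r ^ l)"
    by (rule sum.reindex_bij_witness[of _ prod.swap prod.swap]) auto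
  also have "\<dots> = (\<Sum>l<n. \<Sum>k\<le>l. exp (- (1 - s) * c) * r ^ l)"
    by (subst sum.Sigma) auto
  also have "\<dots> = exp (- (1 - s) * c) * (\<Sum>l<n. (real l + 1) * r ^ l)"
    by (simp add: sum_distrib_left mult_ac add.commute)
  also have "\<dots> \<le> exp (- (1 - s) * c) * (1 / (1 - r)\<^sup>2)"
    using weighted_geometric_sum[OF r] by (intro mult_left_mono) auto
  finally show ?thesis by (simp add: A_def a_def r_def)
qed

section \<open>Upper bound\<close>

lemma uminus_unit_ball [simp]: "- x \<in> unit_ball \<longleftrightarrow> x \<in> unit_ball"
  by auto

lemma arrives_take: "arrives k l x (take n w) \<Longrightarrow> arrives k l x w"
proof (induction w arbitrary: k l x n)
  case (Cons e w)
  then obtain n' where "n = Suc n'" by (cases n) auto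
  then show ?case using Cons by (auto split: if_splits)
qed simp

text \<open>A visit to the origin comes one step after a point of the sphere, and this point is
  counted unless it is the start.\<close>

lemma visits_origin_le:
  assumes "set w \<subseteq> unit_steps"
  shows "visits {0} x w \<le> visits unit_steps x w + of_bool (x \<in> unit_steps)"
  using assms
proof (induction w arbitrary: x)
  case (Cons e w)
  have "x + e = 0 \<longrightarrow> x \<in> unit_steps" using add_eq_zero_unit_steps Cons.prems by auto
  moreover have "visits {0} (x + e) w \<le> visits unit_steps (x + e) w + of_bool (x + e \<in> unit_steps)"
    using Cons by auto
  ultimately show ?case by (auto split: if_splits)
qed simp

context
  fixes a p :: real and u :: "int ^ 'd" and w :: "nat \<Rightarrow> nat \<Rightarrow> real"
  assumes u: "u \<in> unit_steps"
  defines "a \<equiv> 1 / (2 * real CARD('d))" and "p \<equiv> direct_lim u"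
  defines "w \<equiv> excursion_weight a p"
begin

text \<open>\<open>arrives\<close> requires a return to the sphere; the second alternative adds the
  path that has not returned yet, whose weight is 1.\<close>

lemma arrives_or_start_prob: "word_prob R (\<lambda>v. arrives k l u v \<or> k = 0 \<and> l = 0) \<le> w k l"
proof (cases l)
  case 0
  then show ?thesis by (cases k) (simp_all add: not_arrives_0 word_mean_zero w_def)
next
  case (Suc l')
  then show ?thesis using arrives_prob_bound_sphere[OF u, of l R k] by (simp add: w_def a_def p_def)
qed

lemma w_nonneg: "0 \<le> w k l"
  by (simp add: w_def a_def p_def direct_lim_nonneg excursion_weight_nonneg)

text \<open>The occupation time of the sphere includes the entrance, so the rate is taken at one
  visit more than the returns counted by the weight. Adding a direct return, or one through the
  origin, makes up for this at the cost of a constant.\<close>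

lemma w_Suc_bounds: "w k l \<le> (1 / p) * w k (Suc l)" "w k l \<le> (1 / a) * w (Suc k) (Suc l)"
proof -
  have p: "0 < p" unfolding p_def by (rule direct_lim_pos[OF u])
  have a: "0 < a" by (simp add: a_def)
  have "p * w k l \<le> w k (Suc l)"
    using w_nonneg a by (cases k) (auto simp: w_def)
  then show "w k l \<le> (1 / p) * w k (Suc l)" using p by (simp add: field_simps)
  have "a * w k l \<le> w (Suc k) (Suc l)" using w_nonneg[of "Suc k" l] p by (simp add: w_def)
  then show "w k l \<le> (1 / a) * w (Suc k) (Suc l)" using a by (simp add: field_simps)
qed

text \<open>A path from the sphere that ends with \<open>k\<close> visits to the origin and \<open>l\<close> visits to the sphere ends
  either away from the origin, or at the origin one step after a path with \<open>k - 1\<close> visits to it.\<close>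

lemma visits_cases:
  assumes v: "set v \<subseteq> unit_steps" and k: "k = visits {0} u v" and l: "l = visits unit_steps u v"
  shows "(arrives k l u v \<or> k = 0 \<and> l = 0) \<or>
    0 < k \<and> (arrives (k - 1) l u v \<or> k - 1 = 0 \<and> l = 0)"
proof -
  have u0: "u \<noteq> 0" using u by auto
  have away: "arrives (visits {0} u v) (visits unit_steps u v) u v \<or> visits {0} u v = 0 \<and> visits unit_steps u v = 0"
    if "set v \<subseteq> unit_steps" "u + sum_list v \<noteq> 0" for v
    using arrivesI[OF that(2,1)] visits_origin_eq_0[OF _ u0 that(2,1)]
    by (cases "visits unit_steps u v = 0") simp_all
  show ?thesis
  proof (cases "u + sum_list v = 0")
    case True
    then have "v \<noteq> []" using u0 by auto
    then obtain v' e where v': "v = v' @ [e]" by (metis rev_exhaust)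
    have x: "u + sum_list v' \<in> unit_steps"
      by (rule add_eq_zero_unit_steps[of _ e]) (use True v in \<open>auto simp: v' add.assoc\<close>)
    have "u + sum_list v' + e = 0" using True by (simp add: v' add.assoc)
    then have kl: "visits {0} u v = Suc (visits {0} u v')" "visits unit_steps u v = visits unit_steps u v'"
      by (simp_all add: v' visits_append)
    have "u + sum_list v' \<noteq> 0" using x by auto
    moreover have "set v' \<subseteq> unit_steps" using v by (simp add: v')
    moreover have k': "k = Suc (visits {0} u v')" "l = visits unit_steps u v'"
      using k l kl by simp_all
    ultimately have "arrives (k - 1) l u v' \<or> k - 1 = 0 \<and> l = 0"
      using away[of v'] by simp
    moreover have "arrives (k - 1) l u v" if "arrives (k - 1) l u v'"
      using that by (intro arrives_take[of _ _ u "length v'" v]) (simp add: v')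
    ultimately show ?thesis using k'(1) by auto
  next
    case False
    then show ?thesis using away[OF v] unfolding k l by simp
  qed
qed

text \<open>The maximum over the times \<open>i\<close> is free: \<open>arrives\<close> is inherited
  by longer words, so the union runs over pairs of counts and not over times.\<close>

lemma rate_exceeds_prob:
  assumes q: "a + p < 1" and s: "0 < s" "s < 1" and c: "0 \<le> c"
  shows "word_prob R (\<lambda>v. \<exists>i\<le>R. c < rate CARD('d) p (real (visits {0} u (take i v)))
      (real (Suc (visits unit_steps u (take i v)))))
    \<le> (1 / p + 1 / a) * (exp (- (1 - s) * c) / (1 - (a + p) powr s)\<^sup>2)"
proof -
  have p: "0 < p" unfolding p_def by (rule direct_lim_pos[OF u])
  define A where "A = {(k, l). k \<le> l \<and> l < R + 2 \<and> c < rate CARD('d) p (real k) (real l)}"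
  have "A \<subseteq> {..R + 2} \<times> {..R + 2}" by (auto simp: A_def)
  then have finA: "finite A" by (rule finite_subset) simp
  define Q where "Q kl v \<longleftrightarrow> 0 < snd kl \<and> ((arrives (fst kl) (snd kl - 1) u v \<or> fst kl = 0 \<and> snd kl - 1 = 0) \<or>
    0 < fst kl \<and> (arrives (fst kl - 1) (snd kl - 1) u v \<or> fst kl - 1 = 0 \<and> snd kl - 1 = 0))" for kl v
  have "word_prob R (\<lambda>v. \<exists>i\<le>R. c < rate CARD('d) p (real (visits {0} u (take i v)))
      (real (Suc (visits unit_steps u (take i v))))) \<le> (\<Sum>kl\<in>A. word_prob R (Q kl))"
  proof (rule word_prob_union[OF finA])
    fix v :: "(int ^ 'd) list"
    assume v: "length v = R" "set v \<subseteq> unit_steps" "\<exists>i\<le>R. c < rate CARD('d) p (real (visits {0} u (take i v)))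
      (real (Suc (visits unit_steps u (take i v))))"
    then obtain i where i: "i \<le> R" "c < rate CARD('d) p (real (visits {0} u (take i v)))
      (real (Suc (visits unit_steps u (take i v))))" by blast
    define k where "k = visits {0} u (take i v)"
    define l where "l = visits unit_steps u (take i v)"
    have tv: "set (take i v) \<subseteq> unit_steps" using v(2) set_take_subset[of i v] by blast
    have "k \<le> Suc l" using visits_origin_le[OF tv, of u] u by (simp add: k_def l_def)
    moreover have "l \<le> R" using visits_le_length[of unit_steps u "take i v"] v(1) i(1) by (simp add: l_def)
    ultimately have "(k, Suc l) \<in> A" using i(2) by (simp add: A_def k_def l_def)
    moreover have "Q (k, Suc l) v"
      using visits_cases[OF tv k_def l_def] by (auto simp: Q_def intro: arrives_take)
    ultimately show "\<exists>kl\<in>A. Q kl v" by blast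
  qed
  also have "\<dots> \<le> (\<Sum>kl\<in>A. (1 / p + 1 / a) * w (fst kl) (snd kl))"
  proof (rule sum_mono)
    fix kl :: "nat \<times> nat"
    obtain k l where [simp]: "kl = (k, l)" by (cases kl)
    show "word_prob R (Q kl) \<le> (1 / p + 1 / a) * w (fst kl) (snd kl)"
    proof (cases l)
      case 0
      then show ?thesis using p w_nonneg by (simp add: Q_def word_mean_zero a_def)
    next
      case (Suc l')
      have "word_prob R (Q kl) \<le> word_prob R (\<lambda>v. arrives k l' u v \<or> k = 0 \<and> l' = 0) +
          word_prob R (\<lambda>v. 0 < k \<and> (arrives (k - 1) l' u v \<or> k - 1 = 0 \<and> l' = 0))"
        by (rule order_trans[OF _ word_prob_disj], rule word_prob_mono) (auto simp: Q_def Suc)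
      also have "\<dots> \<le> (1 / p) * w k l + (1 / a) * w k l"
      proof (rule add_mono)
        show "word_prob R (\<lambda>v. arrives k l' u v \<or> k = 0 \<and> l' = 0) \<le> (1 / p) * w k l"
          unfolding Suc by (rule order_trans[OF arrives_or_start_prob w_Suc_bounds(1)])
        show "word_prob R (\<lambda>v. 0 < k \<and> (arrives (k - 1) l' u v \<or> k - 1 = 0 \<and> l' = 0)) \<le> (1 / a) * w k l"
        proof (cases k)
          case 0
          then show ?thesis using w_nonneg by (simp add: word_mean_zero a_def)
        next
          case (Suc k')
          show ?thesis
            using order_trans[OF arrives_or_start_prob w_Suc_bounds(2), of R k' l'] \<open>l = Suc l'\<close> Suc by simp
        qed
      qed
      finally show ?thesis by (simp add: distrib_right)
    qed
  qed
  also have "\<dots> = (1 / p + 1 / a) * (\<Sum>(k, l)\<in>A. w k l)"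
    by (simp add: sum_distrib_left case_prod_unfold)
  also have "\<dots> \<le> (1 / p + 1 / a) * (exp (- (1 - s) * c) / (1 - (a + p) powr s)\<^sup>2)"
    unfolding A_def w_def a_def
    using p q s c by (intro mult_left_mono excursion_weight_tail_sum) (auto simp: a_def)
  finally show ?thesis .
qed

end

text \<open>The origin is reached only through the sphere, so the first point met in the ball lies
  on the sphere. An arbitrary subset \<open>A\<close> of the ball serves both counts at once; the
  \<open>of_bool\<close> term is the entrance itself.\<close>

lemma first_entrance:
  assumes z: "z \<notin> unit_ball" and l: "set l \<subseteq> unit_steps"
    and n: "n \<le> length l" "visits unit_ball z (take n l) \<noteq> 0"
  obtains i where "0 < i" "i \<le> n" "z + sum_list (take i l) \<in> unit_steps"
    "\<And>A. A \<subseteq> unit_ball \<Longrightarrow>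
      visits A z (take n l) = of_bool (z + sum_list (take i l) \<in> A) + visits A (z + sum_list (take i l)) (take (n - i) (drop i l))"
proof -
  define P where "P i \<longleftrightarrow> 0 < i \<and> i \<le> n \<and> z + sum_list (take i l) \<in> unit_ball" for i
  have "length (take n l) = n" using n by simp
  then obtain i0 where "0 < i0" "i0 \<le> n" "z + sum_list (take i0 (take n l)) \<in> unit_ball"
    using n(2) unfolding visits_eq_0_iff by auto
  then have "P i0" by (simp add: P_def take_take min.absorb1)
  define i where "i = (LEAST i. P i)"
  have Pi: "P i" unfolding i_def by (rule LeastI) fact
  have least: "i \<le> i'" if "P i'" for i' unfolding i_def by (rule Least_le) fact
  obtain i' where i': "i = Suc i'" using Pi by (cases i) (auto simp: P_def)
  have i'l: "i' < length l" using Pi n by (auto simp: P_def i')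
  define x where "x = z + sum_list (take i' l)"
  have step: "z + sum_list (take i l) = x + l ! i'"
    using i'l by (simp add: i' x_def take_Suc_conv_app_nth add.assoc)
  have none: "z + sum_list (take m l) \<notin> unit_ball" if "m \<le> i'" for m
  proof (cases "m = 0")
    case False
    then show ?thesis using least[of m] that Pi by (auto simp: P_def i')
  qed (use z in simp)
  have "l ! i' \<in> unit_steps" using l i'l nth_mem by blast
  then have "z + sum_list (take i l) \<noteq> 0"
    unfolding step using none[of i'] add_eq_zero_unit_steps[of x "l ! i'"] by (auto simp: x_def)
  then have sphere: "z + sum_list (take i l) \<in> unit_steps" using Pi by (auto simp: P_def)
  have decomp: "visits A z (take n l) = of_bool (z + sum_list (take i l) \<in> A) + visits A (z + sum_list (take i l)) (take (n - i) (drop i l))"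
    if A: "A \<subseteq> unit_ball" for A
  proof -
    have "visits A z (take i' l) = 0"
      unfolding visits_eq_0_iff using none A by (auto simp: min_def)
    moreover have "take i l = take i' l @ [l ! i']"
      using i'l by (simp add: i' take_Suc_conv_app_nth)
    ultimately have "visits A z (take i l) = of_bool (z + sum_list (take i l) \<in> A)"
      using step by (simp add: visits_append x_def add.assoc)
    moreover have "take n l = take i l @ take (n - i) (drop i l)"
      using Pi by (metis P_def take_add le_add_diff_inverse)
    ultimately show ?thesis by (simp add: visits_append)
  qed
  have "0 < i" "i \<le> n" using Pi by (simp_all add: P_def)
  then show thesis using sphere decomp by (rule that)
qed

text \<open>A ball that is entered is determined by the entrance time \<open>i\<close> and the
  position \<open>u\<close> relative to its centre, which makes 2dH cases; the walk after
  \<open>i\<close> is a walk from \<open>u\<close>. A ball never entered has both counts 0 and rate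
  0.\<close>

lemma upper_bound_prob:
  fixes v :: "int ^ 'd"
  assumes v: "v \<in> unit_steps"
  defines "a \<equiv> 1 / (2 * real CARD('d))" and "p \<equiv> direct_lim v"
  assumes q: "a + p < 1" and s: "0 < s" "s < 1" and c: "0 \<le> c"
  shows "word_prob H (\<lambda>l. \<exists>n\<le>H. \<exists>z :: int ^ 'd. z \<notin> unit_ball \<and>
      c < rate CARD('d) p (real (visits {0} (- z) (take n l))) (real (visits unit_steps (- z) (take n l))))
    \<le> 2 * real CARD('d) * real H * ((1 / p + 1 / a) * (exp (- (1 - s) * c) / (1 - (a + p) powr s)\<^sup>2))"
proof -
  define E where "E u R w \<longleftrightarrow> (\<exists>i\<le>R. c < rate CARD('d) p (real (visits {0} u (take i w)))
      (real (Suc (visits unit_steps u (take i w)))))" for u :: "int ^ 'd" and R w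
  define C where "C = (1 / p + 1 / a) * (exp (- (1 - s) * c) / (1 - (a + p) powr s)\<^sup>2)"
  have "word_prob H (\<lambda>l. \<exists>n\<le>H. \<exists>z :: int ^ 'd. z \<notin> unit_ball \<and>
      c < rate CARD('d) p (real (visits {0} (- z) (take n l))) (real (visits unit_steps (- z) (take n l))))
    \<le> (\<Sum>(i, u)\<in>{1..H} \<times> unit_steps. word_prob H (\<lambda>l. E u (H - i) (drop i l)))"
    unfolding case_prod_unfold
  proof (rule word_prob_union)
    fix l :: "(int ^ 'd) list" assume l: "length l = H" "set l \<subseteq> unit_steps"
    assume "\<exists>n\<le>H. \<exists>z :: int ^ 'd. z \<notin> unit_ball \<and>
      c < rate CARD('d) p (real (visits {0} (- z) (take n l))) (real (visits unit_steps (- z) (take n l)))"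
    then obtain n z where n: "n \<le> H" and z: "z \<notin> unit_ball"
      and r: "c < rate CARD('d) p (real (visits {0} (- z) (take n l))) (real (visits unit_steps (- z) (take n l)))"
      by blast
    have nz: "visits unit_ball (- z) (take n l) \<noteq> 0"
    proof
      assume "visits unit_ball (- z) (take n l) = 0"
      then have "visits {0} (- z) (take n l) = 0" "visits unit_steps (- z) (take n l) = 0"
        using visits_mono[of "{0}" unit_ball "- z" "take n l"] visits_mono[of unit_steps unit_ball "- z" "take n l"]
        by auto
      then show False using r c by simp
    qed
    have mz: "- z \<notin> unit_ball" and nl: "n \<le> length l" using z n l by auto
    obtain i where i: "0 < i" "i \<le> n" "- z + sum_list (take i l) \<in> unit_steps"
      and vis: "\<And>A. A \<subseteq> unit_ball \<Longrightarrow> visits A (- z) (take n l) =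
        of_bool (- z + sum_list (take i l) \<in> A) + visits A (- z + sum_list (take i l)) (take (n - i) (drop i l))"
      by (rule first_entrance[OF mz l(2) nl nz]) (rule that)
    define u where "u = - z + sum_list (take i l)"
    have "u \<noteq> 0" "u \<in> unit_steps" using i(3) by (auto simp: u_def)
    then have "visits {0} (- z) (take n l) = visits {0} u (take (n - i) (drop i l))"
      "visits unit_steps (- z) (take n l) = Suc (visits unit_steps u (take (n - i) (drop i l)))"
      using vis[of "{0}"] vis[of unit_steps] by (auto simp: u_def)
    then have "E u (H - i) (drop i l)" unfolding E_def using r n by (intro exI[of _ "n - i"]) auto
    then show "\<exists>x\<in>{1..H} \<times> unit_steps. E (snd x) (H - fst x) (drop (fst x) l)"
      using i n \<open>u \<in> unit_steps\<close> by (intro bexI[of _ "(i, u)"]) auto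
  qed simp
  also have "\<dots> \<le> (\<Sum>(i, u)\<in>{1..H} \<times> (unit_steps :: (int ^ 'd) set). C)"
  proof (rule sum_mono, clarify)
    fix i and u :: "int ^ 'd" assume i: "i \<in> {1..H}" and u: "u \<in> unit_steps"
    have pu: "direct_lim u = p" unfolding p_def by (rule direct_lim_unit_steps[OF u v])
    have "word_prob H (\<lambda>l. E u (H - i) (drop i l)) = word_prob (H - i) (E u (H - i))"
      using word_mean_drop[of i "H - i" "\<lambda>w. of_bool (E u (H - i) w)"] i by simp
    also have "\<dots> \<le> C"
      using rate_exceeds_prob[OF u, folded a_def, unfolded pu, OF q s c, of "H - i"]
      by (simp only: E_def C_def)
    finally show "word_prob H (\<lambda>l. E u (H - i) (drop i l)) \<le> C" .
  qed
  also have "\<dots> = 2 * real CARD('d) * real H * C"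
    by (simp add: card_unit_steps)
  finally show ?thesis by (simp add: C_def)
qed

section \<open>Lower bound\<close>

lemma word_prob_append_conj:
  "word_prob (m + n) (\<lambda>l. P (take m l) \<and> Q (drop m l)) = word_prob m P * word_prob n Q"
  unfolding of_bool_conj by (rule word_mean_append_mult)

lemma independent_blocks:
  "word_prob (K * m) (\<lambda>l. \<forall>b<K. \<not> G (take m (drop (b * m) l))) = (1 - word_prob m G) ^ K"
proof (induction K)
  case (Suc K)
  have "word_prob (Suc K * m) (\<lambda>l. \<forall>b<Suc K. \<not> G (take m (drop (b * m) l))) =
      word_prob (m + K * m) (\<lambda>l. \<not> G (take m l) \<and> (\<forall>b<K. \<not> G (take m (drop (b * m) (drop m l)))))"
    by (simp add: All_less_Suc2 add.commute)
  also have "\<dots> = word_prob m (\<lambda>l. \<not> G l) * word_prob (K * m) (\<lambda>l. \<forall>b<K. \<not> G (take m (drop (b * m) l)))"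
    by (rule word_prob_append_conj)
  also have "\<dots> = (1 - word_prob m G) ^ Suc K"
    by (simp add: Suc word_prob_compl)
  finally show ?case .
qed simp

lemma independent_blocks':
  fixes G :: "(int ^ 'd) list \<Rightarrow> bool"
  assumes "K * m \<le> H"
  shows "word_prob H (\<lambda>l. \<forall>b<K. \<not> G (take m (drop (b * m) l))) = (1 - word_prob m G) ^ K"
proof -
  have "take m (drop (b * m) (take (K * m) l)) = take m (drop (b * m) l)" if "b < K" for b and l :: "(int ^ 'd) list"
  proof -
    have "b * m + m \<le> K * m" using that mult_le_mono1[of "Suc b" K m] by simp
    then show ?thesis by (simp add: drop_take)
  qed
  then have "word_prob H (\<lambda>l. \<forall>b<K. \<not> G (take m (drop (b * m) l))) =
      word_prob (K * m + (H - K * m)) (\<lambda>l. \<forall>b<K. \<not> G (take m (drop (b * m) (take (K * m) l))))"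
    using assms by simp
  also have "\<dots> = word_prob (K * m) (\<lambda>l. \<forall>b<K. \<not> G (take m (drop (b * m) l)))"
    by (rule word_mean_take)
  finally show ?thesis by (simp add: independent_blocks)
qed

text \<open>The path read backwards from its end and reflected is again a path of the walk.\<close>

abbreviation backward :: "(int ^ 'd) list \<Rightarrow> (int ^ 'd) list" where
  "backward l \<equiv> map uminus (rev l)"

lemma word_mean_backward: "word_mean n (\<lambda>l. g (backward l)) = word_mean n g"
  using word_mean_rev[of n "\<lambda>l. g (map uminus l)"] word_mean_map[OF bij_betw_uminus_unit_steps, of n g] by simp

lemma sum_list_take_backward:
  assumes "r \<le> length l"
  shows "sum_list (take r (backward l)) = sum_list (take (length l - r) l) - sum_list l"
proof -
  have "take r (backward l) = backward (drop (length l - r) l)"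
    by (simp add: take_map rev_drop[symmetric]) (metis assms diff_diff_cancel take_rev)
  moreover have "sum_list (backward v) = - sum_list v" for v :: "(int ^ 'a) list"
    by (induction v) simp_all
  moreover have "sum_list l = sum_list (take (length l - r) l) + sum_list (drop (length l - r) l)"
    by (simp flip: sum_list_append)
  ultimately show ?thesis by simp
qed

context
  fixes u :: "int ^ 'd" and k l L :: nat
  assumes u: "u \<in> unit_steps" and L: "0 < L"
begin

text \<open>A block has length \<open>3 * L\<close>, and its centre is placed so that the walk is at
  \<open>u\<close> relative to it after \<open>L\<close> steps. Read backwards from there, the first
  \<open>L\<close> steps avoid the ball; the other \<open>2 * L\<close> steps produce the
  counts.\<close>

definition good_block :: "(int ^ 'd) list \<Rightarrow> bool" where
  "good_block c \<longleftrightarrow> visits unit_ball u (backward (take L c)) = 0 \<and> settled k l L u (drop L c)"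

text \<open>Here \<open>t\<close> is the time in the whole word at which the walk is at
  \<open>u\<close>. This event and \<open>late_visit\<close> cover exactly the visits to the ball
  that \<open>good_block\<close> leaves open.\<close>

definition early_visit :: "nat \<Rightarrow> (int ^ 'd) list \<Rightarrow> bool" where
  "early_visit t w \<longleftrightarrow> (\<exists>r. L < r \<and> r \<le> t \<and> u + sum_list (take r (backward (take t w))) \<in> unit_ball)"

definition late_visit :: "nat \<Rightarrow> (int ^ 'd) list \<Rightarrow> bool" where
  "late_visit t w \<longleftrightarrow> (\<exists>r. 2 * L < r \<and> r \<le> length w - t \<and> u + sum_list (take r (drop t w)) \<in> unit_ball)"

text \<open>The ball is avoided before time \<open>t\<close>, the position \<open>u\<close> at time
  \<open>t\<close> is the extra visit to the sphere, and all other visits fall into the next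
  \<open>2 * L\<close> steps. One centre thus serves every \<open>n\<close> from the end of the
  block on.\<close>

lemma good_block_visits:
  assumes good: "good_block (take (3 * L) (drop (b * (3 * L)) w))"
    and early: "\<not> early_visit (b * (3 * L) + L) w" and late: "\<not> late_visit (b * (3 * L) + L) w"
    and n: "Suc b * (3 * L) \<le> n" "n \<le> length w"
  shows "\<exists>z. visits {0} (- z) (take n w) = k \<and> visits unit_steps (- z) (take n w) = Suc l"
proof -
  define t where "t = b * (3 * L) + L"
  have t: "0 < t" "t + 2 * L \<le> n" "t + 2 * L \<le> length w" using n L by (auto simp: t_def)
  define z where "z = sum_list (take t w) - u"
  have len: "length (take t w) = t" using t by simp
  have fresh: "visits unit_ball u (backward (take L (drop (t - L) w))) = 0"
    and settled: "settled k l L u (take (2 * L) (drop t w))"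
  proof -
    have "take L (take (3 * L) (drop (b * (3 * L)) w)) = take L (drop (t - L) w)"
      by (simp add: t_def min_def)
    moreover have "drop L (take (3 * L) (drop (b * (3 * L)) w)) = take (2 * L) (drop t w)"
      by (simp add: t_def drop_take add.commute)
    ultimately show "visits unit_ball u (backward (take L (drop (t - L) w))) = 0"
      "settled k l L u (take (2 * L) (drop t w))"
      using good by (simp_all add: good_block_def)
  qed
  have split: "take t w = take (t - L) w @ take L (drop (t - L) w)"
    by (metis t_def add_diff_cancel_right' take_add)
  \<comment> \<open>The position at time \<open>i\<close> is that of the backward path from
    \<open>u\<close> at time \<open>t - i\<close>. Up to \<open>L\<close> the block excludes the
    ball, beyond \<open>L\<close> the absence of early visits does.\<close>
  have before: "- z + sum_list (take i w) \<notin> unit_ball" if "i < t" for i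
  proof -
    have "u + sum_list (take (t - i) (backward (take t w))) = - z + sum_list (take i w)"
      using sum_list_take_backward[of "t - i" "take t w"] that unfolding len by (simp add: z_def)
    moreover have "u + sum_list (take (t - i) (backward (take t w))) \<notin> unit_ball"
    proof (cases "t - i \<le> L")
      case True
      have Lt: "length (take L (drop (t - L) w)) = L" using t by (simp add: t_def)
      then have "take (t - i) (backward (take t w)) = take (t - i) (backward (take L (drop (t - L) w)))"
        unfolding split using True by (simp add: take_map)
      then show ?thesis
        using fresh True that Lt unfolding visits_eq_0_iff by (simp only: length_map length_rev) simp
    next
      case False
      then show ?thesis using early that unfolding early_visit_def t_def[symmetric]
        by (metis diff_le_self not_le)
    qed
    ultimately show ?thesis by simp
  qed
  have z_at: "- z + sum_list (take t w) = u" by (simp add: z_def)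
  have vis: "visits A (- z) (take n w) = of_bool (u \<in> A) + visits A u (take (2 * L) (drop t w))" if A: "A \<subseteq> unit_ball" for A
  proof -
    obtain t' where t': "t = Suc t'" using t by (cases t) auto
    have "visits A (- z) (take t' w) = 0"
      unfolding visits_eq_0_iff using before A t' by (auto simp: min_def)
    moreover have tt: "take t w = take t' w @ [w ! t']" using t by (simp add: t' take_Suc_conv_app_nth)
    moreover have "- z + sum_list (take t' w) + w ! t' = u"
      using z_at by (simp add: tt algebra_simps)
    ultimately have 1: "visits A (- z) (take t w) = of_bool (u \<in> A)"
      by (simp add: visits_append)
    have "n - t = 2 * L + (n - t - 2 * L)" using t by simp
    then have "take (n - t) (drop t w) = take (2 * L) (drop t w) @ take (n - t - 2 * L) (drop (2 * L) (drop t w))"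
      by (metis take_add)
    then have "visits A u (take (n - t) (drop t w)) =
        visits A u (take (2 * L) (drop t w)) + visits A (u + sum_list (take (2 * L) (drop t w))) (take (n - t - 2 * L) (drop (2 * L) (drop t w)))"
      by (simp only: visits_append)
    moreover have "visits A (u + sum_list (take (2 * L) (drop t w))) (take (n - t - 2 * L) (drop (2 * L) (drop t w))) = 0"
      unfolding visits_eq_0_iff
    proof (intro allI impI)
      fix i assume i: "0 < i" "i \<le> length (take (n - t - 2 * L) (drop (2 * L) (drop t w)))"
      then have "i \<le> n - t - 2 * L" by simp
      then have "take (2 * L + i) (drop t w) = take (2 * L) (drop t w) @ take i (take (n - t - 2 * L) (drop (2 * L) (drop t w)))"
        by (simp add: take_add min.absorb1)
      moreover have "u + sum_list (take (2 * L + i) (drop t w)) \<notin> unit_ball"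
        using late i t n unfolding late_visit_def t_def[symmetric] by auto
      ultimately show "u + sum_list (take (2 * L) (drop t w)) + sum_list (take i (take (n - t - 2 * L) (drop (2 * L) (drop t w)))) \<notin> A"
        using A by (auto simp: add.assoc)
    qed
    moreover have "take n w = take t w @ take (n - t) (drop t w)"
      using t by (metis add_leD1 le_add_diff_inverse take_add)
    ultimately show ?thesis using 1 z_at by (simp add: visits_append)
  qed
  have "u \<noteq> 0" using u by auto
  then show ?thesis
    using vis[of "{0}"] vis[of unit_steps] u settled by (intro exI[of _ z]) (auto simp: settled_def)
qed

text \<open>One factor \<gamma> is for the backward path that avoids the ball, the other for the
  final escape in \<open>settled_prob_bound\<close>.\<close>

lemma good_block_prob:
  assumes \<gamma>: "0 \<le> \<gamma>" "\<And>n u. u \<in> unit_steps \<Longrightarrow> \<gamma> \<le> word_prob n (\<lambda>l :: (int ^ 'd) list. visits unit_ball u l = 0)"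
    and T: "(T + 2) * l \<le> L"
  shows "\<gamma> * (\<gamma> * excursion_weight (1 / (2 * real CARD('d))) (direct_prob T u) k l) \<le> word_prob (3 * L) good_block"
proof -
  have "word_prob (3 * L) good_block = word_prob L (\<lambda>c. visits unit_ball u (backward c) = 0) * word_prob (2 * L) (settled k l L u)"
    using word_prob_append_conj[of L "2 * L" "\<lambda>c. visits unit_ball u (backward c) = 0" "settled k l L u"]
    by (simp add: good_block_def[abs_def])
  also have "word_prob L (\<lambda>c. visits unit_ball u (backward c) = 0) = word_prob L (\<lambda>c. visits unit_ball u c = 0)"
    by (rule word_mean_backward)
  finally show ?thesis
    using \<gamma> u T by (auto intro!: mult_mono settled_prob_bound excursion_weight_nonneg mult_nonneg_nonneg word_prob_nonneg)
qed

text \<open>What \<open>settled\<close> implies for the \<open>L\<close> steps after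
  \<open>t\<close> alone. Its probability is at most the excursion weight, the factor by which a
  revisit must be discounted.\<close>

definition started :: "(int ^ 'd) list \<Rightarrow> bool" where
  "started c \<longleftrightarrow> arrives k l u c \<or> k = 0 \<and> l = 0"

lemma settled_started:
  assumes "settled k l L u (take (2 * L) w)" "set w \<subseteq> unit_steps"
  shows "started (take L w)"
proof -
  have "visits {0} u (take L w) = k" "visits unit_steps u (take L w) = l" "u + sum_list (take L w) \<noteq> 0"
    using assms(1) by (auto simp: settled_def)
  moreover have "set (take L w) \<subseteq> unit_steps" using assms(2) set_take_subset[of L w] by blast
  moreover have "u \<noteq> 0" using u by auto
  ultimately show ?thesis
    using arrivesI[of u "take L w"] visits_origin_eq_0[of u "take L w"] by (auto simp: started_def)
qed

lemma started_prob: "word_prob n started \<le> excursion_weight (1 / (2 * real CARD('d))) (direct_lim u) k l"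
  unfolding started_def by (rule arrives_or_start_prob[OF u])

text \<open>The past of \<open>t\<close>, read backwards, is independent of the \<open>L\<close>
  steps after \<open>t\<close>, so the two bounds multiply.\<close>

lemma early_prob:
  assumes d: "CARD('d) \<ge> 4" and H: "t + L \<le> H"
  shows "word_prob H (\<lambda>w. early_visit t w \<and> started (take L (drop t w))) \<le>
    excursion_weight (1 / (2 * real CARD('d))) (direct_lim u) k l * (green_const CARD('d) / (real L + 1))"
proof -
  let ?V = "\<lambda>c. \<exists>r. L < r \<and> r \<le> t \<and> u + sum_list (take r c) \<in> unit_ball"
  have "word_prob H (\<lambda>w. early_visit t w \<and> started (take L (drop t w))) =
      word_prob (t + (L + (H - t - L))) (\<lambda>w. ?V (backward (take t w)) \<and> started (take L (drop t w)))"
    using H by (simp add: early_visit_def)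
  also have "\<dots> = word_prob t (\<lambda>c. ?V (backward c)) * word_prob (L + (H - t - L)) (\<lambda>w. started (take L w))"
    by (rule word_prob_append_conj)
  also have "word_prob t (\<lambda>c. ?V (backward c)) = word_prob t ?V"
    by (rule word_mean_backward)
  also have "word_prob (L + (H - t - L)) (\<lambda>w. started (take L w)) = word_prob L started"
    by (rule word_mean_take)
  also have "word_prob t ?V * word_prob L started \<le>
      (green_const CARD('d) / (real L + 1)) * excursion_weight (1 / (2 * real CARD('d))) (direct_lim u) k l"
    by (intro mult_mono late_visit_bound[OF d] started_prob) (auto simp: word_prob_nonneg green_const_nonneg)
  finally show ?thesis by (simp only: mult.commute)
qed

text \<open>Given the \<open>L\<close> steps after \<open>t\<close>, the visit comes more than
  \<open>L\<close> steps later, and \<open>late_visit_bound\<close> is uniform in the starting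
  point.\<close>

lemma late_prob:
  assumes d: "CARD('d) \<ge> 4" and H: "t + L \<le> H"
  shows "word_prob H (\<lambda>w. late_visit t w \<and> started (take L (drop t w))) \<le>
    excursion_weight (1 / (2 * real CARD('d))) (direct_lim u) k l * (green_const CARD('d) / (real L + 1))"
proof -
  define R where "R = H - t - L"
  have HR: "H = t + (L + R)" using H by (simp add: R_def)
  let ?V = "\<lambda>x c. \<exists>r. L < r \<and> r \<le> R \<and> x + sum_list (take r c) \<in> unit_ball"
  have "word_prob H (\<lambda>w. late_visit t w \<and> started (take L (drop t w))) \<le>
      word_prob (t + (L + R)) (\<lambda>w. started (take L (drop t w)) \<and> ?V (u + sum_list (take L (drop t w))) (drop L (drop t w)))"
    unfolding HR
  proof (rule word_prob_mono)
    fix w :: "(int ^ 'd) list" assume w: "length w = t + (L + R)" "late_visit t w \<and> started (take L (drop t w))"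
    then obtain r where r: "2 * L < r" "r \<le> L + R" "u + sum_list (take r (drop t w)) \<in> unit_ball"
      by (auto simp: late_visit_def)
    have "take r (drop t w) = take L (drop t w) @ take (r - L) (drop L (drop t w))"
      using r(1) by (metis add_diff_inverse_nat less_imp_not_less mult_2 take_add trans_less_add1)
    then have "u + sum_list (take L (drop t w)) + sum_list (take (r - L) (drop L (drop t w))) \<in> unit_ball"
      using r(3) by (simp add: add.assoc)
    then show "started (take L (drop t w)) \<and> ?V (u + sum_list (take L (drop t w))) (drop L (drop t w))"
      using w r by (intro conjI exI[of _ "r - L"]) auto
  qed
  also have "\<dots> = word_prob (L + R) (\<lambda>w. started (take L w) \<and> ?V (u + sum_list (take L w)) (drop L w))"
    by (rule word_mean_drop)
  also have "\<dots> = word_mean L (\<lambda>a. word_prob R (\<lambda>b. started a \<and> ?V (u + sum_list a) b))"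
    unfolding word_mean_append by (rule word_mean_cong) simp
  also have "\<dots> \<le> word_mean L (\<lambda>a. (green_const CARD('d) / (real L + 1)) * of_bool (started a))"
  proof (rule word_mean_mono)
    fix a :: "(int ^ 'd) list"
    show "word_prob R (\<lambda>b. started a \<and> ?V (u + sum_list a) b) \<le> (green_const CARD('d) / (real L + 1)) * of_bool (started a)"
      using late_visit_bound[OF d, of R L "u + sum_list a"] by (cases "started a") (auto simp: word_mean_zero)
  qed
  also have "\<dots> = (green_const CARD('d) / (real L + 1)) * word_prob L started"
    by (rule word_mean_cmult)
  also have "\<dots> \<le> (green_const CARD('d) / (real L + 1)) * excursion_weight (1 / (2 * real CARD('d))) (direct_lim u) k l"
    by (intro mult_left_mono started_prob) (simp add: green_const_nonneg)
  finally show ?thesis by (simp only: mult.commute)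
qed

text \<open>Failure means that no block is good or that some block is revisited. A good block is in
  particular \<open>started\<close>, so only revisits together with \<open>started\<close> have to
  be counted.\<close>

lemma lower_bound_prob:
  assumes d: "CARD('d) \<ge> 4"
    and \<gamma>: "0 \<le> \<gamma>" "\<And>n u. u \<in> unit_steps \<Longrightarrow> \<gamma> \<le> word_prob n (\<lambda>l :: (int ^ 'd) list. visits unit_ball u l = 0)"
    and T: "(T + 2) * l \<le> L" and H: "K * (3 * L) \<le> N" "N \<le> H"
  shows "word_prob H (\<lambda>w. \<not> (\<forall>n. N \<le> n \<and> n \<le> H \<longrightarrow>
      (\<exists>z :: int ^ 'd. visits {0} (- z) (take n w) = k \<and> visits unit_steps (- z) (take n w) = Suc l)))
    \<le> (1 - \<gamma> * (\<gamma> * excursion_weight (1 / (2 * real CARD('d))) (direct_prob T u) k l)) ^ K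
      + 2 * real K * (excursion_weight (1 / (2 * real CARD('d))) (direct_lim u) k l * (green_const CARD('d) / (real L + 1)))"
proof -
  let ?W = "excursion_weight (1 / (2 * real CARD('d))) (direct_lim u) k l * (green_const CARD('d) / (real L + 1))"
  define t where "t b = b * (3 * L) + L" for b
  have tH: "t b + 2 * L \<le> H" if "b < K" for b
  proof -
    have "Suc b * (3 * L) \<le> K * (3 * L)" using that by (intro mult_le_mono1) simp
    then show ?thesis using H by (simp add: t_def)
  qed
  define bad where "bad b w \<longleftrightarrow> (early_visit (t b) w \<or> late_visit (t b) w) \<and> started (take L (drop (t b) w))" for b w
  have "word_prob H (\<lambda>w. \<not> (\<forall>n. N \<le> n \<and> n \<le> H \<longrightarrow>
      (\<exists>z :: int ^ 'd. visits {0} (- z) (take n w) = k \<and> visits unit_steps (- z) (take n w) = Suc l))) \<le>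
    word_prob H (\<lambda>w. (\<forall>b<K. \<not> good_block (take (3 * L) (drop (b * (3 * L)) w))) \<or> (\<exists>b\<in>{..<K}. bad b w))"
  proof (rule word_prob_mono, rule ccontr)
    fix w :: "(int ^ 'd) list" assume w: "length w = H" "set w \<subseteq> unit_steps"
    assume none: "\<not> (\<forall>n. N \<le> n \<and> n \<le> H \<longrightarrow>
      (\<exists>z :: int ^ 'd. visits {0} (- z) (take n w) = k \<and> visits unit_steps (- z) (take n w) = Suc l))"
    assume "\<not> ((\<forall>b<K. \<not> good_block (take (3 * L) (drop (b * (3 * L)) w))) \<or> (\<exists>b\<in>{..<K}. bad b w))"
    then obtain b where b: "b < K" "good_block (take (3 * L) (drop (b * (3 * L)) w))" "\<not> bad b w" by auto
    have "settled k l L u (take (2 * L) (drop (t b) w))"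
      using b(2) by (simp add: good_block_def t_def drop_take add.commute)
    moreover have "set (drop (t b) w) \<subseteq> unit_steps" using w(2) set_drop_subset[of "t b" w] by blast
    ultimately have "started (take L (drop (t b) w))" by (rule settled_started)
    then have "\<not> early_visit (t b) w" "\<not> late_visit (t b) w" using b(3) by (auto simp: bad_def)
    moreover have "Suc b * (3 * L) \<le> N"
      using b(1) H by (intro order_trans[OF mult_le_mono1 H(1)]) simp
    ultimately have "\<forall>n. N \<le> n \<and> n \<le> H \<longrightarrow>
      (\<exists>z :: int ^ 'd. visits {0} (- z) (take n w) = k \<and> visits unit_steps (- z) (take n w) = Suc l)"
      using good_block_visits[OF b(2)] w(1) by (auto simp: t_def)
    then show False using none by blast
  qed
  also have "\<dots> \<le> word_prob H (\<lambda>w. \<forall>b<K. \<not> good_block (take (3 * L) (drop (b * (3 * L)) w)))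
      + word_prob H (\<lambda>w. \<exists>b\<in>{..<K}. bad b w)"
    by (rule word_prob_disj)
  also have "word_prob H (\<lambda>w. \<forall>b<K. \<not> good_block (take (3 * L) (drop (b * (3 * L)) w))) =
      (1 - word_prob (3 * L) good_block) ^ K"
    using H by (intro independent_blocks') simp
  also have "\<dots> \<le> (1 - \<gamma> * (\<gamma> * excursion_weight (1 / (2 * real CARD('d))) (direct_prob T u) k l)) ^ K"
    using good_block_prob[OF \<gamma> T] word_prob_le_1[of "3 * L" good_block] by (intro power_mono) auto
  also have "word_prob H (\<lambda>w. \<exists>b\<in>{..<K}. bad b w) \<le> (\<Sum>b<K. word_prob H (bad b))"
    by (rule word_prob_union) auto
  also have "\<dots> \<le> (\<Sum>b<K. 2 * ?W)"
  proof (rule sum_mono)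
    fix b assume "b \<in> {..<K}"
    then have tL: "t b + L \<le> H" using tH[of b] by simp
    have "word_prob H (bad b) \<le> word_prob H (\<lambda>w. early_visit (t b) w \<and> started (take L (drop (t b) w)))
        + word_prob H (\<lambda>w. late_visit (t b) w \<and> started (take L (drop (t b) w)))"
      by (rule order_trans[OF _ word_prob_disj], rule word_prob_mono) (auto simp: bad_def)
    then show "word_prob H (bad b) \<le> 2 * ?W"
      using early_prob[OF d tL] late_prob[OF d tL] by linarith
  qed
  also have "(\<Sum>b<K. 2 * ?W) = 2 * real K * ?W" by simp
  finally show ?thesis by simp
qed

end

section \<open>From words to the random walk\<close>

lemma word_mean_eq_sum:
  fixes g :: "(int ^ 'd) list \<Rightarrow> real"
  shows "word_mean n g = (\<Sum>w | set w \<subseteq> unit_steps \<and> length w = n. g w * (1 / (2 * real CARD('d))) ^ n)"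
proof -
  let ?W = "{w :: (int ^ 'd) list. set w \<subseteq> unit_steps \<and> length w = n}"
  have fin: "finite ?W" by (simp add: finite_lists_length_eq)
  have "word_mean n g = word_mean n (\<lambda>l. \<Sum>w\<in>?W. g w * of_bool (l = w))"
  proof (rule word_mean_cong)
    fix l :: "(int ^ 'd) list" assume "length l = n" "set l \<subseteq> unit_steps"
    then have "l \<in> ?W" by simp
    have "(\<Sum>w\<in>?W. g w * of_bool (l = w)) = (\<Sum>w\<in>?W. if w = l then g w else 0)"
      by (intro sum.cong) auto
    also have "\<dots> = g l" using fin \<open>l \<in> ?W\<close> by (subst sum.delta) auto
    finally show "g l = (\<Sum>w\<in>?W. g w * of_bool (l = w))" by simp
  qed
  also have "\<dots> = (\<Sum>w\<in>?W. g w * word_prob n (\<lambda>l. l = w))"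
    by (simp only: word_mean_sum word_mean_cmult)
  also have "\<dots> = (\<Sum>w\<in>?W. g w * (1 / (2 * real CARD('d))) ^ n)"
    by (intro sum.cong) (auto simp: word_prob_singleton)
  finally show ?thesis .
qed

definition steps_word :: "(nat \<Rightarrow> int ^ 'd) \<Rightarrow> nat \<Rightarrow> (int ^ 'd) list" where
  "steps_word x n = map (\<lambda>i. x (Suc i)) [0..<n]"

lemma length_steps_word [simp]: "length (steps_word x n) = n"
  by (simp add: steps_word_def)

lemma take_steps_word: "i \<le> n \<Longrightarrow> take i (steps_word x n) = steps_word x i"
  by (simp add: steps_word_def take_map)

lemma walk_eq: "walk z x n = z + sum_list (steps_word x n)"
proof -
  have "(\<Sum>k=1..n. x k) = sum_list (steps_word x n)"
    by (induction n) (simp_all add: steps_word_def)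
  then show ?thesis by (simp add: walk_def)
qed

lemma walk_eq_take: "i \<le> n \<Longrightarrow> walk z x i = z + sum_list (take i (steps_word x n))"
  by (simp add: walk_eq take_steps_word)

lemma visits_translate: "visits ((\<lambda>v. v + z) ` A) x l = visits A (x - z) l"
proof (induction l arbitrary: x)
  case (Cons e l)
  have "x + e \<in> (\<lambda>v. v + z) ` A \<longleftrightarrow> x - z + e \<in> A"
    by (auto simp: image_iff algebra_simps) (metis diff_add_cancel add.commute add_diff_eq)
  then show ?case using Cons[of "x + e"] by (simp add: algebra_simps)
qed simp

lemma visits_sum: "finite A \<Longrightarrow> visits A x l = (\<Sum>a\<in>A. visits {a} x l)"
proof (induction l arbitrary: x)
  case (Cons e l)
  have "(\<Sum>a\<in>A. of_bool (x + e = a)) = (of_bool (x + e \<in> A) :: nat)"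
  proof -
    have "(\<Sum>a\<in>A. of_bool (x + e = a)) = (\<Sum>a\<in>A. if a = x + e then 1 else 0 :: nat)"
      by (intro sum.cong) auto
    then show ?thesis using Cons.prems by (simp add: sum.delta)
  qed
  then show ?case using Cons by (simp add: sum.distrib)
qed simp

text \<open>Instead of the ball, the start of the path is translated, so that all estimates concern
  one fixed ball.\<close>

lemma local_time_eq_visits: "local_time (walk 0 x) z n = visits {0} (- z) (steps_word x n)"
proof -
  have "visits {0} (- z) (steps_word x n) = visits {z} 0 (steps_word x n)"
    using visits_translate[of z "{0}" 0 "steps_word x n"] by simp
  also have "\<dots> = local_time (walk 0 x) z n"
    unfolding visits_eq_card local_time_def
    by (intro arg_cong[of _ _ card]) (auto simp: walk_eq_take[of _ n])
  finally show ?thesis by simp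
qed

lemma sphere_occupation_time_eq_visits:
  "sphere_occupation_time (walk 0 x) z n = visits unit_steps (- z) (steps_word x n)"
proof -
  have "visits unit_steps (- z) (steps_word x n) = visits ((\<lambda>v. v + z) ` unit_steps) 0 (steps_word x n)"
    by (simp add: visits_translate)
  also have "\<dots> = (\<Sum>y\<in>(\<lambda>v. v + z) ` unit_steps. visits {y} 0 (steps_word x n))"
    by (rule visits_sum) simp
  also have "\<dots> = sphere_occupation_time (walk 0 x) z n"
    unfolding sphere_occupation_time_def unit_sphere_eq_unit_steps local_time_eq_visits
    using visits_translate[of _ "{0}" 0 "steps_word x n"] by (intro sum.cong) auto
  finally show ?thesis by simp
qed

context simple_random_walk
begin

section \<open>Transfer of word probabilities to the process\<close>

lemma measurable_step: "k \<ge> 1 \<Longrightarrow> X k \<in> measurable M (count_space UNIV)"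
  using indep_steps by (auto simp: indep_vars_def)

lemma prob_cylinder:
  assumes w: "set w \<subseteq> unit_steps"
  shows "prob {\<omega> \<in> space M. steps_word (\<lambda>k. X k \<omega>) (length w) = w} = (1 / (2 * real CARD('d))) ^ length w"
proof -
  have eq: "steps_word (\<lambda>k. X k \<omega>) (length w) = w \<longleftrightarrow> (\<forall>k\<in>{1..length w}. X k \<omega> = w ! (k - 1))" for \<omega>
  proof
    assume "steps_word (\<lambda>k. X k \<omega>) (length w) = w"
    then have "X (Suc i) \<omega> = w ! i" if "i < length w" for i
      using that nth_map[of i "[0..<length w]" "\<lambda>i. X (Suc i) \<omega>"] by (simp add: steps_word_def)
    then show "\<forall>k\<in>{1..length w}. X k \<omega> = w ! (k - 1)"
      by (metis One_nat_def Suc_le_eq Suc_pred' atLeastAtMost_iff)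
  next
    assume *: "\<forall>k\<in>{1..length w}. X k \<omega> = w ! (k - 1)"
    then show "steps_word (\<lambda>k. X k \<omega>) (length w) = w"
      by (intro nth_equalityI) (auto simp: steps_word_def)
  qed
  show "prob {\<omega> \<in> space M. steps_word (\<lambda>k. X k \<omega>) (length w) = w} = (1 / (2 * real CARD('d))) ^ length w"
  proof (cases "w = []")
    case True
    then show ?thesis by (simp add: steps_word_def prob_space)
  next
    case False
    have "{\<omega> \<in> space M. steps_word (\<lambda>k. X k \<omega>) (length w) = w} =
        (\<Inter>k\<in>{1..length w}. X k -` {w ! (k - 1)} \<inter> space M)"
      unfolding eq using False by (cases w) auto
    then have "prob {\<omega> \<in> space M. steps_word (\<lambda>k. X k \<omega>) (length w) = w} =
        (\<Prod>k\<in>{1..length w}. prob (X k -` {w ! (k - 1)} \<inter> space M))"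
      using False by (simp only:) (intro indep_varsD[OF indep_steps], auto simp: Suc_le_eq)
    also have "\<dots> = (\<Prod>k\<in>{1..length w}. 1 / (2 * real CARD('d)))"
    proof (rule prod.cong)
      fix k assume k: "k \<in> {1..length w}"
      then have "w ! (k - 1) \<in> unit_steps" using w nth_mem[of "k - 1" w] by auto
      moreover have "X k -` {w ! (k - 1)} \<inter> space M = {\<omega> \<in> space M. X k \<omega> = w ! (k - 1)}" by auto
      ultimately show "prob (X k -` {w ! (k - 1)} \<inter> space M) = 1 / (2 * real CARD('d))"
        using prob_step[of k "w ! (k - 1)"] k by simp
    qed simp
    finally show ?thesis by simp
  qed
qed

text \<open>The 2d prescribed probabilities add up to 1.\<close>

lemma AE_unit_steps: "AE \<omega> in M. \<forall>k\<ge>1. X k \<omega> \<in> unit_steps"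
proof -
  have "AE \<omega> in M. k \<ge> 1 \<longrightarrow> X k \<omega> \<in> unit_steps" for k
  proof (cases "k \<ge> 1")
    case True
    have ev: "{\<omega> \<in> space M. X k \<omega> = e} \<in> events" for e
      using measurable_sets[OF measurable_step[OF True], of "{e}"] by (simp add: vimage_def Int_def conj_commute)
    have "{\<omega> \<in> space M. X k \<omega> \<in> unit_steps} = (\<Union>e\<in>unit_steps. {\<omega> \<in> space M. X k \<omega> = e})" by auto
    then have "prob {\<omega> \<in> space M. X k \<omega> \<in> unit_steps} = (\<Sum>e\<in>unit_steps. prob {\<omega> \<in> space M. X k \<omega> = e})"
      using ev by (simp only:) (intro finite_measure_finite_Union, auto simp: disjoint_family_on_def)
    also have "\<dots> = 1" using True by (simp add: prob_step card_unit_steps)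
    finally have "prob {\<omega> \<in> space M. X k \<omega> \<in> unit_steps} = 1" .
    moreover have "{\<omega> \<in> space M. X k \<omega> \<in> unit_steps} \<in> events"
      using measurable_sets[OF measurable_step[OF True], of unit_steps] by (simp add: vimage_def Int_def conj_commute)
    ultimately have "AE \<omega> in M. X k \<omega> \<in> unit_steps" by (simp add: prob_Collect_eq_1)
    then show ?thesis by simp
  qed simp
  then show ?thesis by (simp add: AE_all_countable)
qed

text \<open>Words form a countable type, so an arbitrary predicate \<open>Q\<close>, such as one
  that quantifies over all centres, gives an event.\<close>

lemma word_event: "{\<omega> \<in> space M. Q (steps_word (\<lambda>k. X k \<omega>) n)} \<in> events"
proof -
  have meas: "(\<lambda>\<omega>. steps_word (\<lambda>k. X k \<omega>) n) \<in> measurable M (count_space UNIV)"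
  proof (rule measurableI)
    fix A :: "(int ^ 'd) list set"
    have one: "{\<omega> \<in> space M. steps_word (\<lambda>k. X k \<omega>) n = w} \<in> events" for w
    proof (cases "length w = n")
      case True
      have "{\<omega> \<in> space M. steps_word (\<lambda>k. X k \<omega>) n = w} = {\<omega> \<in> space M. \<forall>i\<in>{..<n}. X (Suc i) \<omega> = w ! i}"
        using True by (auto simp: steps_word_def list_eq_iff_nth_eq)
      moreover have "{\<omega> \<in> space M. X (Suc i) \<omega> = w ! i} \<in> events" for i
        using measurable_sets[OF measurable_step[of "Suc i"], of "{w ! i}"]
        by (simp add: vimage_def Int_def conj_commute)
      ultimately show ?thesis by (simp only:) (intro sets.sets_Collect_finite_All, auto)
    next
      case False
      then have "{\<omega> \<in> space M. steps_word (\<lambda>k. X k \<omega>) n = w} = {}" by auto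
      then show ?thesis by (simp only: sets.empty_sets)
    qed
    have "(\<lambda>\<omega>. steps_word (\<lambda>k. X k \<omega>) n) -` A \<inter> space M = (\<Union>w\<in>A. {\<omega> \<in> space M. steps_word (\<lambda>k. X k \<omega>) n = w})"
      by auto
    also have "\<dots> \<in> events" using one by (intro sets.countable_UN') auto
    finally show "(\<lambda>\<omega>. steps_word (\<lambda>k. X k \<omega>) n) -` A \<inter> space M \<in> events" .
  qed simp
  show ?thesis
    using measurable_sets[OF meas, of "Collect Q"] by (simp add: vimage_def Int_def conj_commute)
qed

text \<open>Carries every word estimate over to the given walk and, through
  \<open>simple_random_walk_product\<close>, to the path-space law behind \<open>p\<close>.\<close>

lemma prob_word: "prob {\<omega> \<in> space M. Q (steps_word (\<lambda>k. X k \<omega>) n)} = word_prob n Q"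
proof -
  let ?W = "{w :: (int ^ 'd) list. set w \<subseteq> unit_steps \<and> length w = n}"
  have fin: "finite ?W" by (simp add: finite_lists_length_eq)
  then have fin': "finite {w \<in> ?W. Q w}" by (rule rev_finite_subset) auto
  have "prob {\<omega> \<in> space M. Q (steps_word (\<lambda>k. X k \<omega>) n)} =
      prob (\<Union>w\<in>{w \<in> ?W. Q w}. {\<omega> \<in> space M. steps_word (\<lambda>k. X k \<omega>) n = w})"
  proof (rule finite_measure_eq_AE)
    show "AE \<omega> in M. \<omega> \<in> {\<omega> \<in> space M. Q (steps_word (\<lambda>k. X k \<omega>) n)} \<longleftrightarrow>
        \<omega> \<in> (\<Union>w\<in>{w \<in> ?W. Q w}. {\<omega> \<in> space M. steps_word (\<lambda>k. X k \<omega>) n = w})"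
      using AE_unit_steps by eventually_elim (auto simp: steps_word_def)
  qed (use word_event fin' in auto)
  also have "\<dots> = (\<Sum>w\<in>{w \<in> ?W. Q w}. prob {\<omega> \<in> space M. steps_word (\<lambda>k. X k \<omega>) n = w})"
    using fin' word_event by (intro finite_measure_finite_Union) (auto simp: disjoint_family_on_def)
  also have "\<dots> = (\<Sum>w\<in>{w \<in> ?W. Q w}. (1 / (2 * real CARD('d))) ^ n)"
    using prob_cylinder by (intro sum.cong) auto
  also have "\<dots> = word_prob n Q"
    unfolding word_mean_eq_sum using fin by (intro sum.mono_neutral_cong_left) auto
  finally show ?thesis .
qed

lemma prob_direct_LIMSEQ:
  "prob {\<omega> \<in> space M. \<exists>R. direct u (steps_word (\<lambda>k. X k \<omega>) R)} = direct_lim u"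
proof -
  let ?A = "\<lambda>R. {\<omega> \<in> space M. direct u (steps_word (\<lambda>k. X k \<omega>) R)}"
  have "incseq ?A"
  proof (rule incseq_SucI, clarify)
    fix R \<omega> assume "direct u (steps_word (\<lambda>k. X k \<omega>) R)"
    then show "direct u (steps_word (\<lambda>k. X k \<omega>) (Suc R))"
      using direct_take[of u R "steps_word (\<lambda>k. X k \<omega>) (Suc R)"] by (simp add: take_steps_word)
  qed
  then have "(\<lambda>R. prob (?A R)) \<longlonglongrightarrow> prob (\<Union>R. ?A R)"
    using word_event by (intro finite_Lim_measure_incseq) auto
  moreover have "(\<Union>R. ?A R) = {\<omega> \<in> space M. \<exists>R. direct u (steps_word (\<lambda>k. X k \<omega>) R)}" by auto
  ultimately have "(\<lambda>R. direct_prob R u) \<longlonglongrightarrow> prob {\<omega> \<in> space M. \<exists>R. direct u (steps_word (\<lambda>k. X k \<omega>) R)}"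
    by (simp add: prob_word)
  then show ?thesis using LIMSEQ_unique direct_prob_LIMSEQ by blast
qed

end

section \<open>Hitting times and identification of the return probability\<close>

lemma enat_less_hitting_time: "enat i < hitting_time A s \<longleftrightarrow> (\<forall>j. 1 \<le> j \<and> s j \<in> A \<longrightarrow> i < j)"
proof
  assume *: "enat i < hitting_time A s"
  then show "\<forall>j. 1 \<le> j \<and> s j \<in> A \<longrightarrow> i < j"
    unfolding hitting_time_def by (auto dest: less_INF_D)
next
  assume *: "\<forall>j. 1 \<le> j \<and> s j \<in> A \<longrightarrow> i < j"
  have "enat (Suc i) \<le> hitting_time A s"
    unfolding hitting_time_def using * by (intro INF_greatest) (auto simp: Suc_le_eq)
  then show "enat i < hitting_time A s" by (meson enat_ord_simps(2) lessI less_le_trans)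
qed

lemma hitting_time_less_iff:
  "hitting_time A s < hitting_time B s \<longleftrightarrow>
    (\<exists>i\<ge>1. s i \<in> A \<and> (\<forall>j. 1 \<le> j \<and> j \<le> i \<longrightarrow> s j \<notin> B))"
proof -
  have "hitting_time A s < hitting_time B s \<longleftrightarrow> (\<exists>i\<ge>1. s i \<in> A \<and> enat i < hitting_time B s)"
    unfolding hitting_time_def[of A] INF_less_iff by auto
  then show ?thesis
    unfolding enat_less_hitting_time by (metis not_less)
qed

lemma simple_random_walk_product:
  "simple_random_walk (\<Pi>\<^sub>M k\<in>{1..}. measure_pmf (pmf_of_set (unit_steps :: (int ^ 'd) set))) (\<lambda>k x. x k)"
proof -
  let ?p = "measure_pmf (pmf_of_set (unit_steps :: (int ^ 'd) set))"
  let ?M = "\<Pi>\<^sub>M k\<in>{1 :: nat..}. ?p"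
  interpret P: product_prob_space "\<lambda>_. ?p" "{1 :: nat..}"
    by unfold_locales
  have ne: "(unit_steps :: (int ^ 'd) set) \<noteq> {}" using axis_in_unit_steps by blast
  have comp: "(\<lambda>x. x k) \<in> measurable ?M ?p" if "k \<ge> 1" for k
    using that by (intro measurable_component_singleton) auto
  then have comp': "(\<lambda>x. x k) \<in> measurable ?M (count_space UNIV)" if "k \<ge> 1" for k
    using that by (simp cong: measurable_cong_sets)
  have distr: "distr ?M (count_space UNIV) (\<lambda>x. x k) = ?p" if "k \<ge> 1" for k
  proof -
    have "distr ?M (count_space UNIV) (\<lambda>x. x k) = distr ?M ?p (\<lambda>x. x k)"
      by (intro distr_cong) auto
    also have "\<dots> = ?p" using that by (intro P.PiM_component) auto
    finally show ?thesis .
  qed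
  show ?thesis
  proof
    show "P.indep_vars (\<lambda>_. count_space UNIV) (\<lambda>k x. x k) {1..}"
    proof (subst P.indep_vars_iff_distr_eq_PiM')
      have sets: "sets (\<Pi>\<^sub>M k\<in>{1 :: nat..}. count_space (UNIV :: (int ^ 'd) set)) = sets ?M"
        by (intro sets_PiM_cong) auto
      have "distr ?M (\<Pi>\<^sub>M k\<in>{1 :: nat..}. count_space UNIV) (\<lambda>x. \<lambda>k\<in>{1..}. x k) = distr ?M ?M (\<lambda>x. x)"
        by (intro distr_cong sets refl) (auto simp: space_PiM PiE_def extensional_restrict)
      also have "\<dots> = ?M" by (rule distr_id)
      also have "\<dots> = (\<Pi>\<^sub>M k\<in>{1..}. distr ?M (count_space UNIV) (\<lambda>x. x k))"
        by (intro PiM_cong refl) (rule distr[symmetric], simp)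
      finally show "distr ?M (\<Pi>\<^sub>M k\<in>{1..}. count_space UNIV) (\<lambda>x. \<lambda>k\<in>{1..}. x k) =
          (\<Pi>\<^sub>M k\<in>{1..}. distr ?M (count_space UNIV) (\<lambda>x. x k))" .
    qed (use comp' in auto)
    fix k :: nat and e :: "int ^ 'd" assume k: "k \<ge> 1" and e: "e \<in> unit_steps"
    have "measure ?M {x \<in> space ?M. x k = e} = measure (distr ?M (count_space UNIV) (\<lambda>x. x k)) {e}"
      using comp'[OF k] by (subst measure_distr) (auto simp: vimage_def Int_def conj_commute)
    also have "\<dots> = 1 / (2 * real CARD('d))"
      unfolding distr[OF k] using e ne by (simp add: measure_pmf_single card_unit_steps)
    finally show "measure ?M {x \<in> space ?M. x k = e} = 1 / (2 * real CARD('d))" .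
  qed
qed

lemma sphere_before_origin_prob_eq:
  fixes u :: "int ^ 'd"
  shows "sphere_before_origin_prob u = direct_lim u"
proof -
  let ?M = "\<Pi>\<^sub>M k\<in>{1 :: nat..}. measure_pmf (pmf_of_set (unit_steps :: (int ^ 'd) set))"
  let ?N = "\<Pi>\<^sub>M n\<in>(UNIV :: nat set). count_space (UNIV :: (int ^ 'd) set)"
  interpret W: simple_random_walk ?M "\<lambda>k x. x k"
    by (rule simple_random_walk_product)
  have event: "{s \<in> space ?N. hitting_time unit_sphere s < hitting_time {0} s} \<in> sets ?N"
  proof -
    have [measurable]: "(\<lambda>s. s i) \<in> measurable ?N (count_space UNIV)" for i
      by (intro measurable_component_singleton) auto
    show ?thesis
      unfolding hitting_time_less_iff by measurable
  qed
  have meas: "walk u \<in> measurable ?M ?N"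
  proof (rule measurable_PiM_single')
    fix i :: nat
    have "walk u x i = u + sum_list (steps_word x i)" for x by (rule walk_eq)
    then have "(\<lambda>x. walk u x i) -` A \<inter> space ?M = {x \<in> space ?M. u + sum_list (steps_word (\<lambda>k. x k) i) \<in> A}" for A
      by auto
    then show "(\<lambda>x. walk u x i) \<in> measurable ?M (count_space UNIV)"
      using W.word_event[of "\<lambda>w. u + sum_list w \<in> _" i] by (intro measurableI) auto
  qed (auto simp: space_PiM)
  have iff: "hitting_time unit_sphere (walk u x) < hitting_time {0} (walk u x) \<longleftrightarrow> (\<exists>R. direct u (steps_word x R))" for x
  proof -
    have "direct u (steps_word x R) \<longleftrightarrow>
        (\<exists>i. 0 < i \<and> i \<le> R \<and> walk u x i \<in> unit_steps \<and> (\<forall>i'. 0 < i' \<and> i' \<le> i \<longrightarrow> walk u x i' \<noteq> 0))" for R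
      unfolding direct_iff by (auto simp: walk_eq take_steps_word)
    then show ?thesis
      unfolding hitting_time_less_iff unit_sphere_eq_unit_steps by (auto simp: Suc_le_eq)
  qed
  have "sphere_before_origin_prob u = measure ?M (walk u -` {s \<in> space ?N. hitting_time unit_sphere s < hitting_time {0} s} \<inter> space ?M)"
    unfolding sphere_before_origin_prob_def walk_law_def space_distr
    by (rule measure_distr[OF meas event])
  also have "walk u -` {s \<in> space ?N. hitting_time unit_sphere s < hitting_time {0} s} \<inter> space ?M =
      {x \<in> space ?M. \<exists>R. direct u (steps_word (\<lambda>k. x k) R)}"
    using measurable_space[OF meas] by (auto simp: iff)
  finally show ?thesis using W.prob_direct_LIMSEQ[of u] by simp
qed

text \<open>Fixes the parameters at the dyadic level n = 2^i. The constant and the threshold for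
  \<open>i\<close> do not depend on the pair, so a union over pairs can follow.\<close>

lemma lower_bound_decay:
  fixes u :: "int ^ 'd" and \<delta> :: real
  assumes d: "CARD('d) \<ge> 4" and u: "u \<in> unit_steps" and \<delta>: "0 < \<delta>" "\<delta> \<le> 1"
  defines "p \<equiv> direct_lim u"
  shows "\<exists>C. \<forall>\<^sub>F i in sequentially. \<forall>k l. k \<le> l \<and> rate CARD('d) p (real k) (real l) \<le> (1 - \<delta>) * (real i * ln 2) \<longrightarrow>
    word_prob (2 ^ Suc i) (\<lambda>w. \<not> (\<forall>n. 2 ^ i \<le> n \<and> n \<le> 2 ^ Suc i \<longrightarrow>
      (\<exists>z :: int ^ 'd. visits {0} (- z) (take n w) = k \<and> visits unit_steps (- z) (take n w) = Suc l)))
    \<le> C * 2 powr (- (\<delta> / 8 * real i))"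
proof -
  define a where "a = 1 / (2 * real CARD('d))"
  define \<eta> where "\<eta> = \<delta> / 8"
  have \<eta>: "0 < \<eta>" "\<delta> = 8 * \<eta>" using \<delta> by (simp_all add: \<eta>_def)
  obtain \<gamma> where \<gamma>: "0 < \<gamma>" "\<gamma> \<le> 1"
    "\<And>n u. u \<in> unit_steps \<Longrightarrow> \<gamma> \<le> word_prob n (\<lambda>l :: (int ^ 'd) list. visits unit_ball u l = 0)"
    using escape_probability[OF d] by metis
  have a: "0 < a" by (simp add: a_def)
  have p: "0 < p" unfolding p_def by (rule direct_lim_pos[OF u])
  have q: "a + p < 1"
    using direct_lim_le_escape[OF u \<gamma>(3)[OF u]] \<gamma>(1) by (simp add: a_def p_def)
  define B where "B = ln 2 / ln (1 / (a + p))"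
  have lnq: "0 < ln (1 / (a + p))" using q a p by simp
  then have B: "0 < B" by (simp add: B_def)
  \<comment> \<open>Chosen so that \<open>exp (- (\<eta>' * (B * real i)))\<close> is 1/x below:
    replacing \<open>p\<close> by \<open>direct_prob T u\<close> in at most \<open>B * i\<close>
    excursions then costs at most a factor \<open>x\<close>.\<close>
  define \<eta>' where "\<eta>' = \<eta> * ln 2 / B"
  have \<eta>': "0 < \<eta>'" using \<eta> B by (simp add: \<eta>'_def)
  have "p * exp (- \<eta>') < p" using p \<eta>' by simp
  then have "\<forall>\<^sub>F T in sequentially. p * exp (- \<eta>') < direct_prob T u"
    using direct_prob_LIMSEQ[of u] unfolding p_def by (rule order_tendstoD[rotated])
  then obtain T where T: "p * exp (- \<eta>') < direct_prob T u"
    using eventually_happens'[OF sequentially_bot] by blast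
  define pT where "pT = direct_prob T u"
  define g where "g = green_const CARD('d)"
  have g: "0 \<le> g" by (simp add: g_def green_const_nonneg)
  have ev1: "\<forall>\<^sub>F i :: nat in sequentially. (real T + 2) * (B * real i) \<le> 2 powr (4 * (\<eta> * real i))"
    using B \<eta> by real_asymp
  have ev2: "\<forall>\<^sub>F i :: nat in sequentially. 12 * (B * real i + 1) \<le> 2 powr (2 * (\<eta> * real i))"
    using B \<eta> by real_asymp
  have "\<forall>\<^sub>F i in sequentially. \<forall>k l. k \<le> l \<and> rate CARD('d) p (real k) (real l) \<le> (1 - \<delta>) * (real i * ln 2) \<longrightarrow>
    word_prob (2 ^ Suc i) (\<lambda>w. \<not> (\<forall>n. 2 ^ i \<le> n \<and> n \<le> 2 ^ Suc i \<longrightarrow>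
      (\<exists>z :: int ^ 'd. visits {0} (- z) (take n w) = k \<and> visits unit_steps (- z) (take n w) = Suc l)))
    \<le> (1 / \<gamma>\<^sup>2 + 4 * g) * 2 powr (- (\<delta> / 8 * real i))"
    using ev1 ev2
  proof (eventually_elim, intro allI impI, elim conjE)
    fix i k l :: nat
    assume e1: "(real T + 2) * (B * real i) \<le> 2 powr (4 * (\<eta> * real i))"
      and e2: "12 * (B * real i + 1) \<le> 2 powr (2 * (\<eta> * real i))"
      and kl: "k \<le> l" and rate: "rate CARD('d) p (real k) (real l) \<le> (1 - \<delta>) * (real i * ln 2)"
    \<comment> \<open>In terms of n = 2^i these are n^\<eta> and n^(1 - \<delta>), and x^8 y = n is
      the available time. Four powers of \<open>x\<close> go into the block length and two into the
      number of blocks; the last two absorb 12 (B i + 1).\<close>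
    define x where "x = 2 powr (\<eta> * real i)"
    define y where "y = 2 powr ((1 - \<delta>) * real i)"
    have x1: "1 \<le> x" unfolding x_def using \<eta> by (simp add: ge_one_powr_ge_zero)
    have y1: "1 \<le> y" unfolding y_def using \<delta> by (simp add: ge_one_powr_ge_zero)
    have x0: "0 < x" and y0: "0 < y" using x1 y1 by simp_all
    have xn: "x ^ n = 2 powr (real n * (\<eta> * real i))" for n
      by (simp add: x_def powr_realpow[symmetric] powr_powr mult_ac)
    have N: "x ^ 8 * y = 2 ^ i"
      unfolding xn y_def powr_add[symmetric] \<eta>(2) by (simp add: algebra_simps powr_realpow)
    have e1': "(real T + 2) * (B * real i) \<le> x ^ 4" using e1 by (simp add: xn)
    have e2': "12 * (B * real i + 1) \<le> x ^ 2" using e2 by (simp add: xn)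
    have lB: "real l \<le> B * real i"
    proof -
      have "real l * ln (1 / (a + p)) \<le> rate CARD('d) p (real k) (real l)"
        unfolding a_def using rate_ge_linear[OF _ p kl] by simp
      also have "\<dots> \<le> real i * ln 2"
        using rate \<delta> mult_right_mono[of "1 - \<delta>" 1 "real i * ln 2"] by simp
      finally show ?thesis using lnq by (simp add: B_def field_simps)
    qed
    define w where "w = excursion_weight a p k l"
    define wT where "wT = excursion_weight a pT k l"
    have w: "0 < w" using a p kl by (simp add: w_def excursion_weight_def)
    have w1: "w \<le> 1"
      using excursion_weight_le_power[of a p k l] a p q power_le_one[of "a + p" l] by (simp add: w_def)
    have inv_w: "1 / w \<le> (B * real i + 1) * y"
    proof -
      have "y = exp ((1 - \<delta>) * (real i * ln 2))"
        by (simp add: y_def powr_def mult_ac)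
      then have "1 / y = exp (- ((1 - \<delta>) * (real i * ln 2)))"
        by (simp only: exp_minus inverse_eq_divide)
      also have "\<dots> \<le> exp (- rate CARD('d) p (real k) (real l))" using rate by simp
      also have "\<dots> \<le> (real l + 1) * w"
        unfolding w_def a_def using excursion_weight_ge_exp_rate[OF _ p kl] by simp
      also have "\<dots> \<le> (B * real i + 1) * w" using lB w by (intro mult_right_mono) auto
      finally show ?thesis using w y0 by (simp add: field_simps)
    qed
    have pT: "0 \<le> pT" "exp (- \<eta>') \<le> pT / p" "pT \<le> p"
      using T p direct_prob_le_lim[of T u] by (simp_all add: pT_def word_prob_nonneg field_simps p_def)
    have wT: "w / x \<le> wT"
    proof -
      have "1 / x = exp (- (\<eta>' * (B * real i)))"
        using B by (simp add: x_def \<eta>'_def powr_def exp_minus field_simps)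
      also have "\<dots> \<le> exp (- (\<eta>' * real l))" using lB \<eta>' by (simp add: mult_left_mono)
      also have "\<dots> = exp (- \<eta>') ^ l" by (simp add: exp_of_nat_mult[symmetric] mult.commute)
      also have "\<dots> \<le> exp (- \<eta>') ^ (l - k)" using \<eta>' by (intro power_decreasing) auto
      also have "\<dots> \<le> (pT / p) ^ (l - k)" using pT by (intro power_mono) auto
      finally have "w * (1 / x) \<le> w * (pT / p) ^ (l - k)" using w by (intro mult_left_mono) auto
      also have "\<dots> = wT" using p by (simp add: w_def wT_def excursion_weight_def power_divide)
      finally show ?thesis by simp
    qed
    have wT1: "0 < wT" "wT \<le> 1"
    proof -
      show "0 < wT" using wT w x0 by (meson divide_pos_pos less_le_trans)
      have "wT \<le> (a + pT) ^ l"
        using excursion_weight_le_power[of a pT k l] a pT by (simp add: wT_def)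
      also have "\<dots> \<le> 1" using a pT q by (intro power_le_one) auto
      finally show "wT \<le> 1" .
    qed
    define L where "L = nat \<lceil>x ^ 4\<rceil>"
    have L: "x ^ 4 \<le> real L" "real L \<le> 2 * x ^ 4"
    proof -
      show "x ^ 4 \<le> real L" unfolding L_def by linarith
      have "real L \<le> x ^ 4 + 1" unfolding L_def using x0 by (simp add: of_nat_ceiling) 
      also have "\<dots> \<le> 2 * x ^ 4" using x1 by simp
      finally show "real L \<le> 2 * x ^ 4" .
    qed
    have L0: "0 < L" using L(1) x0 by (metis gr_zeroI not_le of_nat_0 zero_less_power)
    have TL: "(T + 2) * l \<le> L"
    proof -
      have "real ((T + 2) * l) = (real T + 2) * real l" by (simp add: algebra_simps)
      also have "\<dots> \<le> (real T + 2) * (B * real i)" by (intro mult_left_mono lB) simp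
      finally have "real ((T + 2) * l) \<le> (real T + 2) * (B * real i)" .
      then have "real ((T + 2) * l) \<le> real L" using e1' L(1) by linarith
      then show ?thesis by (simp only: of_nat_le_iff)
    qed
    \<comment> \<open>A block is good with probability at least \<gamma>^2 w / x. One power of
      \<open>x\<close> makes up for this loss and the other makes the expected number of good blocks
      at least \<gamma>^2 x.\<close>
    define K where "K = nat \<lceil>x ^ 2 / w\<rceil>"
    have K: "x ^ 2 / w \<le> real K" "real K \<le> x ^ 2 / w + 1"
    proof -
      show "x ^ 2 / w \<le> real K" unfolding K_def by linarith
      show "real K \<le> x ^ 2 / w + 1" unfolding K_def using w by (simp add: of_nat_ceiling)
    qed
    have KL: "K * (3 * L) \<le> 2 ^ i"
    proof -
      have "real K \<le> x ^ 2 * (1 / w) + 1" using K(2) by simp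
      also have "\<dots> \<le> x ^ 2 * ((B * real i + 1) * y) + x ^ 2 * ((B * real i + 1) * y)"
      proof (intro add_mono mult_left_mono inv_w)
        have "1 * (1 * 1) \<le> x ^ 2 * ((B * real i + 1) * y)"
          using x1 y1 B by (intro mult_mono) auto
        then show "1 \<le> x ^ 2 * ((B * real i + 1) * y)" by simp
      qed simp
      finally have Kbound: "real K \<le> 2 * (x ^ 2 * ((B * real i + 1) * y))" by (simp only: mult_2)
      have "real K * (3 * real L) \<le> (2 * (x ^ 2 * ((B * real i + 1) * y))) * (3 * (2 * x ^ 4))"
        by (rule mult_mono[OF Kbound]) (use L(2) B y0 in auto)
      also have "\<dots> = (12 * (B * real i + 1)) * (x ^ 6 * y)"
        by (simp add: algebra_simps flip: power_add)
      also have "\<dots> \<le> x ^ 2 * (x ^ 6 * y)"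
        using e2' x0 y0 by (intro mult_right_mono) auto
      also have "\<dots> = 2 ^ i" unfolding N[symmetric] by (simp add: mult.assoc[symmetric] flip: power_add)
      finally have "real (K * (3 * L)) \<le> real (2 ^ i)" by simp
      then show ?thesis by (simp only: of_nat_le_iff)
    qed
    have miss: "(1 - \<gamma> * (\<gamma> * wT)) ^ K \<le> 1 / (\<gamma>\<^sup>2 * x)"
    proof -
      define t where "t = \<gamma> * (\<gamma> * wT)"
      have t: "0 < t" "t \<le> 1" using \<gamma> wT1 by (auto simp: t_def intro!: mult_le_one)
      have Kt: "\<gamma>\<^sup>2 * x \<le> real K * t"
      proof -
        have "\<gamma>\<^sup>2 * x = (x ^ 2 / w) * (\<gamma>\<^sup>2 * (w / x))"
          using w x0 by (simp add: field_simps power2_eq_square)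
        also have "\<dots> \<le> real K * (\<gamma>\<^sup>2 * wT)"
          using K(1) wT w x0 by (intro mult_mono mult_left_mono) auto
        finally show ?thesis by (simp add: t_def power2_eq_square mult.assoc)
      qed
      have "(1 - t) ^ K \<le> exp (- t) ^ K"
        using t exp_ge_add_one_self[of "- t"] by (intro power_mono) auto
      also have "\<dots> = exp (- (real K * t))" by (simp add: exp_of_nat_mult[symmetric])
      also have "\<dots> \<le> exp (- (\<gamma>\<^sup>2 * x))" using Kt by simp
      also have "\<dots> \<le> 1 / (\<gamma>\<^sup>2 * x)"
      proof -
        have "0 < \<gamma>\<^sup>2 * x" using \<gamma> x0 by simp
        moreover have "\<gamma>\<^sup>2 * x \<le> exp (\<gamma>\<^sup>2 * x)" using exp_ge_add_one_self[of "\<gamma>\<^sup>2 * x"] by linarith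
        ultimately show ?thesis by (simp add: exp_minus field_simps)
      qed
      finally show ?thesis by (simp add: t_def)
    qed
    \<comment> \<open>The weight cancels against the number of blocks, which leaves x^2 over the
      length x^4.\<close>
    have revisit: "2 * real K * (w * (g / (real L + 1))) \<le> 4 * g / x"
    proof -
      have "real K * w \<le> x ^ 2 + w" using K(2) w by (simp add: field_simps)
      then have Kw: "real K * w \<le> 2 * x ^ 2" using w1 x1 by (smt (verit) one_le_power)
      have gL: "g / (real L + 1) \<le> g / x ^ 4"
        using L(1) g x0 by (intro divide_left_mono) auto
      have "2 * real K * (w * (g / (real L + 1))) = 2 * ((real K * w) * (g / (real L + 1)))" by simp
      also have "\<dots> \<le> 2 * ((2 * x ^ 2) * (g / x ^ 4))"
        by (intro mult_left_mono mult_mono[OF Kw gL]) (use g x0 w in auto)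
      also have "\<dots> = 4 * g / x ^ 2" using x0 by (simp add: field_simps power_numeral_reduce)
      also have "\<dots> \<le> 4 * g / x"
        using g x1 x0 self_le_power[of x 2] by (intro divide_left_mono) auto
      finally show ?thesis .
    qed
    have "word_prob (2 ^ Suc i) (\<lambda>w. \<not> (\<forall>n. 2 ^ i \<le> n \<and> n \<le> 2 ^ Suc i \<longrightarrow>
      (\<exists>z :: int ^ 'd. visits {0} (- z) (take n w) = k \<and> visits unit_steps (- z) (take n w) = Suc l)))
      \<le> (1 - \<gamma> * (\<gamma> * wT)) ^ K + 2 * real K * (w * (g / (real L + 1)))"
      unfolding w_def wT_def pT_def a_def p_def g_def
      by (rule lower_bound_prob[OF u L0 d less_imp_le[OF \<gamma>(1)] \<gamma>(3) TL KL]) (auto intro: power_increasing)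
    also have "\<dots> \<le> 1 / (\<gamma>\<^sup>2 * x) + 4 * g / x" using miss revisit by linarith
    also have "\<dots> = (1 / \<gamma>\<^sup>2 + 4 * g) * (1 / x)" using x0 \<gamma> by (simp add: field_simps)
    also have "1 / x = 2 powr (- (\<delta> / 8 * real i))"
      unfolding x_def \<eta>_def by (simp add: powr_minus_divide)
    finally show "word_prob (2 ^ Suc i) (\<lambda>w. \<not> (\<forall>n. 2 ^ i \<le> n \<and> n \<le> 2 ^ Suc i \<longrightarrow>
      (\<exists>z :: int ^ 'd. visits {0} (- z) (take n w) = k \<and> visits unit_steps (- z) (take n w) = Suc l)))
    \<le> (1 / \<gamma>\<^sup>2 + 4 * g) * 2 powr (- (\<delta> / 8 * real i))" .
  qed
  then show ?thesis by blast
qed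

section \<open>Almost sure statements\<close>

text \<open>A visit to the origin that does not end the path is followed by one to the sphere. This
  serves the centres within distance 1 of the start, where \<open>visits_origin_le\<close> may be
  off by one; the term for \<open>x = 0\<close> carries the induction.\<close>

lemma visits_origin_le_away:
  assumes "set w \<subseteq> unit_steps" "x + sum_list w \<noteq> 0"
  shows "visits {0} x w + of_bool (x = 0) \<le> visits unit_steps x w"
  using assms
proof (induction w arbitrary: x)
  case (Cons e w)
  then have "visits {0} (x + e) w + of_bool (x + e = 0) \<le> visits unit_steps (x + e) w"
    by (auto simp: add.assoc)
  moreover have "x = 0 \<longrightarrow> x + e \<in> unit_steps" using Cons.prems by auto
  ultimately show ?case by (auto split: if_splits)
qed simp

lemma rate_lower_set:
  assumes d: "0 < d" and p: "0 < p" and q: "1 / (2 * real d) + p < 1" and c: "0 \<le> c"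
    and kl: "k \<le> l" "rate d p (real k) (real l) \<le> c"
  shows "real l \<le> c / ln (1 / (1 / (2 * real d) + p))"
proof -
  have "0 < 1 / (2 * real d) + p" using d p by (simp add: add_pos_pos)
  then have "0 < ln (1 / (1 / (2 * real d) + p))" using q by simp
  then show ?thesis
    using rate_ge_linear[OF d p kl(1)] kl(2) by (simp add: field_simps)
qed

text \<open>Since \<open>l\<close> is at most \<open>B * i\<close>, there are at most (B i + 1)^2
  pairs, which the exponential decay in \<open>i\<close> absorbs.\<close>

lemma lower_bound_summable:
  fixes u :: "int ^ 'd" and \<delta> :: real
  assumes d: "CARD('d) \<ge> 4" and u: "u \<in> unit_steps" and \<delta>: "0 < \<delta>" "\<delta> \<le> 1"
  defines "p \<equiv> direct_lim u"
  shows "summable (\<lambda>i. word_prob (2 ^ Suc i) (\<lambda>w. \<not> (\<forall>k l. k \<le> l \<and>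
      rate CARD('d) p (real k) (real l) \<le> (1 - \<delta>) * (real i * ln 2) \<longrightarrow>
      (\<forall>n. 2 ^ i \<le> n \<and> n \<le> 2 ^ Suc i \<longrightarrow>
      (\<exists>z :: int ^ 'd. visits {0} (- z) (take n w) = k \<and> visits unit_steps (- z) (take n w) = Suc l)))))"
proof -
  define F where "F i k l w \<longleftrightarrow> \<not> (\<forall>n. 2 ^ i \<le> n \<and> n \<le> 2 ^ Suc i \<longrightarrow>
      (\<exists>z :: int ^ 'd. visits {0} (- z) (take n w) = k \<and> visits unit_steps (- z) (take n w) = Suc l))" for i k l w
  define A where "A i = {(k, l). k \<le> l \<and> rate CARD('d) p (real k) (real l) \<le> (1 - \<delta>) * (real i * ln 2)}" for i :: nat
  obtain \<gamma> where \<gamma>: "0 < \<gamma>" "\<gamma> \<le> 1"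
    "\<And>n u. u \<in> unit_steps \<Longrightarrow> \<gamma> \<le> word_prob n (\<lambda>l :: (int ^ 'd) list. visits unit_ball u l = 0)"
    using escape_probability[OF d] by metis
  have p: "0 < p" unfolding p_def by (rule direct_lim_pos[OF u])
  have q: "1 / (2 * real CARD('d)) + p < 1"
    using direct_lim_le_escape[OF u \<gamma>(3)[OF u]] \<gamma>(1) by (simp add: p_def)
  define B where "B = ln 2 / ln (1 / (1 / (2 * real CARD('d)) + p))"
  have "0 < 1 / (2 * real CARD('d)) + p" using p by (simp add: add_pos_pos)
  then have B: "0 < B" unfolding B_def using q by simp
  define \<eta> where "\<eta> = \<delta> / 8"
  have \<eta>: "0 < \<eta>" using \<delta> by (simp add: \<eta>_def)
  have A_sub: "A i \<subseteq> {..nat \<lfloor>B * real i\<rfloor>} \<times> {..nat \<lfloor>B * real i\<rfloor>}" for i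
  proof clarify
    fix k l assume "(k, l) \<in> A i"
    then have kl: "k \<le> l" "rate CARD('d) p (real k) (real l) \<le> (1 - \<delta>) * (real i * ln 2)" by (auto simp: A_def)
    have "(1 - \<delta>) * (real i * ln 2) \<le> 1 * (real i * ln 2)"
      using \<delta> by (intro mult_right_mono) auto
    then have "real l \<le> real i * ln 2 / ln (1 / (1 / (2 * real CARD('d)) + p))"
      using kl q p by (intro rate_lower_set) auto
    then have "real l \<le> B * real i" by (simp add: B_def mult.commute)
    then have "l \<le> nat \<lfloor>B * real i\<rfloor>" by (simp add: le_nat_floor)
    then show "k \<in> {..nat \<lfloor>B * real i\<rfloor>} \<and> l \<in> {..nat \<lfloor>B * real i\<rfloor>}" using kl by simp
  qed
  have finA: "finite (A i)" for i by (rule finite_subset[OF A_sub]) simp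
  have cardA: "real (card (A i)) \<le> (B * real i + 1)\<^sup>2" for i
  proof -
    have "card (A i) \<le> card ({..nat \<lfloor>B * real i\<rfloor>} \<times> {..nat \<lfloor>B * real i\<rfloor>})"
      by (rule card_mono[OF _ A_sub]) simp
    then have "card (A i) \<le> (nat \<lfloor>B * real i\<rfloor> + 1)\<^sup>2"
      by (simp add: card_cartesian_product power2_eq_square)
    then have "real (card (A i)) \<le> real ((nat \<lfloor>B * real i\<rfloor> + 1)\<^sup>2)" by (simp only: of_nat_le_iff)
    also have "\<dots> = (real (nat \<lfloor>B * real i\<rfloor>) + 1)\<^sup>2" by simp
    also have "\<dots> \<le> (B * real i + 1)\<^sup>2"
      using B by (intro power_mono add_mono of_nat_floor) auto
    finally show ?thesis .
  qed
  obtain C where C: "\<forall>\<^sub>F i in sequentially. \<forall>k l. k \<le> l \<and> rate CARD('d) p (real k) (real l) \<le> (1 - \<delta>) * (real i * ln 2) \<longrightarrow>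
    word_prob (2 ^ Suc i) (F i k l) \<le> C * 2 powr (- (\<eta> * real i))"
    using lower_bound_decay[OF d u \<delta>] unfolding F_def p_def \<eta>_def by blast
  have "\<forall>\<^sub>F i in sequentially. norm (word_prob (2 ^ Suc i) (\<lambda>w. \<exists>kl\<in>A i. F i (fst kl) (snd kl) w))
      \<le> (B * real i + 1)\<^sup>2 * (\<bar>C\<bar> * 2 powr (- (\<eta> * real i)))"
    using C
  proof eventually_elim
    case (elim i)
    have "word_prob (2 ^ Suc i) (\<lambda>w. \<exists>kl\<in>A i. F i (fst kl) (snd kl) w) \<le>
        (\<Sum>kl\<in>A i. word_prob (2 ^ Suc i) (F i (fst kl) (snd kl)))"
      by (rule word_prob_union[OF finA])
    also have "\<dots> \<le> (\<Sum>kl\<in>A i. \<bar>C\<bar> * 2 powr (- (\<eta> * real i)))"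
    proof (rule sum_mono)
      fix kl assume "kl \<in> A i"
      then have "word_prob (2 ^ Suc i) (F i (fst kl) (snd kl)) \<le> C * 2 powr (- (\<eta> * real i))"
        using elim by (auto simp: A_def)
      also have "\<dots> \<le> \<bar>C\<bar> * 2 powr (- (\<eta> * real i))" by (intro mult_right_mono) auto
      finally show "word_prob (2 ^ Suc i) (F i (fst kl) (snd kl)) \<le> \<bar>C\<bar> * 2 powr (- (\<eta> * real i))" .
    qed
    also have "\<dots> = real (card (A i)) * (\<bar>C\<bar> * 2 powr (- (\<eta> * real i)))" by simp
    also have "\<dots> \<le> (B * real i + 1)\<^sup>2 * (\<bar>C\<bar> * 2 powr (- (\<eta> * real i)))"
      by (intro mult_right_mono cardA) auto
    finally show ?case by (simp add: word_prob_nonneg)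
  qed
  moreover have "summable (\<lambda>i. (B * real i + 1)\<^sup>2 * (\<bar>C\<bar> * 2 powr (- (\<eta> * real i))))"
  proof (rule summable_comparison_test_ev)
    have "\<forall>\<^sub>F i :: nat in sequentially. (B * real i + 1)\<^sup>2 * 2 powr (- (\<eta> * real i)) \<le> 2 powr (- (\<eta> / 2 * real i))"
      using B \<eta> by real_asymp
    then show "\<forall>\<^sub>F i in sequentially. norm ((B * real i + 1)\<^sup>2 * (\<bar>C\<bar> * 2 powr (- (\<eta> * real i))))
        \<le> \<bar>C\<bar> * (2 powr (- (\<eta> / 2))) ^ i"
    proof eventually_elim
      case (elim i)
      have "norm ((B * real i + 1)\<^sup>2 * (\<bar>C\<bar> * 2 powr (- (\<eta> * real i)))) =
          \<bar>C\<bar> * ((B * real i + 1)\<^sup>2 * 2 powr (- (\<eta> * real i)))"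
        by (simp add: abs_mult)
      also have "\<dots> \<le> \<bar>C\<bar> * 2 powr (- (\<eta> / 2 * real i))"
        using elim by (intro mult_left_mono) auto
      also have "2 powr (- (\<eta> / 2 * real i)) = (2 powr (- (\<eta> / 2))) ^ i"
        by (simp add: powr_realpow[symmetric] powr_powr)
      finally show ?case .
    qed
    have "2 powr (- (\<eta> / 2)) < 2 powr (0 :: real)" using \<eta> by (subst powr_less_cancel_iff) auto
    then show "summable (\<lambda>i. \<bar>C\<bar> * (2 powr (- (\<eta> / 2))) ^ i)"
      by (intro summable_mult summable_geometric) simp
  qed
  ultimately have "summable (\<lambda>i. word_prob (2 ^ Suc i) (\<lambda>w. \<exists>kl\<in>A i. F i (fst kl) (snd kl) w))"
    by (rule summable_comparison_test_ev)
  moreover have "(\<exists>kl\<in>A i. F i (fst kl) (snd kl) w) \<longleftrightarrow>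
      \<not> (\<forall>k l. k \<le> l \<and> rate CARD('d) p (real k) (real l) \<le> (1 - \<delta>) * (real i * ln 2) \<longrightarrow> \<not> F i k l w)" for i w
    unfolding A_def by auto
  ultimately have "summable (\<lambda>i. word_prob (2 ^ Suc i) (\<lambda>w.
      \<not> (\<forall>k l. k \<le> l \<and> rate CARD('d) p (real k) (real l) \<le> (1 - \<delta>) * (real i * ln 2) \<longrightarrow> \<not> F i k l w)))"
    by (simp only:)
  then show ?thesis by (simp only: F_def not_not)
qed

text \<open>Level \<open>i\<close> covers all times up to 2^(i + 1) with the threshold of time 2^i,
  so the times in between need no interpolation.\<close>

lemma upper_bound_summable:
  fixes u :: "int ^ 'd" and \<epsilon> :: real
  assumes d: "CARD('d) \<ge> 4" and u: "u \<in> unit_steps" and \<epsilon>: "0 < \<epsilon>"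
  defines "p \<equiv> direct_lim u"
  shows "summable (\<lambda>i. word_prob (2 ^ Suc i) (\<lambda>l. \<not> (\<forall>n\<le>2 ^ Suc i. \<forall>z :: int ^ 'd. z \<notin> unit_ball \<longrightarrow>
    rate CARD('d) p (real (visits {0} (- z) (take n l))) (real (visits unit_steps (- z) (take n l)))
      \<le> (1 + \<epsilon>) * (real i * ln 2))))"
proof -
  obtain \<gamma> where \<gamma>: "0 < \<gamma>" "\<gamma> \<le> 1"
    "\<And>n u. u \<in> unit_steps \<Longrightarrow> \<gamma> \<le> word_prob n (\<lambda>l :: (int ^ 'd) list. visits unit_ball u l = 0)"
    using escape_probability[OF d] by metis
  define a where "a = 1 / (2 * real CARD('d))"
  have q: "a + p < 1"
    using direct_lim_le_escape[OF u \<gamma>(3)[OF u]] \<gamma>(1) by (simp add: p_def a_def)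
  \<comment> \<open>Half of the surplus \<epsilon> pays for the exponent 1 - s in the tail sum; the
    other half beats the order 2^i of the number of entrances.\<close>
  define s where "s = \<epsilon> / (2 * (1 + \<epsilon>))"
  have s: "0 < s" "s < 1" using \<epsilon> by (simp_all add: s_def field_simps)
  have s_eq: "(1 - s) * (1 + \<epsilon>) = 1 + \<epsilon> / 2" using \<epsilon> by (simp add: s_def field_simps)
  define C where "C = 2 * real CARD('d) * 2 * ((1 / p + 1 / a) / (1 - (a + p) powr s)\<^sup>2)"
  let ?Q = "\<lambda>i l. \<not> (\<forall>n\<le>2 ^ Suc i. \<forall>z :: int ^ 'd. z \<notin> unit_ball \<longrightarrow>
    rate CARD('d) p (real (visits {0} (- z) (take n l))) (real (visits unit_steps (- z) (take n l)))
      \<le> (1 + \<epsilon>) * (real i * ln 2))"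
  have bound: "word_prob (2 ^ Suc i) (?Q i) \<le> C * (2 powr (- (\<epsilon> / 2))) ^ i" for i
  proof -
    define c where "c = (1 + \<epsilon>) * (real i * ln 2)"
    have c: "0 \<le> c" using \<epsilon> by (simp add: c_def)
    have "word_prob (2 ^ Suc i) (?Q i) \<le>
      2 * real CARD('d) * real (2 ^ Suc i) * ((1 / p + 1 / a) * (exp (- (1 - s) * c) / (1 - (a + p) powr s)\<^sup>2))"
      unfolding c_def[symmetric]
      by (rule order_trans[OF word_prob_mono upper_bound_prob[OF u, folded p_def a_def, OF q s c, of "2 ^ Suc i"]])
        (metis not_le)
    also have "exp (- (1 - s) * c) = 2 powr (- (1 + \<epsilon> / 2) * real i)"
    proof -
      have "- (1 - s) * c = - ((1 - s) * (1 + \<epsilon>)) * (real i * ln 2)" by (simp add: c_def algebra_simps)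
      then show ?thesis unfolding s_eq by (simp add: powr_def mult_ac)
    qed
    also have "2 * real CARD('d) * real (2 ^ Suc i) *
        ((1 / p + 1 / a) * (2 powr (- (1 + \<epsilon> / 2) * real i) / (1 - (a + p) powr s)\<^sup>2)) =
        C * (2 ^ i * 2 powr (- (1 + \<epsilon> / 2) * real i))"
      by (simp add: C_def)
    also have "2 ^ i * 2 powr (- (1 + \<epsilon> / 2) * real i) = (2 powr (- (\<epsilon> / 2))) ^ i"
    proof -
      have "(2 powr (- (\<epsilon> / 2))) ^ i = 2 powr (- (\<epsilon> / 2) * real i)"
        by (simp add: powr_realpow[symmetric] powr_powr)
      moreover have "(2 :: real) ^ i = 2 powr real i" by (simp add: powr_realpow)
      moreover have "real i + - (1 + \<epsilon> / 2) * real i = - (\<epsilon> / 2) * real i" by (simp add: algebra_simps)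
      ultimately show ?thesis by (simp only: powr_add[symmetric])
    qed
    finally show ?thesis .
  qed
  have "summable (\<lambda>i. C * (2 powr (- (\<epsilon> / 2))) ^ i)"
  proof -
    have "2 powr (- (\<epsilon> / 2)) < 2 powr (0 :: real)" using \<epsilon> by (subst powr_less_cancel_iff) auto
    then show ?thesis by (intro summable_mult summable_geometric) simp
  qed
  then show ?thesis
  proof (rule summable_comparison_test'[where N = 0])
    fix i
    show "norm (word_prob (2 ^ Suc i) (?Q i)) \<le> C * (2 powr (- (\<epsilon> / 2))) ^ i"
      using bound[of i] word_prob_nonneg[of "2 ^ Suc i" "?Q i"] by (simp only: real_norm_def abs_of_nonneg)
  qed
qed

context simple_random_walk
begin

section \<open>Borel-Cantelli and transience of the path\<close>

lemma borel_cantelli_words: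
  assumes "summable (\<lambda>i. word_prob (H i) (\<lambda>w. \<not> Q i w))"
  shows "AE \<omega> in M. \<forall>\<^sub>F i in sequentially. Q i (steps_word (\<lambda>k. X k \<omega>) (H i))"
proof -
  let ?A = "\<lambda>i. {\<omega> \<in> space M. \<not> Q i (steps_word (\<lambda>k. X k \<omega>) (H i))}"
  have "summable (\<lambda>i. measure M (?A i))"
    unfolding prob_word[of "\<lambda>w. \<not> Q _ w"] by (rule assms)
  then have "AE \<omega> in M. \<forall>\<^sub>F i in sequentially. \<omega> \<in> space M - ?A i"
    by (intro borel_cantelli_AE1 word_event) (auto simp: emeasure_eq_measure)
  then show ?thesis
  proof eventually_elim
    case (elim \<omega>)
    then show ?case by (rule eventually_mono) auto
  qed
qed

lemma transient:
  assumes d: "CARD('d) \<ge> 4"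
  shows "AE \<omega> in M. \<forall>y. \<forall>\<^sub>F n in sequentially. walk 0 (\<lambda>k. X k \<omega>) n \<noteq> y"
proof (subst AE_all_countable, intro allI)
  fix y :: "int ^ 'd"
  have "summable (\<lambda>n. inverse (real n ^ 2))"
    by (rule inverse_power_summable) simp
  then have "summable (\<lambda>n. 1 / (real n + 1)\<^sup>2)"
    by (subst (asm) summable_Suc_iff[symmetric]) (simp add: inverse_eq_divide add.commute)
  then have "summable (\<lambda>n. 18 * real CARD('d) ^ 3 * (1 / (real n + 1)\<^sup>2))"
    by (rule summable_mult)
  then have "summable (\<lambda>n. word_prob n (\<lambda>l. \<not> (0 + sum_list l \<noteq> y)))"
  proof (rule summable_comparison_test'[where N = 0])
    fix n
    show "norm (word_prob n (\<lambda>l. \<not> (0 + sum_list l \<noteq> y))) \<le> 18 * real CARD('d) ^ 3 * (1 / (real n + 1)\<^sup>2)"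
      using heat_kernel_bound[OF d, of n 0 y] word_prob_nonneg[of n "\<lambda>l. 0 + sum_list l = y"] by simp
  qed
  then have "AE \<omega> in M. \<forall>\<^sub>F n in sequentially. 0 + sum_list (steps_word (\<lambda>k. X k \<omega>) n) \<noteq> y"
    by (rule borel_cantelli_words)
  then show "AE \<omega> in M. \<forall>\<^sub>F n in sequentially. walk 0 (\<lambda>k. X k \<omega>) n \<noteq> y"
    by (simp add: walk_eq)
qed

end

text \<open>For centres near the start this replaces the union bound over entrances: a constant pair
  of counts has constant rate, which log n eventually exceeds.\<close>

lemma visits_eventually_constant:
  fixes x :: "nat \<Rightarrow> int ^ 'd"
  assumes "finite A" "\<And>y. \<forall>\<^sub>F n in sequentially. walk 0 x n \<noteq> y"
  shows "\<exists>m. \<forall>\<^sub>F n in sequentially. visits A z (steps_word x n) = m"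
proof -
  have "\<forall>\<^sub>F n in sequentially. \<forall>y\<in>(\<lambda>v. v - z) ` A. walk 0 x n \<noteq> y"
    using assms by (intro eventually_ball_finite) auto
  then obtain n0 where n0: "\<And>n. n \<ge> n0 \<Longrightarrow> \<forall>y\<in>(\<lambda>v. v - z) ` A. walk 0 x n \<noteq> y"
    unfolding eventually_sequentially by blast
  have "visits A z (steps_word x n) = visits A z (steps_word x n0)" if "n \<ge> n0" for n
    using that
  proof (induction n rule: dec_induct)
    case (step n)
    have "walk 0 x (Suc n) \<noteq> (z + walk 0 x (Suc n)) - z \<or> z + walk 0 x (Suc n) \<notin> A"
      using n0[of "Suc n"] step by auto
    then have "z + sum_list (steps_word x (Suc n)) \<notin> A" by (simp add: walk_eq)
    moreover have "steps_word x (Suc n) = steps_word x n @ [x (Suc n)]" by (simp add: steps_word_def)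
    ultimately show ?case using step by (simp add: visits_append add.assoc)
  qed simp
  then show ?thesis unfolding eventually_sequentially by blast
qed

text \<open>Includes \<epsilon> \<ge> 1, where the scaling factor is not positive and (0, 0) is the
  only pair of natural numbers in the scaled region.\<close>

lemma scaled_limit_region_le:
  assumes d: "0 < d" and p: "0 < p" and c: "c \<le> c'" "0 \<le> c'"
    and mem: "(real k, real l) \<in> (*\<^sub>R) c ` limit_region d p"
  shows "k \<le> l \<and> rate d p (real k) (real l) \<le> c'"
proof (cases "0 < c")
  case True
  then show ?thesis using mem c by (simp add: scaled_limit_region[OF d p])
next
  case False
  obtain x y where xy: "real k = c * x" "real l = c * y" "x \<le> y" "0 \<le> x"
    using mem unfolding image_iff by (force simp: mem_limit_region)
  have "c * x \<le> 0" "c * y \<le> 0" using False xy(3,4) by (simp_all add: mult_nonpos_nonneg)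
  then have "k = 0" "l = 0" using xy(1,2) by simp_all
  then show ?thesis using c by simp
qed

theorem theorem1p3:
  fixes M :: "'a measure" and X :: "nat \<Rightarrow> 'a \<Rightarrow> int ^ 'd" and j :: 'd and \<epsilon> :: real
  defines "S \<equiv> \<lambda>\<omega>. walk 0 (\<lambda>k. X k \<omega>)"
    and "D \<equiv> limit_region CARD('d) (sphere_before_origin_prob (axis j 1 :: int ^ 'd))"
  assumes "simple_random_walk M X"
    and "CARD('d) \<ge> 4"
    and "\<epsilon> > 0"
  shows "AE \<omega> in M. \<exists>n0. \<forall>n\<ge>n0.
           (\<forall>z. (real (local_time (S \<omega>) z n), real (sphere_occupation_time (S \<omega>) z n))
                  \<in> (*\<^sub>R) ((1 + \<epsilon>) * ln (real n)) ` D) \<and>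
           (\<forall>k l :: nat. (real k, real l) \<in> (*\<^sub>R) ((1 - \<epsilon>) * ln (real n)) ` D \<longrightarrow>
              (\<exists>z. (local_time (S \<omega>) z n, sphere_occupation_time (S \<omega>) z n) = (k, l + 1)))"
proof -
  interpret simple_random_walk M X by fact
  note d4 = \<open>CARD('d) \<ge> 4\<close>
  define u where "u = (axis j 1 :: int ^ 'd)"
  have u: "u \<in> unit_steps" by (simp add: u_def)
  define p where "p = direct_lim u"
  have D: "D = limit_region CARD('d) p"
    by (simp add: D_def sphere_before_origin_prob_eq p_def u_def)
  have p: "0 < p" unfolding p_def by (rule direct_lim_pos[OF u])
  have d: "0 < CARD('d)" by simp
  \<comment> \<open>The gap between 1 - 2 \<delta> and 1 - \<delta> absorbs the difference between
    log n and the smaller i log 2; the minimum with 1 keeps both factors nonnegative for large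
    \<epsilon>.\<close>
  define \<delta> where "\<delta> = min \<epsilon> 1 / 2"
  have \<delta>: "0 < \<delta>" "\<delta> \<le> 1 / 2" "1 - \<epsilon> \<le> 1 - 2 * \<delta>" using \<open>\<epsilon> > 0\<close> by (auto simp: \<delta>_def)
  let ?r = "\<lambda>z w. rate CARD('d) p (real (visits {0} (- z) w)) (real (visits unit_steps (- z) w))"
  let ?hit = "\<lambda>k l n w. \<exists>z :: int ^ 'd. visits {0} (- z) (take n w) = k \<and> visits unit_steps (- z) (take n w) = Suc l"
  have upper: "AE \<omega> in M. \<forall>\<^sub>F i in sequentially. \<forall>n\<le>2 ^ Suc i. \<forall>z :: int ^ 'd. z \<notin> unit_ball \<longrightarrow>
      ?r z (take n (steps_word (\<lambda>k. X k \<omega>) (2 ^ Suc i))) \<le> (1 + \<epsilon>) * (real i * ln 2)"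
    unfolding p_def by (rule borel_cantelli_words[OF upper_bound_summable[OF d4 u \<open>\<epsilon> > 0\<close>]])
  have lower: "AE \<omega> in M. \<forall>\<^sub>F i in sequentially.
      \<forall>k l. k \<le> l \<and> rate CARD('d) p (real k) (real l) \<le> (1 - \<delta>) * (real i * ln 2) \<longrightarrow>
      (\<forall>n. 2 ^ i \<le> n \<and> n \<le> 2 ^ Suc i \<longrightarrow> ?hit k l n (steps_word (\<lambda>k. X k \<omega>) (2 ^ Suc i)))"
    unfolding p_def using \<delta> by (intro borel_cantelli_words lower_bound_summable[OF d4 u]) auto
  show ?thesis
    using AE_unit_steps transient[OF d4] upper lower
  proof eventually_elim
    case (elim \<omega>)
    define W where "W n = steps_word (\<lambda>k. X k \<omega>) n" for n
    have steps: "set (W n) \<subseteq> unit_steps" for n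
      using elim(1) by (auto simp: W_def steps_word_def)
    have transient_path: "\<forall>\<^sub>F n in sequentially. walk 0 (\<lambda>k. X k \<omega>) n \<noteq> y" for y
      using elim(2) by blast
    \<comment> \<open>The threshold depends on \<open>z\<close>, which is harmless for the finitely
      many centres whose ball contains the starting point.\<close>
    have near: "\<forall>\<^sub>F n in sequentially. ?r z (W n) \<le> (1 + \<epsilon>) * ln (real n)" for z :: "int ^ 'd"
    proof -
      obtain a b where "\<forall>\<^sub>F n in sequentially. visits {0} (- z) (W n) = a"
        "\<forall>\<^sub>F n in sequentially. visits unit_steps (- z) (W n) = b"
        unfolding W_def
        using visits_eventually_constant[OF _ transient_path, of "{0}" "- z"]
          visits_eventually_constant[OF _ transient_path, of unit_steps "- z"] by auto
      moreover have "\<forall>\<^sub>F n in sequentially. rate CARD('d) p (real a) (real b) \<le> (1 + \<epsilon>) * ln (real n)"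
        using \<open>\<epsilon> > 0\<close> by real_asymp
      ultimately show ?thesis by eventually_elim simp
    qed
    \<comment> \<open>That the walk is not at \<open>z\<close> at time \<open>n\<close> gives k
      \<le> l for these centres, by \<open>visits_origin_le_away\<close>.\<close>
    have away: "\<forall>\<^sub>F n in sequentially. \<forall>z\<in>unit_ball. walk 0 (\<lambda>k. X k \<omega>) n \<noteq> z \<and> ?r z (W n) \<le> (1 + \<epsilon>) * ln (real n)"
      using transient_path near by (intro eventually_ball_finite ballI eventually_conj) auto
    obtain i0 where i0: "\<And>i. i \<ge> i0 \<Longrightarrow> \<forall>n\<le>2 ^ Suc i. \<forall>z :: int ^ 'd. z \<notin> unit_ball \<longrightarrow>
        ?r z (take n (W (2 ^ Suc i))) \<le> (1 + \<epsilon>) * (real i * ln 2)"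
      using elim(3) unfolding eventually_sequentially W_def by blast
    obtain i1 where i1: "\<And>i. i \<ge> i1 \<Longrightarrow>
        \<forall>k l. k \<le> l \<and> rate CARD('d) p (real k) (real l) \<le> (1 - \<delta>) * (real i * ln 2) \<longrightarrow>
        (\<forall>n. 2 ^ i \<le> n \<and> n \<le> 2 ^ Suc i \<longrightarrow> ?hit k l n (W (2 ^ Suc i)))"
      using elim(4) unfolding eventually_sequentially W_def by blast
    define i2 where "i2 = max (max i0 i1) (nat \<lceil>1 / \<delta>\<rceil>)"
    have "\<forall>\<^sub>F n in sequentially. 2 ^ i2 \<le> n \<and> 2 \<le> n"
      by (intro eventually_conj eventually_ge_at_top)
    with away have "\<forall>\<^sub>F n in sequentially.
           (\<forall>z. (real (local_time (S \<omega>) z n), real (sphere_occupation_time (S \<omega>) z n))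
                  \<in> (*\<^sub>R) ((1 + \<epsilon>) * ln (real n)) ` D) \<and>
           (\<forall>k l :: nat. (real k, real l) \<in> (*\<^sub>R) ((1 - \<epsilon>) * ln (real n)) ` D \<longrightarrow>
              (\<exists>z. (local_time (S \<omega>) z n, sphere_occupation_time (S \<omega>) z n) = (k, l + 1)))"
    proof eventually_elim
      case (elim n)
      have n: "2 ^ i2 \<le> n" "2 \<le> n" using elim by auto
      have lnn: "0 < ln (real n)" using n by simp
      obtain i where i: "2 ^ i \<le> n" "n < 2 ^ Suc i"
        using ex_power_ivl1[of 2 n] n by auto
      have "i2 \<le> i"
      proof (rule ccontr)
        assume "\<not> i2 \<le> i"
        then have "(2 :: nat) ^ Suc i \<le> 2 ^ i2" by (intro power_increasing) auto
        then show False using i n by linarith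
      qed
      then have ii: "i0 \<le> i" "i1 \<le> i" "1 / \<delta> \<le> real i" by (auto simp: i2_def)
      have ln_n: "real i * ln 2 \<le> ln (real n)" "ln (real n) \<le> (real i + 1) * ln 2"
      proof -
        have "ln (real (2 ^ i)) \<le> ln (real n)" using i n by (subst ln_le_cancel_iff) (auto simp del: of_nat_power)
        then show "real i * ln 2 \<le> ln (real n)" by (simp add: ln_realpow)
        have "ln (real n) \<le> ln (real (2 ^ Suc i))" using i n by (subst ln_le_cancel_iff) (auto simp del: of_nat_power power_Suc)
        then show "ln (real n) \<le> (real i + 1) * ln 2" by (simp add: ln_realpow ln_mult algebra_simps)
      qed
      have Wn: "take n (W (2 ^ Suc i)) = W n"
        unfolding W_def using i by (intro take_steps_word) simp
      have eqs: "local_time (S \<omega>) z n = visits {0} (- z) (W n)"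
        "sphere_occupation_time (S \<omega>) z n = visits unit_steps (- z) (W n)" for z
        by (simp_all add: S_def W_def local_time_eq_visits sphere_occupation_time_eq_visits)
      have part1: "(real (visits {0} (- z) (W n)), real (visits unit_steps (- z) (W n)))
          \<in> (*\<^sub>R) ((1 + \<epsilon>) * ln (real n)) ` D" for z
      proof -
        have "visits {0} (- z) (W n) \<le> visits unit_steps (- z) (W n) \<and> ?r z (W n) \<le> (1 + \<epsilon>) * ln (real n)"
        proof (cases "z \<in> unit_ball")
          case True
          then have "- z + sum_list (W n) \<noteq> 0" "?r z (W n) \<le> (1 + \<epsilon>) * ln (real n)"
            using elim by (auto simp: walk_eq W_def[symmetric])
          then show ?thesis using visits_origin_le_away[OF steps, of "- z" n] by simp
        next
          case False
          then have "?r z (W n) \<le> (1 + \<epsilon>) * (real i * ln 2)"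
            using i0[OF ii(1)] i(2) unfolding Wn[symmetric] by (meson less_imp_le)
          also have "\<dots> \<le> (1 + \<epsilon>) * ln (real n)"
            using ln_n(1) \<open>\<epsilon> > 0\<close> by (intro mult_left_mono) auto
          finally show ?thesis using visits_origin_le[OF steps, of "- z" n] False by simp
        qed
        moreover have "0 < (1 + \<epsilon>) * ln (real n)" using lnn \<open>\<epsilon> > 0\<close> by simp
        ultimately show ?thesis unfolding D by (subst scaled_limit_region[OF d p]) auto
      qed
      have part2: "\<exists>z. visits {0} (- z) (W n) = k \<and> visits unit_steps (- z) (W n) = l + 1"
        if "(real k, real l) \<in> (*\<^sub>R) ((1 - \<epsilon>) * ln (real n)) ` D" for k l
      proof -
        have "k \<le> l \<and> rate CARD('d) p (real k) (real l) \<le> (1 - 2 * \<delta>) * ln (real n)"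
          using that \<delta> lnn unfolding D
          by (intro scaled_limit_region_le[OF d p, of "(1 - \<epsilon>) * ln (real n)"]) (auto intro: mult_right_mono)
        moreover have "(1 - 2 * \<delta>) * ln (real n) \<le> (1 - \<delta>) * (real i * ln 2)"
        proof -
          have "(1 - 2 * \<delta>) * ln (real n) \<le> (1 - 2 * \<delta>) * ((real i + 1) * ln 2)"
            using ln_n(2) \<delta> by (intro mult_left_mono) auto
          also have "\<dots> = ((1 - 2 * \<delta>) * (real i + 1)) * ln 2" by simp
          also have "\<dots> \<le> ((1 - \<delta>) * real i) * ln 2"
          proof (rule mult_right_mono)
            have "1 \<le> \<delta> * real i" using ii(3) \<delta> by (simp add: field_simps)
            then show "(1 - 2 * \<delta>) * (real i + 1) \<le> (1 - \<delta>) * real i"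
              using \<delta> by (simp add: algebra_simps)
          qed simp
          finally show ?thesis by simp
        qed
        ultimately have "k \<le> l \<and> rate CARD('d) p (real k) (real l) \<le> (1 - \<delta>) * (real i * ln 2)" by linarith
        then have "?hit k l n (W (2 ^ Suc i))" using i1[OF ii(2)] i by (meson less_imp_le)
        then show ?thesis unfolding Wn by simp
      qed
      show ?case unfolding eqs using part1 part2 by auto
    qed
    then show ?case by (simp only: eventually_sequentially)
  qed
qed

end
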